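(* There is a unique Laurent series $\zeta_{\mathcal{E}/\hat{R}}(t)\in \frac1t+\hat{R}[[t]]$, odd under $t\mapsto -t$, such that $D(\zeta_{\mathcal{E}/\hat{R}}(t))+x(t)=\beta$ for some element $\beta\in\hat{R}$.
   Context: Let $p>3$ be a prime. Let $A_4,A_6$ be independent indeterminates and $R=\mathbb{Z}[\tfrac16][A_4,A_6]$, graded so that $A_4,A_6$ have weights $4,6$. Let $f(x)=x^3+A_4x+A_6$ and let $\mathcal{E}$ be the projective closure over $R$ of the curve $y^2=f(x)$, with origin $O$ the point at infinity. Let $H\in R$ be the coefficient of $x^{p-1}$ in $f(x)^{(p-1)/2}$. Let $R_H=R[1/H]$ and $\hat{R}=\varprojlim_n R_H/p^nR_H$. Let $t=-x/y$ and $\omega=dx/(2y)$. At $O$ one has expansions $x(t)\in t^{-2}+R[[t]]$, $y(t)\in -t^{-3}+R[[t]]$ and $\omega=W(t)\,dt$ with $W(t)\in 1+R[[t]]$. Let $D$ be the derivation $Dh=dh/\omega$; on Laurent series $h(t)$ over $\hat{R}$ this is $Dh=(dh/dt)/W(t)$, and on functions it is the derivation over $R$ with $Dx=2y$. *)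

theory Defs
  imports
    "HOL-Algebra.QuotRing"
    "HOL-Computational_Algebra.Computational_Algebra"
begin

section \<open>The ring $R = \mathbf{Z}[1/6][A_4, A_6]$\<close>

typedef zsixth = "{q :: rat. \<exists>(a::int) (k::nat). q = of_int a / 6 ^ k}"
  morphisms rat_of_zsixth Abs_zsixth
  by (rule exI[of _ 0]) (auto intro!: exI[of _ 0])

setup_lifting type_definition_zsixth

instantiation zsixth :: idom
begin

lift_definition zero_zsixth :: zsixth is 0
  by (auto intro!: exI[of _ 0])

lift_definition one_zsixth :: zsixth is 1
  by (rule exI[of _ 1], rule exI[of _ 0]) simp

lift_definition plus_zsixth :: "zsixth \<Rightarrow> zsixth \<Rightarrow> zsixth" is "(+)"
proof -
  fix q r :: rat
  assume "\<exists>(a::int) (k::nat). q = of_int a / 6 ^ k" "\<exists>(a::int) (k::nat). r = of_int a / 6 ^ k"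
  then obtain a b :: int and k l :: nat where "q = of_int a / 6 ^ k" "r = of_int b / 6 ^ l"
    by blast
  hence "q + r = of_int (a * 6 ^ l + b * 6 ^ k) / 6 ^ (k + l)"
    by (simp add: power_add add_divide_distrib)
  thus "\<exists>(a::int) (k::nat). q + r = of_int a / 6 ^ k" by blast
qed

lift_definition uminus_zsixth :: "zsixth \<Rightarrow> zsixth" is uminus
proof -
  fix q :: rat
  assume "\<exists>(a::int) (k::nat). q = of_int a / 6 ^ k"
  then obtain a :: int and k :: nat where "q = of_int a / 6 ^ k" by blast
  hence "- q = of_int (- a) / 6 ^ k" by simp
  thus "\<exists>(a::int) (k::nat). - q = of_int a / 6 ^ k" by blast
qed

definition minus_zsixth :: "zsixth \<Rightarrow> zsixth \<Rightarrow> zsixth" where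
  "minus_zsixth q r = q + - r"

lift_definition times_zsixth :: "zsixth \<Rightarrow> zsixth \<Rightarrow> zsixth" is "(*)"
proof -
  fix q r :: rat
  assume "\<exists>(a::int) (k::nat). q = of_int a / 6 ^ k" "\<exists>(a::int) (k::nat). r = of_int a / 6 ^ k"
  then obtain a b :: int and k l :: nat where "q = of_int a / 6 ^ k" "r = of_int b / 6 ^ l"
    by blast
  hence "q * r = of_int (a * b) / 6 ^ (k + l)"
    by (simp add: power_add)
  thus "\<exists>(a::int) (k::nat). q * r = of_int a / 6 ^ k" by blast
qed

instance
  by standard (unfold minus_zsixth_def, (transfer, simp add: algebra_simps)+)

end

lemma zsixth_half_exists: "\<exists>h :: zsixth. 2 * h = 1"
proof -
  have "\<exists>h :: zsixth. (1 + 1) * h = 1"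
  proof (transfer, rule bexI[of _ "1 / 2"])
    show "(1 / 2 :: rat) \<in> {q. \<exists>(a::int) (k::nat). q = of_int a / 6 ^ k}"
      by (simp, rule exI[of _ 3], rule exI[of _ 1]) simp
  qed simp
  thus ?thesis by simp
qed

text \<open>The inner variable is $A_4$, the outer one is $A_6$.\<close>

type_synonym R = "zsixth poly poly"

definition A4 :: R where "A4 = [:[:0, 1:]:]"

definition A6 :: R where "A6 = [:0, 1:]"

definition cubic :: "R poly" where "cubic = [:A6, A4, 0, 1:]"

definition hasse :: "nat \<Rightarrow> R" where
  "hasse p = coeff (cubic ^ ((p - 1) div 2)) (p - 1)"


section \<open>The rings $R_H = R[1/H]$ and $\hat R$\<close>

text \<open>
  Since \<open>R\<close> is a domain and \<open>hasse p \<noteq> 0\<close> for primes \<open>p > 3\<close> (lemma \<open>hasse_nonzero\<close> below),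
  the localization is the subring of the fraction field consisting of the $a/H^k$.
\<close>

definition R_H :: "nat \<Rightarrow> R fract ring" where
  "R_H p = \<lparr>carrier = {to_fract a / to_fract (hasse p) ^ k | a k. True},
            monoid.mult = (*), one = 1, zero = 0, add = (+)\<rparr>"

text \<open>
  $\varprojlim_n S/c^nS$. The transition map $S/c^{n+1}S \to S/c^nS$ sends a coset $X$ to the
  coset $c^nS + X$.
\<close>

definition adic_completion :: "('a, 'm) ring_scheme \<Rightarrow> 'a \<Rightarrow> (nat \<Rightarrow> 'a set) ring" where
  "adic_completion S c =
    (let I = (\<lambda>n::nat. PIdl\<^bsub>S\<^esub> (c [^]\<^bsub>S\<^esub> n)) in
     \<lparr>carrier = {s. (\<forall>n. s n \<in> carrier (S Quot I n)) \<and>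
                    (\<forall>n. s n = I n <+>\<^bsub>S\<^esub> s (Suc n))},
      monoid.mult = (\<lambda>r s n. r n \<otimes>\<^bsub>S Quot I n\<^esub> s n),
      one = (\<lambda>n. \<one>\<^bsub>S Quot I n\<^esub>),
      zero = (\<lambda>n. \<zero>\<^bsub>S Quot I n\<^esub>),
      add = (\<lambda>r s n. r n \<oplus>\<^bsub>S Quot I n\<^esub> s n)\<rparr>)"

definition R_hat :: "nat \<Rightarrow> (nat \<Rightarrow> R fract set) ring" where
  "R_hat p = adic_completion (R_H p) (of_nat p)"

definition to_R_hat :: "nat \<Rightarrow> R \<Rightarrow> nat \<Rightarrow> R fract set" where
  "to_R_hat p a = (\<lambda>n. (PIdl\<^bsub>R_H p\<^esub> (of_nat p [^]\<^bsub>R_H p\<^esub> n)) +>\<^bsub>R_H p\<^esub> to_fract a)"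


section \<open>Laurent series over a ring with carrier\<close>

text \<open>The series $\sum_n h_n t^n$ is represented by its coefficient function $h$.\<close>

definition laurent_ring :: "('a, 'm) ring_scheme \<Rightarrow> (int \<Rightarrow> 'a) ring" where
  "laurent_ring S =
    \<lparr>carrier = {h. (\<forall>n. h n \<in> carrier S) \<and> (\<exists>N. \<forall>n<N. h n = \<zero>\<^bsub>S\<^esub>)},
     monoid.mult = (\<lambda>g h n. \<Oplus>\<^bsub>S\<^esub>i\<in>{i. g i \<noteq> \<zero>\<^bsub>S\<^esub> \<and> h (n - i) \<noteq> \<zero>\<^bsub>S\<^esub>}. g i \<otimes>\<^bsub>S\<^esub> h (n - i)),
     one = (\<lambda>n. if n = 0 then \<one>\<^bsub>S\<^esub> else \<zero>\<^bsub>S\<^esub>),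
     zero = (\<lambda>n. \<zero>\<^bsub>S\<^esub>),
     add = (\<lambda>g h n. g n \<oplus>\<^bsub>S\<^esub> h n)\<rparr>"

definition power_series :: "('a, 'm) ring_scheme \<Rightarrow> (int \<Rightarrow> 'a) set" where
  "power_series S = {h. (\<forall>n. h n \<in> carrier S) \<and> (\<forall>n<0. h n = \<zero>\<^bsub>S\<^esub>)}"

definition laurent_const :: "('a, 'm) ring_scheme \<Rightarrow> 'a \<Rightarrow> int \<Rightarrow> 'a" where
  "laurent_const S b = (\<lambda>n. if n = 0 then b else \<zero>\<^bsub>S\<^esub>)"

definition laurent_t_inv :: "('a, 'm) ring_scheme \<Rightarrow> int \<Rightarrow> 'a" where
  "laurent_t_inv S = (\<lambda>n. if n = -1 then \<one>\<^bsub>S\<^esub> else \<zero>\<^bsub>S\<^esub>)"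

text \<open>The substitution $t \mapsto -t$.\<close>

definition laurent_reflect :: "('a, 'm) ring_scheme \<Rightarrow> (int \<Rightarrow> 'a) \<Rightarrow> int \<Rightarrow> 'a" where
  "laurent_reflect S h = (\<lambda>n. if even n then h n else \<ominus>\<^bsub>S\<^esub> h n)"

definition laurent_odd :: "('a, 'm) ring_scheme \<Rightarrow> (int \<Rightarrow> 'a) \<Rightarrow> bool" where
  "laurent_odd S h \<longleftrightarrow> laurent_reflect S h = \<ominus>\<^bsub>laurent_ring S\<^esub> h"

definition laurent_deriv :: "('a, 'm) ring_scheme \<Rightarrow> (int \<Rightarrow> 'a) \<Rightarrow> int \<Rightarrow> 'a" where
  "laurent_deriv S h = (\<lambda>n. add_pow S (n + 1) (h (n + 1)))"


section \<open>Expansions at the origin\<close>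

text \<open>
  The pair of expansions of $x$ and $y$ in the parameter $t = -x/y$ at the point at infinity
  is the unique solution of the curve equation in Laurent series of the following shape.
\<close>

definition expansion_at_O :: "R fls \<Rightarrow> R fls \<Rightarrow> bool" where
  "expansion_at_O x y \<longleftrightarrow>
     (\<exists>g. x = fls_X_inv ^ 2 + fps_to_fls g) \<and>
     (\<exists>g. y = - (fls_X_inv ^ 3) + fps_to_fls g) \<and>
     y ^ 2 = x ^ 3 + fls_const A4 * x + fls_const A6 \<and>
     x = - (fls_X * y)"

definition x_exp :: "R fls" where "x_exp = fst (THE (x, y). expansion_at_O x y)"

definition y_exp :: "R fls" where "y_exp = snd (THE (x, y). expansion_at_O x y)"

text \<open>$W = (dx/dt)/(2y)$ and $1/W$, both in \<open>R\<close>((\<open>t\<close>)).\<close>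

definition W_exp :: "R fls" where "W_exp = (THE W. W * (2 * y_exp) = fls_deriv x_exp)"

definition W_inv_exp :: "R fls" where "W_inv_exp = (THE V. W_exp * V = 1)"

definition expand_R_hat :: "nat \<Rightarrow> R fls \<Rightarrow> int \<Rightarrow> nat \<Rightarrow> R fract set" where
  "expand_R_hat p h = (\<lambda>n. to_R_hat p (fls_nth h n))"

text \<open>$Dh = (dh/dt)/W(t)$ on $\hat R((t))$.\<close>

definition D_hat :: "nat \<Rightarrow> (int \<Rightarrow> nat \<Rightarrow> R fract set) \<Rightarrow> int \<Rightarrow> nat \<Rightarrow> R fract set" where
  "D_hat p h = laurent_deriv (R_hat p) h \<otimes>\<^bsub>laurent_ring (R_hat p)\<^esub> expand_R_hat p W_inv_exp"


section \<open>Well-definedness\<close>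

lemma fls_X_times_X_inv: "fls_X * fls_X_inv = (1 :: 'a :: comm_ring_1 fls)"
  by (simp add: fls_X_times_conv_shift)

lemma fps_X_power_dvd_iff:
  fixes f :: "'a :: comm_ring_1 fps"
  shows "fps_X ^ n dvd f \<longleftrightarrow> (\<forall>i<n. fps_nth f i = 0)"
proof
  assume "fps_X ^ n dvd f"
  thus "\<forall>i<n. fps_nth f i = 0" by (auto simp: dvd_def fps_X_power_mult_nth)
next
  assume *: "\<forall>i<n. fps_nth f i = 0"
  have "f = fps_X ^ n * fps_shift n f"
    by (rule fps_ext) (use * in \<open>auto simp: fps_X_power_mult_nth\<close>)
  thus "fps_X ^ n dvd f" by (metis dvd_triv_left)
qed

lemma fps_fixpoint:
  fixes F :: "'a :: comm_ring_1 fps \<Rightarrow> 'a fps"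
  assumes contr: "\<And>n u v. fps_X ^ n dvd u - v \<Longrightarrow> fps_X ^ Suc n dvd F u - F v"
  shows "\<exists>u. F u = u"
proof -
  define s where "s = (\<lambda>k. (F ^^ k) 0)"
  have sS: "s (Suc k) = F (s k)" for k by (simp add: s_def)
  have step: "fps_X ^ k dvd s (Suc k) - s k" for k
  proof (induction k)
    case (Suc k)
    thus ?case using contr[of k "s (Suc k)" "s k"] by (simp add: sS)
  qed simp
  have far: "fps_X ^ k dvd s m - s k" if "k \<le> m" for k m
    using that
  proof (induction m rule: dec_induct)
    case (step m)
    have "fps_X ^ k dvd s (Suc m) - s m"
      using \<open>\<And>k. fps_X ^ k dvd s (Suc k) - s k\<close>[of m] step(1) by (meson dvd_trans le_imp_power_dvd)
    from dvd_add[OF this step.IH] show ?case by simp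
  qed simp
  define u where "u = Abs_fps (\<lambda>n. fps_nth (s (Suc n)) n)"
  have us: "fps_X ^ k dvd u - s k" for k
    unfolding fps_X_power_dvd_iff
  proof (intro allI impI)
    fix i assume "i < k"
    hence "fps_X ^ Suc i dvd s k - s (Suc i)" by (intro far) auto
    thus "fps_nth (u - s k) i = 0" unfolding fps_X_power_dvd_iff by (auto simp: u_def)
  qed
  have "fps_X ^ Suc k dvd F u - u" for k
  proof -
    have "fps_X ^ Suc k dvd F u - s (Suc k)" using contr[OF us[of k]] by (simp add: sS)
    from dvd_diff[OF this us[of "Suc k"]] show ?thesis by simp
  qed
  hence "fps_nth (F u - u) k = 0" for k
    unfolding fps_X_power_dvd_iff by blast
  hence "F u = u" by (intro fps_ext) simp
  thus ?thesis ..
qed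

lemma expansion_unique_y:
  assumes "expansion_at_O x y" "expansion_at_O x' y'"
  shows "y = y'"
proof -
  define t :: "R fls" where "t = fls_X"
  define s :: "R fls" where "s = fls_X_inv"
  define a b :: "R fls" where "a = fls_const A4" and "b = fls_const A6"
  have ts: "t * s = 1" by (simp add: t_def s_def fls_X_times_X_inv)
  from assms obtain g g' where y: "y = - (s ^ 3) + fps_to_fls g" "y' = - (s ^ 3) + fps_to_fls g'"
    unfolding expansion_at_O_def s_def by blast
  have e: "y ^ 2 = - (t ^ 3 * y ^ 3) - a * t * y + b" "y' ^ 2 = - (t ^ 3 * y' ^ 3) - a * t * y' + b"
    using assms unfolding expansion_at_O_def t_def a_def b_def
    by (simp_all add: power_mult_distrib mult.assoc)
  define q where "q = y + y' + t ^ 3 * (y ^ 2 + y * y' + y' ^ 2) + a * t"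
  have "(y - y') * q = 0"
    using e unfolding q_def by Groebner_Basis.algebra
  moreover have "q \<noteq> 0"
  proof
    assume "q = 0"
    define G G' where "G = fps_to_fls g" and "G' = fps_to_fls g'"
    have "t ^ 3 * q = t ^ 3 * G + t ^ 3 * G' + 1 - 3 * (t ^ 3 * G) - 3 * (t ^ 3 * G')
        + t ^ 6 * (G ^ 2 + G * G' + G' ^ 2) + a * t ^ 4"
      using ts unfolding q_def y G_def[symmetric] G'_def[symmetric] by Groebner_Basis.algebra
    also have "\<dots> = fps_to_fls (1 + fps_X * (fps_X ^ 2 * g + fps_X ^ 2 * g' - 3 * (fps_X ^ 2 * g)
        - 3 * (fps_X ^ 2 * g') + fps_X ^ 5 * (g ^ 2 + g * g' + g' ^ 2) + fps_const A4 * fps_X ^ 3))"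
      unfolding t_def G_def G'_def a_def
      by (simp add: fls_times_fps_to_fls fps_to_fls_power flip: fps_const_to_fls)
         (simp add: algebra_simps eval_nat_numeral)
    finally have "fps_to_fls (1 + fps_X * (fps_X ^ 2 * g + fps_X ^ 2 * g' - 3 * (fps_X ^ 2 * g)
        - 3 * (fps_X ^ 2 * g') + fps_X ^ 5 * (g ^ 2 + g * g' + g' ^ 2) + fps_const A4 * fps_X ^ 3)) = 0"
      using \<open>q = 0\<close> by simp
    hence "1 + fps_X * (fps_X ^ 2 * g + fps_X ^ 2 * g' - 3 * (fps_X ^ 2 * g)
        - 3 * (fps_X ^ 2 * g') + fps_X ^ 5 * (g ^ 2 + g * g' + g' ^ 2) + fps_const A4 * fps_X ^ 3) = 0"
      by (simp only: fps_to_fls_eq_0_iff)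
    from arg_cong[OF this, of "\<lambda>h. fps_nth h 0"] show False by simp
  qed
  ultimately show ?thesis by simp
qed

lemma expansion_exists:
  "\<exists>x y u. expansion_at_O x y \<and> y * fps_to_fls u = - (fls_X_inv ^ 3) \<and> fps_nth u 0 = 1"
proof -
  define F :: "R fps \<Rightarrow> R fps" where
    "F = (\<lambda>u. 1 + fps_const A4 * fps_X ^ 4 * u ^ 2 + fps_const A6 * fps_X ^ 6 * u ^ 3)"
  have "\<exists>u. F u = u"
  proof (rule fps_fixpoint)
    fix n u v assume *: "(fps_X :: R fps) ^ n dvd u - v"
    have "F u - F v = fps_X * (u - v) * (fps_const A4 * fps_X ^ 3 * (u + v)
            + fps_const A6 * fps_X ^ 5 * (u ^ 2 + u * v + v ^ 2))"
      unfolding F_def by Groebner_Basis.algebra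
    thus "fps_X ^ Suc n dvd F u - F v" using * by (simp add: mult_dvd_mono dvd_mult2)
  qed
  then obtain u where u: "F u = u" ..
  have u0: "fps_nth u 0 = 1" by (subst u[symmetric]) (simp add: F_def mult.assoc)
  obtain v where uv: "u * v = 1"
    using fps_right_inverse[of u 1] u0 by auto
  define E where "E = fps_const A4 * u ^ 2 + fps_const A6 * fps_X ^ 2 * u ^ 3"
  have "u = 1 + fps_X ^ 4 * E"
    using u unfolding F_def E_def by (simp add: algebra_simps eval_nat_numeral)
  hence "v + fps_X ^ 3 * (fps_X * v * E) = u * v"
    by (simp add: algebra_simps eval_nat_numeral)
  hence v: "v = 1 + fps_X ^ 3 * (- (fps_X * v * E))"
    using uv by (simp add: eq_diff_eq)
  define c where "c = - (fps_X * v * E)"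
  have v': "v = 1 + fps_X ^ 3 * c" using v by (simp only: c_def)
  define s t a b :: "R fls" where "s = fls_X_inv" and "t = fls_X"
    and "a = fls_const A4" and "b = fls_const A6"
  have ts: "t * s = 1" by (simp add: t_def s_def fls_X_times_X_inv)
  define U V C where "U = fps_to_fls u" and "V = fps_to_fls v" and "C = fps_to_fls c"
  have UV: "U * V = 1"
    using arg_cong[OF uv, of fps_to_fls] by (simp add: fls_times_fps_to_fls U_def V_def)
  have VC: "V = 1 + t ^ 3 * C"
    using arg_cong[OF v', of fps_to_fls]
    by (simp add: fls_times_fps_to_fls fps_to_fls_power V_def C_def t_def)
  have UF: "U = 1 + a * t ^ 4 * U ^ 2 + b * t ^ 6 * U ^ 3"
    using arg_cong[OF u, of fps_to_fls] unfolding F_def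
    by (simp add: fls_times_fps_to_fls fps_to_fls_power U_def t_def a_def b_def
             flip: fps_const_to_fls)
  have V3: "V ^ 2 = V ^ 3 + a * t ^ 4 * V + b * t ^ 6"
    using UF UV by Groebner_Basis.algebra
  define x y where "x = s ^ 2 * V" and "y = - (s ^ 3) * V"
  have x1: "x = s ^ 2 + t * C" and y1: "y = - (s ^ 3) + (- C)"
    using VC ts unfolding x_def y_def by Groebner_Basis.algebra+
  have x2: "x = s ^ 2 + fps_to_fls (fps_X * c)" and y2: "y = - (s ^ 3) + fps_to_fls (- c)"
    using x1 y1 by (simp_all add: fls_times_fps_to_fls t_def C_def)
  have "y ^ 2 = x ^ 3 + a * x + b" and "x = - (t * y)"
    using V3 ts unfolding x_def y_def by Groebner_Basis.algebra+
  hence "expansion_at_O x y"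
    unfolding expansion_at_O_def s_def[symmetric] t_def[symmetric] a_def[symmetric] b_def[symmetric]
    using x2 y2 by blast
  moreover have "y * fps_to_fls u = - (fls_X_inv ^ 3)"
    using UV unfolding y_def U_def[symmetric] s_def[symmetric] by Groebner_Basis.algebra
  ultimately show ?thesis using u0 by blast
qed

lemma expansion_xy_exp: "expansion_at_O x_exp y_exp"
  and expansion_at_O_unique: "expansion_at_O x y \<Longrightarrow> x = x_exp \<and> y = y_exp"
proof -
  obtain x0 y0 where 0: "expansion_at_O x0 y0" using expansion_exists by blast
  have uniq: "x = x0 \<and> y = y0" if *: "expansion_at_O x y" for x y
  proof -
    have "x = - (fls_X * y)" "x0 = - (fls_X * y0)"
      using * 0 unfolding expansion_at_O_def by blast+
    with expansion_unique_y[OF * 0] show ?thesis by (simp only: simp_thms)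
  qed
  have "(THE z. case z of (x, y) \<Rightarrow> expansion_at_O x y) = (x0, y0)"
  proof (rule the_equality)
    fix z assume *: "case z of (x, y) \<Rightarrow> expansion_at_O x y"
    show "z = (x0, y0)"
    proof (cases z)
      case (Pair x y)
      with * have "expansion_at_O x y" by (simp only: prod.case)
      from uniq[OF this] Pair show ?thesis by (simp only:)
    qed
  qed (use 0 in \<open>simp only: prod.case\<close>)
  hence eq: "x_exp = x0" "y_exp = y0" by (simp_all add: x_exp_def y_exp_def)
  show "expansion_at_O x_exp y_exp" unfolding eq by (fact 0)
  show "expansion_at_O x y \<Longrightarrow> x = x_exp \<and> y = y_exp" unfolding eq by (fact uniq)
qed

lemma W_exp: "W_exp * (2 * y_exp) = fls_deriv x_exp"
  and W_exp_monic: "\<exists>g. W_exp = 1 + fls_X * fps_to_fls g"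
  and W_inv_exp: "W_exp * W_inv_exp = 1"
proof -
  obtain h0 :: zsixth where h0: "2 * h0 = 1" using zsixth_half_exists ..
  define s t h :: "R fls" where "s = fls_X_inv" and "t = fls_X" and "h = fls_const [:[:h0:]:]"
  have ts: "t * s = 1" by (simp add: t_def s_def fls_X_times_X_inv)
  have h: "2 * h = 1"
  proof -
    have "2 * h = fls_const (2 * [:[:h0:]:])"
      by (simp only: h_def mult_2 fls_plus_const)
    also have "2 * [:[:h0:]:] = [:[:2 * h0:]:]"
      by (simp only: mult_2 add_pCons add_0)
    finally show ?thesis using h0 by (simp add: one_pCons[symmetric])
  qed
  obtain u where u: "y_exp * fps_to_fls u = - (s ^ 3)" "fps_nth u 0 = 1"
    using expansion_exists expansion_at_O_unique unfolding s_def by blast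
  define U where "U = fps_to_fls u"
  have yU: "y_exp * U = - (s ^ 3)" using u(1) by (simp add: U_def)
  from expansion_xy_exp obtain g where g: "x_exp = s ^ 2 + fps_to_fls g"
    unfolding expansion_at_O_def s_def by blast
  define G where "G = fps_to_fls (fps_deriv g)"
  have dx: "fls_deriv x_exp = - 2 * s ^ 3 + G"
    unfolding g G_def
    by (simp add: s_def fls_deriv_fps_to_fls power2_eq_square power3_eq_cube algebra_simps)
  define W where "W = - (fls_deriv x_exp * h * t ^ 3 * U)"
  have W1: "W * (2 * y_exp) = fls_deriv x_exp"
    using h ts yU unfolding W_def by Groebner_Basis.algebra
  have y0: "y_exp \<noteq> 0" using yU by (auto simp: s_def)
  have two0: "(2 :: R fls) \<noteq> 0" using h by auto
  have eqW: "W_exp = W" unfolding W_exp_def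
  proof (rule the_equality)
    fix W' assume "W' * (2 * y_exp) = fls_deriv x_exp"
    hence "W' * (2 * y_exp) = W * (2 * y_exp)" using W1 by simp
    thus "W' = W" using y0 two0 by simp
  qed (fact W1)
  thus "W_exp * (2 * y_exp) = fls_deriv x_exp" using W1 by simp
  define k where "k = fps_const [:[:h0:]:]"
  define w where "w = u - fps_deriv g * k * fps_X ^ 3 * u"
  have "W = U - G * h * t ^ 3 * U"
    using h ts unfolding W_def dx by Groebner_Basis.algebra
  hence Ww: "W = fps_to_fls w"
    by (simp add: w_def U_def G_def t_def h_def k_def fls_times_fps_to_fls fps_to_fls_power
             flip: fps_const_to_fls)
  have w0: "fps_nth w 0 = 1" using u(2) by (simp add: w_def)
  hence w1: "w = 1 + fps_X * fps_shift 1 w"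
    by (intro fps_ext) auto
  have "fps_to_fls w = fps_to_fls (1 + fps_X * fps_shift 1 w)"
    by (rule arg_cong[OF w1])
  also have "\<dots> = 1 + fls_X * fps_to_fls (fps_shift 1 w)"
    by (simp only: fps_to_fls_plus fls_times_fps_to_fls fps_one_to_fls fps_X_to_fls)
  finally have "fps_to_fls w = 1 + fls_X * fps_to_fls (fps_shift 1 w)" .
  thus "\<exists>g. W_exp = 1 + fls_X * fps_to_fls g"
    unfolding eqW Ww by blast
  obtain v where "w * v = 1" using fps_right_inverse[of w 1] w0 by auto
  hence Wv: "W * fps_to_fls v = 1"
    unfolding Ww by (simp flip: fls_times_fps_to_fls)
  have "W \<noteq> 0" using Wv by auto
  have "W_inv_exp = fps_to_fls v" unfolding W_inv_exp_def eqW
  proof (rule the_equality)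
    fix V assume "W * V = 1"
    hence "W * V = W * fps_to_fls v" using Wv by simp
    thus "V = fps_to_fls v" using \<open>W \<noteq> 0\<close> by simp
  qed (fact Wv)
  thus "W_exp * W_inv_exp = 1" using Wv eqW by simp
qed

lemma trinomial_coeff:
  fixes G :: "rat poly"
  defines "G \<equiv> [:1, 1, 0, 1:]"
  shows "coeff (G ^ m) k \<ge> 0" and "m \<ge> 2 \<Longrightarrow> coeff (G ^ m) (2 * m) > 0"
proof -
  have Gnn: "coeff G i \<ge> 0" for i
    by (auto simp: G_def coeff_pCons split: nat.splits)
  have nn: "coeff (G ^ m) k \<ge> 0" for m k
    by (induction m arbitrary: k) (auto simp: coeff_mult intro!: sum_nonneg mult_nonneg_nonneg Gnn)
  thus "coeff (G ^ m) k \<ge> 0" .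
  have two: "coeff (G ^ 2) 4 > 0"
    by (simp add: G_def power2_eq_square numeral_eq_Suc)
  have three: "coeff (G ^ 3) 6 > 0"
    by (simp add: G_def power3_eq_cube numeral_eq_Suc)
  have "coeff (G ^ (n + 2)) (2 * (n + 2)) > 0" for n
  proof (induction n rule: induct_nat_012)
    case 0
    have "0 + 2 = (2::nat)" "2 * 2 = (4::nat)" by simp_all
    thus ?case using two by (simp only:)
  next
    case 1
    have "Suc 0 + 2 = (3::nat)" "2 * 3 = (6::nat)" by simp_all
    thus ?case using three by (simp only: One_nat_def)
  next
    case (ge2 n)
    have eq: "G ^ (Suc (Suc n) + 2) = G ^ 2 * G ^ (n + 2)" by (simp add: power_add[symmetric])
    have "0 < coeff (G ^ 2) 4 * coeff (G ^ (n + 2)) (2 * (Suc (Suc n) + 2) - 4)"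
      using two ge2(1) by simp
    also have "\<dots> \<le> coeff (G ^ (Suc (Suc n) + 2)) (2 * (Suc (Suc n) + 2))"
      unfolding eq coeff_mult by (rule member_le_sum) (simp_all only: mult_nonneg_nonneg nn, simp_all)
    finally show ?case .
  qed
  from this[of "m - 2"] show "m \<ge> 2 \<Longrightarrow> coeff (G ^ m) (2 * m) > 0"
    by (simp only: le_add_diff_inverse2)
qed

lemma hasse_nonzero:
  assumes "prime p" "p > 3"
  shows "hasse p \<noteq> 0"
proof -
  define \<phi> :: "R \<Rightarrow> rat" where "\<phi> = (\<lambda>r. rat_of_zsixth (poly (poly r 1) 1))"
  have \<phi>0: "\<phi> 0 = 0" and \<phi>1: "\<phi> 1 = 1" and \<phi>A: "\<phi> A4 = 1" "\<phi> A6 = 1"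
    by (simp_all add: \<phi>_def A4_def A6_def zero_zsixth.rep_eq one_zsixth.rep_eq)
  have \<phi>add: "\<phi> (a + b) = \<phi> a + \<phi> b" and \<phi>mult: "\<phi> (a * b) = \<phi> a * \<phi> b" for a b
    by (simp_all add: \<phi>_def plus_zsixth.rep_eq times_zsixth.rep_eq)
  have \<phi>sum: "\<phi> (sum f A) = (\<Sum>a\<in>A. \<phi> (f a))" for f and A :: "nat set"
    by (induction A rule: infinite_finite_induct) (simp_all add: \<phi>0 \<phi>add)
  have base: "\<phi> (coeff cubic i) = coeff [:1, 1, 0, 1:] i" for i
    by (auto simp: cubic_def coeff_pCons \<phi>0 \<phi>1 \<phi>A split: nat.splits)
  have main: "\<phi> (coeff (cubic ^ m) k) = coeff ([:1, 1, 0, 1:] ^ m) k" for m k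
    by (induction m arbitrary: k) (simp_all add: coeff_mult \<phi>sum \<phi>mult base \<phi>0 \<phi>1 del: mult_pCons_left)
  have "odd p" using assms by (simp add: prime_odd_nat)
  hence "p - 1 = 2 * ((p - 1) div 2)" and "(p - 1) div 2 \<ge> 2"
    using assms by (auto elim!: oddE)
  hence "\<phi> (hasse p) > 0"
    unfolding hasse_def main using trinomial_coeff(2) by metis
  thus ?thesis using \<phi>0 by auto
qed

end

theory Submission
  imports Defs
begin

text \<open>
  In the parameter $z = x^{-1/2}$, with $w = z^2$ and $g = 1 + A_4 w^2 + A_6 w^3$, one has
  $\omega = S\,dz$ and $x\,\omega = w^{-1} S\,dz$ for $S = g^{-1/2}$. A series $\zeta$ with
  $D\zeta + x = \beta$ exists iff $(\beta - x)\,\omega$ is formally exact, i.e. iff for all $k$ its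
  coefficient at $z^{n-1}$ is divisible by $p^k$ whenever $p^k \mid n$.

  Such a $\beta$ is found by the method of Dwork crystals. Let $T$ be the analogue of $S$ for
  $(A_4^p, A_6^p)$. As $g(w)^p = g^{(p)}(w^p) + p\Delta$, the series $S^p$ expands in powers of
  $p \Delta\, T(w^p)^2$. Hence the Cartier operator, which keeps the coefficients with $p \mid n$, maps the
  module spanned by $S$ and the $p^{m-1} Q S^{2m+1}$ with $m \ge 1$, $\deg Q \le 3m$ into multiples
  of $T$ plus $p$ times the same module for $T$; it sends $S$ to $H T$ and $w^{-1}S$ to some $c\,T$
  modulo $p$. Since $H$ is invertible, $x\omega$ can be corrected by a multiple of $\omega$,
  one power of $p$ at a time, so that the $k$-th Cartier iterate is divisible by $p^k$.

  Formal exactness does not depend on the parameter, so this carries over from $z$ to $t$.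
  Uniqueness holds because the coefficient of $\omega$ at $z^{p^k - 1}$ is a unit modulo $p$.
\<close>

section \<open>Power series\<close>

text \<open>Poles and denominators are kept out of the congruences. Substitution works for power
  series, but x omega has a double pole; so dt/t^2 is split off in the parameter t, and the rest E
  dt is a power series form. Since 1/t = z^-1 (g S)(z^2), one has E dt = z^-2 S(z^2) dz + d(1/t),
  and the exact term d(1/t) does not disturb the criterion. As H is not invertible in R, the
  congruences over R carry a factor H^m, and beta is approximated by v / H^m only in R_H. The
  expansion of S^p is infinite, but its r-th term carries p^r, so it is finite modulo p^k. Each
  Cartier step uses up one unit of the truncation level k, which is why statements about iterates
  are proved for all k at once. Finally, dividing by n = p^v n' costs v powers of p, so a
  coefficient of zeta at level N is computed from beta at level N + v.\<close>

definition fps_deg_le :: "'a::zero fps \<Rightarrow> nat \<Rightarrow> bool" where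
  "fps_deg_le f d \<longleftrightarrow> (\<forall>n>d. fps_nth f n = 0)"

lemma fps_deg_le_const: "fps_deg_le (fps_const c) d"
  by (auto simp: fps_deg_le_def)

lemma fps_deg_le_mult:
  fixes f g :: "'a::comm_ring_1 fps"
  assumes "fps_deg_le f d" "fps_deg_le g e"
  shows "fps_deg_le (f * g) (d + e)"
  unfolding fps_deg_le_def
proof (intro allI impI)
  fix n assume n: "d + e < n"
  show "fps_nth (f * g) n = 0"
    unfolding fps_mult_nth
  proof (intro sum.neutral ballI)
    fix i assume "i \<in> {0..n}"
    show "fps_nth f i * fps_nth g (n - i) = 0"
    proof (cases "i > d")
      case False
      hence "n - i > e" using n by linarith
      thus ?thesis using assms(2) by (simp add: fps_deg_le_def)
    qed (use assms(1) in \<open>simp add: fps_deg_le_def\<close>)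
  qed
qed

lemma fps_deg_le_power:
  fixes f :: "'a::comm_ring_1 fps"
  assumes "fps_deg_le f d"
  shows "fps_deg_le (f ^ n) (n * d)"
proof (induction n)
  case 0
  show ?case using fps_deg_le_const[of 1 0] by simp
next
  case (Suc n)
  from fps_deg_le_mult[OF assms Suc] show ?case by simp
qed

lemma fps_deg_le_0_iff: "fps_deg_le f 0 \<longleftrightarrow> f = fps_const (fps_nth f 0)"
proof
  assume "fps_deg_le f 0"
  thus "f = fps_const (fps_nth f 0)"
    by (intro fps_ext) (auto simp: fps_deg_le_def)
next
  assume "f = fps_const (fps_nth f 0)"
  thus "fps_deg_le f 0" by (metis fps_deg_le_const)
qed

lemma of_nat_dvd_fps_iff:
  fixes f :: "'a::comm_ring_1 fps"
  shows "of_nat n dvd f \<longleftrightarrow> (\<forall>i. of_nat n dvd fps_nth f i)"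
proof
  assume "of_nat n dvd f"
  then obtain e where "f = of_nat n * e" by (elim dvdE)
  thus "\<forall>i. of_nat n dvd fps_nth f i" by (simp add: fps_of_nat[symmetric])
next
  assume "\<forall>i. of_nat n dvd fps_nth f i"
  then obtain e where e: "\<And>i. fps_nth f i = of_nat n * e i" unfolding dvd_def by metis
  have "f = of_nat n * Abs_fps e"
    by (intro fps_ext) (simp add: e fps_of_nat[symmetric])
  thus "of_nat n dvd f" by (metis dvd_triv_left)
qed

section \<open>Binomials modulo p and the series (1 + X)^(-1/2)\<close>

lemma prime_dvd_add_power_diff:
  fixes x y :: "'a::comm_ring_1"
  assumes "prime p"
  shows "of_nat p dvd (x + y) ^ p - (x ^ p + y ^ p)"
proof -
  have p: "p > 0" using assms by (simp add: prime_gt_0_nat)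
  have "(x + y) ^ p = (\<Sum>k\<le>p. of_nat (p choose k) * x ^ k * y ^ (p - k))"
    by (rule binomial_ring)
  also have "{..p} = insert 0 (insert p {0<..<p})" using p by auto
  also have "(\<Sum>k\<in>\<dots>. of_nat (p choose k) * x ^ k * y ^ (p - k)) =
      (x ^ p + y ^ p) + (\<Sum>k\<in>{0<..<p}. of_nat (p choose k) * x ^ k * y ^ (p - k))"
    using p by (simp add: algebra_simps)
  finally have "(x + y) ^ p - (x ^ p + y ^ p) =
      (\<Sum>k\<in>{0<..<p}. of_nat (p choose k) * x ^ k * y ^ (p - k))"
    by simp
  moreover have "of_nat p dvd (\<Sum>k\<in>{0<..<p}. of_nat (p choose k) * x ^ k * y ^ (p - k))"
  proof (intro dvd_sum dvd_mult2)
    fix k assume "k \<in> {0<..<p}"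
    hence "p dvd (p choose k)" using assms by (intro dvd_choose_prime) auto
    thus "of_nat p dvd (of_nat (p choose k) :: 'a)" by (auto elim!: dvdE)
  qed
  ultimately show ?thesis by simp
qed

text \<open>With s = 1 + X u the equation becomes 2 u = -(1 + X (u^2 + 2 u + X u^2)). Multiplied by
  1/2 this asks for a fixed point of an X-adic contraction, and no binomial coefficients of exponent
  -1/2 have to be written down.\<close>

lemma exists_inverse_sqrt_series:
  fixes h :: "'a::idom"
  assumes "2 * h = 1"
  shows "\<exists>s :: 'a fps. fps_nth s 0 = 1 \<and> s ^ 2 * (1 + fps_X) = 1"
proof -
  define k :: "'a fps" where "k = fps_const h"
  have k: "2 * k = 1"
    using assms unfolding k_def by (metis fps_const_1_eq_1 fps_const_mult fps_numeral_fps_const)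
  define F where "F = (\<lambda>u::'a fps. - k * (1 + fps_X * (u ^ 2 + 2 * u + fps_X * u ^ 2)))"
  have "\<exists>u. F u = u"
  proof (rule fps_fixpoint)
    fix n and u v :: "'a fps" assume *: "fps_X ^ n dvd u - v"
    have "F u - F v = fps_X * (u - v) * (- k * (u + v + 2 + fps_X * (u + v)))"
      unfolding F_def by Groebner_Basis.algebra
    thus "fps_X ^ Suc n dvd F u - F v" using * by (simp add: mult_dvd_mono dvd_mult2)
  qed
  then obtain u where u: "- k * (1 + fps_X * (u ^ 2 + 2 * u + fps_X * u ^ 2)) = u"
    unfolding F_def ..
  define y where "y = 1 + fps_X * (u ^ 2 + 2 * u + fps_X * u ^ 2)"
  have "2 * u = - ((2 * k) * y)"
    by (subst u[symmetric]) (simp add: y_def algebra_simps)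
  hence u2: "2 * u + y = 0" by (simp add: k)
  have "(1 + fps_X * u) ^ 2 * (1 + fps_X) =
      1 + fps_X * (2 * u + y)"
    by (simp add: y_def algebra_simps power2_eq_square)
  hence "(1 + fps_X * u) ^ 2 * (1 + fps_X) = 1"
    unfolding u2 by simp
  thus ?thesis by (intro exI[of _ "1 + fps_X * u"]) simp
qed

text \<open>A series $f(w)$ stands for the form $f(z^2)\,dz$, in which $w^l$ contributes to $z^{2l+1}\,dz/z$;
  keeping the exponents divisible by $p$ is therefore the case $i = (p-1)/2$.\<close>

definition cartier :: "nat \<Rightarrow> nat \<Rightarrow> 'a::zero fps \<Rightarrow> 'a fps" where
  "cartier p i f = Abs_fps (\<lambda>l. fps_nth f (p * l + i))"

section \<open>Algebra of the Cartier operator\<close>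

lemma fps_nth_cartier [simp]: "fps_nth (cartier p i f) l = fps_nth f (p * l + i)"
  by (simp add: cartier_def)

lemma cartier_add: "cartier p i (f + g) = cartier p i f + cartier p i (g :: 'a::comm_ring_1 fps)"
  by (intro fps_ext) simp

lemma cartier_sum: "cartier p i (sum f A) = (\<Sum>a\<in>A. cartier p i (f a :: 'a::comm_ring_1 fps))"
  by (intro fps_ext) (simp add: fps_sum_nth)

lemma cartier_const_mult: "cartier p i (fps_const c * f) = fps_const c * cartier p i (f :: 'a::comm_ring_1 fps)"
  by (intro fps_ext) simp

lemma cartier_of_nat_mult: "cartier p i (of_nat n * f) = of_nat n * cartier p i (f :: 'a::comm_ring_1 fps)"
  using cartier_const_mult[of p i "of_nat n" f] by (simp add: fps_of_nat)

text \<open>Projection formula. The factor in w^p only has exponents p m, and these contribute to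
  the selected exponent p l + i for m \<le> l; here i < p rules out m = l + 1.\<close>

lemma cartier_mult_compose:
  fixes f g :: "'a::idom fps"
  assumes "i < p"
  shows "cartier p i (f * (g oo fps_X ^ p)) = cartier p i f * g"
proof (intro fps_ext)
  fix l
  have p: "p > 0" using assms by simp
  have "fps_nth (f * (g oo fps_X ^ p)) (p * l + i) =
      (\<Sum>j=0..p * l + i. fps_nth (g oo fps_X ^ p) j * fps_nth f (p * l + i - j))"
    by (subst mult.commute) (simp add: fps_mult_nth)
  also have "\<dots> = (\<Sum>j\<in>(*) p ` {0..l}. fps_nth (g oo fps_X ^ p) j * fps_nth f (p * l + i - j))"
  proof (rule sum.mono_neutral_right)
    show "(*) p ` {0..l} \<subseteq> {0..p * l + i}"
      by (auto intro!: trans_le_add1)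
    show "\<forall>j\<in>{0..p * l + i} - (*) p ` {0..l}.
        fps_nth (g oo fps_X ^ p) j * fps_nth f (p * l + i - j) = 0"
    proof
      fix j assume j: "j \<in> {0..p * l + i} - (*) p ` {0..l}"
      have "\<not> p dvd j"
      proof
        assume "p dvd j"
        then obtain m where m: "j = p * m" by (elim dvdE)
        with j have "p * m < p * Suc l" using assms by auto
        hence "m \<le> l" using p by (metis less_Suc_eq_le mult_less_cancel1)
        with j m show False by auto
      qed
      thus "fps_nth (g oo fps_X ^ p) j * fps_nth f (p * l + i - j) = 0"
        using p by (simp add: fps_nth_compose_X_power)
    qed
  qed simp
  also have "\<dots> = (\<Sum>m=0..l. fps_nth g m * fps_nth f (p * l + i - p * m))"
    using p by (subst sum.reindex) (auto simp: inj_on_def fps_nth_compose_X_power)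
  also have "\<dots> = (\<Sum>m=0..l. fps_nth g m * fps_nth f (p * (l - m) + i))"
    by (intro sum.cong) (auto simp: diff_mult_distrib2)
  also have "\<dots> = fps_nth (g * cartier p i f) l" by (simp add: fps_mult_nth)
  finally show "fps_nth (cartier p i (f * (g oo fps_X ^ p))) l = fps_nth (cartier p i f * g) l"
    by (simp add: mult.commute)
qed

lemma fps_deg_le_cartier:
  assumes "fps_deg_le f d" "d < p * (e + 1) + i"
  shows "fps_deg_le (cartier p i f) e"
  unfolding fps_deg_le_def
proof (intro allI impI)
  fix n assume "e < n"
  hence "p * (e + 1) \<le> p * n" by (intro mult_le_mono) auto
  thus "fps_nth (cartier p i f) n = 0" using assms by (auto simp: fps_deg_le_def)
qed

text \<open>Taylor expansion of f at 0: the r-th term carries p^r, so the tail from k on is a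
  multiple of p^k and a finite sum remains.\<close>

lemma compose_of_nat_mult_expand:
  fixes f z :: "'a::idom fps"
  assumes "fps_nth z 0 = 0"
  shows "\<exists>e. f oo (of_nat p * z) =
     (\<Sum>r<k. fps_const (fps_nth f r) * of_nat p ^ r * z ^ r) + of_nat p ^ k * e"
proof -
  define y where "y = of_nat p * z"
  have y0: "fps_nth y 0 = 0" using assms by (simp add: y_def)
  have f: "f = (\<Sum>r<k. fps_const (fps_nth f r) * fps_X ^ r) + fps_X ^ k * fps_shift k f"
    by (intro fps_ext)
       (simp add: fps_sum_nth fps_X_power_mult_nth if_distrib[of "\<lambda>x. _ * x"] cong: if_cong)
  have X: "(fps_X :: 'a fps) ^ r oo y = y ^ r" for r
    using y0 by (simp add: fps_compose_power[symmetric] fps_X_fps_compose_startby0)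
  have "f oo y = (\<Sum>r<k. fps_const (fps_nth f r) * y ^ r) + y ^ k * (fps_shift k f oo y)"
    by (subst f) (simp add: fps_compose_add_distrib fps_compose_sum_distrib
        fps_compose_mult_distrib[OF y0] X)
  thus ?thesis unfolding y_def by (auto simp: power_mult_distrib mult.assoc)
qed

section \<open>The Cartier operator on forms with bounded poles\<close>

definition wcubic :: "'a::comm_ring_1 \<Rightarrow> 'a \<Rightarrow> 'a fps" where
  "wcubic a b = 1 + fps_const a * fps_X ^ 2 + fps_const b * fps_X ^ 3"

lemma wcubic_nth_0 [simp]: "fps_nth (wcubic a b) 0 = 1"
  by (simp add: wcubic_def)

lemma fps_deg_le_wcubic: "fps_deg_le (wcubic a b) 3"
  by (auto simp: fps_deg_le_def wcubic_def fps_X_power_iff)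

text \<open>The p-th power is additive modulo p; this is applied twice, splitting off b w^3 and then
  a w^2. The quotient by p is the Delta of the overview.\<close>

lemma wcubic_power_prime:
  fixes a b :: "'a::comm_ring_1"
  assumes "prime p"
  shows "of_nat p dvd wcubic a b ^ p - (wcubic (a ^ p) (b ^ p) oo fps_X ^ p)"
proof -
  define u v :: "'a fps" where "u = fps_const a * fps_X ^ 2" and "v = fps_const b * fps_X ^ 3"
  have p: "p > 0" using assms by (simp add: prime_gt_0_nat)
  have X: "fps_X ^ n oo fps_X ^ p = (fps_X :: 'a fps) ^ (n * p)" for n
    using p by (intro fps_ext) (simp add: fps_nth_compose_X_power, auto simp: fps_X_power_iff elim!: dvdE)
  have c: "(fps_const c * f) oo fps_X ^ p = fps_const c * (f oo (fps_X ^ p))" for c and f :: "'a fps"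
    using p by (intro fps_ext) (auto simp: fps_nth_compose_X_power)
  have "wcubic (a ^ p) (b ^ p) oo fps_X ^ p = 1 + u ^ p + v ^ p"
    unfolding wcubic_def u_def v_def
    by (simp add: fps_compose_add_distrib c X power_mult_distrib fps_const_power power_mult)
  moreover have "of_nat p dvd ((1 + u) + v) ^ p - ((1 + u) ^ p + v ^ p)"
    "of_nat p dvd (1 + u) ^ p - (1 ^ p + u ^ p)"
    by (intro prime_dvd_add_power_diff assms)+
  hence "of_nat p dvd ((1 + u) + v) ^ p - ((1 + u) ^ p + v ^ p) + ((1 + u) ^ p - (1 ^ p + u ^ p))"
    by (rule dvd_add)
  ultimately show ?thesis
    unfolding wcubic_def u_def[symmetric] v_def[symmetric] by (simp add: algebra_simps)
qed

section \<open>Inverse square roots of power series\<close>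

locale inverse_sqrt_series =
  fixes s :: "'a::idom fps"
  assumes s_0: "fps_nth s 0 = 1"
    and s_square: "s ^ 2 * (1 + fps_X) = 1"
    and two_neq_0: "(2 :: 'a) \<noteq> 0"
begin

text \<open>As \<open>s\<close> is the binomial series (1 + X)^(-1/2), this is f^(-1/2) for f with
  constant term 1.\<close>

definition inv_sqrt :: "'a fps \<Rightarrow> 'a fps" where
  "inv_sqrt f = s oo (f - 1)"

lemma inv_sqrt_nth_0: "fps_nth (inv_sqrt f) 0 = 1"
  by (simp add: inv_sqrt_def s_0)

lemma inv_sqrt_square:
  assumes "fps_nth f 0 = 1"
  shows "inv_sqrt f ^ 2 * f = 1"
proof -
  have f0: "fps_nth (f - 1) 0 = 0" using assms by simp
  have "(s ^ 2 * (1 + fps_X)) oo (f - 1) = inv_sqrt f ^ 2 * f"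
    using f0 unfolding inv_sqrt_def
    by (simp add: fps_compose_mult_distrib[OF f0] fps_compose_add_distrib
        fps_X_fps_compose_startby0 fps_compose_power[OF f0])
  thus ?thesis by (simp add: s_square)
qed

text \<open>Two roots q, r satisfy (q - r)(q + r) f = 0 in a domain, and q + r has constant term 2,
  which is nonzero.\<close>

lemma inv_sqrt_unique:
  assumes "q ^ 2 * f = 1" "fps_nth q 0 = 1"
  shows "q = inv_sqrt f"
proof -
  have "fps_nth (q ^ 2 * f) 0 = 1" using assms(1) by simp
  hence f0: "fps_nth f 0 = 1" using assms(2) by (simp add: power2_eq_square)
  have "(q - inv_sqrt f) * (q + inv_sqrt f) * f = 0"
    using assms(1) inv_sqrt_square[OF f0] by Groebner_Basis.algebra
  moreover have "f \<noteq> 0" using f0 by auto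
  moreover have "fps_nth (q + inv_sqrt f) 0 \<noteq> 0"
    using two_neq_0 assms(2) inv_sqrt_nth_0 by simp
  hence "q + inv_sqrt f \<noteq> 0" by (metis fps_zero_nth)
  ultimately show ?thesis by simp
qed

end

section \<open>The Cartier operator on polynomial multiples of powers of S\<close>

locale dwork = inverse_sqrt_series s for s :: "'a::idom fps" +
  fixes p :: nat
  assumes prime: "prime p" and odd: "odd p" and p_neq_0: "of_nat p \<noteq> (0 :: 'a)"
begin

definition h :: nat where "h = (p - 1) div 2"

lemma p_h: "p = 2 * h + 1" and h_pos: "h \<ge> 1"
  using odd prime_gt_1_nat[OF prime] by (auto simp: h_def elim!: oddE)

abbreviation wS :: "'a \<Rightarrow> 'a \<Rightarrow> 'a fps" where "wS a b \<equiv> inv_sqrt (wcubic a b)"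

abbreviation pp :: "'a fps" where "pp \<equiv> of_nat p"

text \<open>With g^p = g'(w^p) + p d one has T(w^p)^2 g^p = 1 + p d T(w^p)^2, so both sides are
  inverse square roots of g^p with constant term 1. Cancelling p in the domain gives the degree
  bound and the vanishing constant term of d.\<close>

lemma wS_power_p:
  obtains d where "fps_nth d 0 = 0" "fps_deg_le d (3 * p)"
    "wS a b ^ p = (wS (a ^ p) (b ^ p) oo fps_X ^ p) *
       (s oo (of_nat p * (d * (wS (a ^ p) (b ^ p) oo fps_X ^ p) ^ 2)))"
proof -
  have p0: "p > 0" using prime by (simp add: prime_gt_0_nat)
  have X0: "fps_nth ((fps_X :: 'a fps) ^ p) 0 = 0" using p0 by (simp add: fps_X_power_iff)
  define g where "g = wcubic a b"
  define g' where "g' = wcubic (a ^ p) (b ^ p)"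
  define T where "T = wS (a ^ p) (b ^ p) oo fps_X ^ p"
  obtain d where d: "g ^ p - (g' oo fps_X ^ p) = pp * d"
    using wcubic_power_prime[OF prime, of a b] unfolding g_def g'_def by (elim dvdE)
  have nth: "of_nat p * fps_nth d n = fps_nth (g ^ p - (g' oo fps_X ^ p)) n" for n
    unfolding d by (simp add: fps_of_nat[symmetric])
  have T: "T ^ 2 * (g' oo fps_X ^ p) = 1"
    unfolding T_def fps_compose_power[OF X0] fps_compose_mult_distrib[OF X0, symmetric]
    using inv_sqrt_square[of g'] by (simp add: g'_def)
  show thesis
  proof (rule that)
    have "of_nat p * fps_nth d 0 = 0"
      unfolding nth by (simp add: g_def g'_def fps_nth_power_0)
    thus d0: "fps_nth d 0 = 0" using p_neq_0 by simp
    have "fps_deg_le (g ^ p) (p * 3)"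
      unfolding g_def by (intro fps_deg_le_power fps_deg_le_wcubic)
    moreover have "fps_deg_le (g' oo fps_X ^ p) (p * 3)"
      using fps_deg_le_wcubic[of "a ^ p" "b ^ p"] p0
      by (auto simp: fps_deg_le_def g'_def fps_nth_compose_X_power)
    ultimately have "of_nat p * fps_nth d n = 0" if "n > p * 3" for n
      using that unfolding nth by (simp add: fps_deg_le_def)
    thus "fps_deg_le d (3 * p)" using p_neq_0 by (auto simp: fps_deg_le_def mult.commute)
    define y where "y = pp * (d * T ^ 2)"
    have y0: "fps_nth y 0 = 0" using d0 by (simp add: y_def)
    have y: "(s oo y) ^ 2 * (1 + y) = 1"
      using inv_sqrt_square[of "1 + y"] y0 by (simp add: inv_sqrt_def)
    have "g ^ p = (g' oo fps_X ^ p) + pp * d" using d by (simp add: algebra_simps)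
    hence "T ^ 2 * g ^ p = T ^ 2 * (g' oo fps_X ^ p) + y"
      by (simp add: y_def algebra_simps)
    hence "(T * (s oo y)) ^ 2 * g ^ p = (s oo y) ^ 2 * (1 + y)"
      unfolding T by (simp add: power_mult_distrib mult_ac)
    hence "(T * (s oo y)) ^ 2 * g ^ p = 1" using y by simp
    moreover have "fps_nth (T * (s oo y)) 0 = 1"
      by (simp add: T_def inv_sqrt_nth_0 s_0)
    ultimately have "T * (s oo y) = inv_sqrt (g ^ p)" by (rule inv_sqrt_unique)
    moreover have "(wS a b ^ p) ^ 2 * g ^ p = 1"
    proof -
      have "(wS a b ^ p) ^ 2 * g ^ p = (wS a b ^ 2 * g) ^ p"
        by (simp add: power_mult_distrib power_mult[symmetric] mult.commute)
      also have "\<dots> = 1" using inv_sqrt_square[of g] by (simp add: g_def)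
      finally show ?thesis .
    qed
    hence "wS a b ^ p = inv_sqrt (g ^ p)"
      by (rule inv_sqrt_unique) (simp add: fps_nth_power_0 inv_sqrt_nth_0)
    ultimately show "wS a b ^ p = (wS (a ^ p) (b ^ p) oo fps_X ^ p) *
        (s oo (of_nat p * (d * (wS (a ^ p) (b ^ p) oo fps_X ^ p) ^ 2)))"
      by (simp add: y_def flip: T_def)
  qed
qed

text \<open>Because S^2 g = 1, the exponent 2m + 1 can be raised to the multiple p (2m' + 1) of p at
  the price of g^j. Then the expansion of S^p applies, and the powers of T(w^p) leave the Cartier
  operator. The residue i = h serves S itself, i = h + 1 serves w^-1 S.\<close>

lemma cartier_expand:
  assumes Q: "fps_deg_le Q (3 * m)" and j: "p * (2 * m' + 1) = 2 * m + 1 + 2 * j"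
    and i: "i \<in> {h, h + 1}"
  obtains R e where "\<And>r. fps_deg_le (R r) (3 * (m' + r))"
    "R 0 = cartier p i (Q * wcubic a b ^ j)"
    "cartier p i (Q * wS a b ^ (2 * m + 1)) =
      (\<Sum>r<k. pp ^ r * R r * wS (a ^ p) (b ^ p) ^ (2 * (m' + r) + 1)) + pp ^ k * e"
proof -
  define g where "g = wcubic a b"
  define T where "T = wS (a ^ p) (b ^ p)"
  define Tp where "Tp = T oo fps_X ^ p"
  have p0: "p > 0" using prime by (simp add: prime_gt_0_nat)
  have ip: "i < p" using i p_h h_pos by auto
  have X0: "fps_nth ((fps_X :: 'a fps) ^ p) 0 = 0" using p0 by (simp add: fps_X_power_iff)
  obtain d where d: "fps_nth d 0 = 0" "fps_deg_le d (3 * p)"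
    "wS a b ^ p = Tp * (s oo (pp * (d * Tp ^ 2)))"
    using wS_power_p[of a b] unfolding Tp_def T_def by blast
  define M where "M = 2 * m' + 1"
  define z where "z = d * Tp ^ 2"
  have z0: "fps_nth z 0 = 0" "fps_nth (pp * z) 0 = 0" using d(1) by (simp_all add: z_def)
  obtain e where e: "s ^ M oo (pp * z) =
      (\<Sum>r<k. fps_const (fps_nth (s ^ M) r) * pp ^ r * z ^ r) + pp ^ k * e"
    using compose_of_nat_mult_expand[OF z0(1)] by blast
  define R where "R = (\<lambda>r. fps_const (fps_nth (s ^ M) r) * cartier p i (Q * g ^ j * d ^ r))"
  have SQ: "wS a b ^ 2 * g = 1" using inv_sqrt_square[of g] by (simp add: g_def)
  have "wS a b ^ (2 * m + 1) = wS a b ^ (2 * m + 1) * (wS a b ^ 2 * g) ^ j"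
    by (simp add: SQ)
  also have "\<dots> = wS a b ^ (2 * m + 1 + 2 * j) * g ^ j"
    by (simp add: power_mult_distrib power_add power_mult)
  also have "\<dots> = (wS a b ^ p) ^ M * g ^ j"
    unfolding j[symmetric] M_def power_mult ..
  also have "(wS a b ^ p) ^ M = Tp ^ M * (s ^ M oo (pp * z))"
    unfolding d(3) z_def[symmetric] by (simp add: power_mult_distrib fps_compose_power[OF z0(2)])
  finally have eq0: "Q * wS a b ^ (2 * m + 1) = Q * (Tp ^ M * (s ^ M oo (pp * z)) * g ^ j)"
    by simp
  have comm: "(Tp ^ 2) ^ n = (Tp ^ n) ^ 2" for n
    by (simp add: power_mult[symmetric] mult.commute)
  note eq0
  also have "Q * (Tp ^ M * (s ^ M oo (pp * z)) * g ^ j) = (\<Sum>r<k. fps_const (fps_nth (s ^ M) r) *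
          (of_nat (p ^ r) * ((Q * g ^ j * d ^ r) * Tp ^ (2 * (m' + r) + 1)))) +
        of_nat (p ^ k) * (Q * Tp ^ M * g ^ j * e)"
    unfolding e by (simp add: algebra_simps sum_distrib_left sum_distrib_right z_def
       power_mult_distrib M_def power_add power_mult comm)
  finally have eq: "Q * wS a b ^ (2 * m + 1) = \<dots>" .
  have Tc: "Tp ^ n = T ^ n oo fps_X ^ p" for n
    unfolding Tp_def by (rule fps_compose_power[OF X0])
  have "cartier p i (Q * wS a b ^ (2 * m + 1)) =
      (\<Sum>r<k. pp ^ r * R r * T ^ (2 * (m' + r) + 1)) + pp ^ k * cartier p i (Q * Tp ^ M * g ^ j * e)"
    unfolding eq cartier_add cartier_sum cartier_const_mult cartier_of_nat_mult Tc cartier_mult_compose[OF ip] R_def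
    by (simp add: mult_ac)
  moreover have "fps_deg_le (R r) (3 * (m' + r))" for r
  proof -
    have "fps_deg_le (Q * g ^ j * d ^ r) (3 * m + j * 3 + r * (3 * p))"
      unfolding g_def
      by (intro fps_deg_le_mult fps_deg_le_power fps_deg_le_wcubic Q d)
    moreover have "3 * m + j * 3 + r * (3 * p) < p * (3 * (m' + r) + 1) + i"
    proof -
      \<comment> \<open>The relation between m, m' and j gives 3m + 3j = 3 p m' + 3h, and the
        leftover 3h stays below p + i exactly because i \<ge> h.\<close>
      have "2 * (3 * m + j * 3) + 3 = 3 * (p * (2 * m' + 1))" using j by simp
      also have "\<dots> = 6 * (p * m') + 3 * p" by (simp add: algebra_simps)
      finally have "3 * m + j * 3 = 3 * (p * m') + 3 * h" using p_h by simp
      moreover have "3 * h < p + i" using i p_h by auto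
      ultimately show ?thesis by (simp add: algebra_simps)
    qed
    ultimately have "fps_deg_le (cartier p i (Q * g ^ j * d ^ r)) (3 * (m' + r))"
      by (rule fps_deg_le_cartier)
    from fps_deg_le_mult[OF fps_deg_le_const this, of _ 0] show ?thesis
      by (simp add: R_def)
  qed
  moreover have "R 0 = cartier p i (Q * g ^ j)" 
    by (simp add: R_def s_0 fps_nth_power_0)
  ultimately show thesis using that unfolding g_def T_def by blast
qed

text \<open>The factor of $p$ allowed in front of $Q S^{2m+1}$ is $p^{m-1}$ for $m \ge 1$ and $1$ for
  $m = 0$; truncated subtraction covers both cases.\<close>

inductive_set dwork_mod :: "nat \<Rightarrow> 'a fps \<Rightarrow> 'a fps set" for k :: nat and S :: "'a fps" where
  gen: "fps_deg_le Q (3 * m) \<Longrightarrow> pp ^ (m - 1) * Q * S ^ (2 * m + 1) \<in> dwork_mod k S"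
| rem: "pp ^ k * e \<in> dwork_mod k S"
| add: "f \<in> dwork_mod k S \<Longrightarrow> g \<in> dwork_mod k S \<Longrightarrow> f + g \<in> dwork_mod k S"

section \<open>The module of forms with bounded poles under the Cartier operator\<close>

lemma N_const_mult: "f \<in> dwork_mod k S \<Longrightarrow> fps_const c * f \<in> dwork_mod k S"
proof (induction rule: dwork_mod.induct)
  case (gen Q m)
  hence "fps_deg_le (fps_const c * Q) (3 * m)"
    using fps_deg_le_mult[OF fps_deg_le_const, of Q "3 * m" c 0] by simp
  from dwork_mod.gen[OF this, of S k] show ?case by (simp add: mult_ac)
next
  case (rem e)
  from dwork_mod.rem[of k "fps_const c * e" S] show ?case by (simp add: mult_ac)
next
  case (add f g)
  thus ?case by (auto simp: distrib_left intro: dwork_mod.add)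
qed

lemma N_0: "0 \<in> dwork_mod k S"
  using dwork_mod.rem[of k 0 S] by simp

lemma S_in_N: "S \<in> dwork_mod k S"
  using dwork_mod.gen[of 1 0 S k] fps_deg_le_const[of 1 0] by simp

lemma N_p_mult: "f \<in> dwork_mod k S \<Longrightarrow> pp * f \<in> dwork_mod k S"
  using N_const_mult[of f k S "of_nat p"] by (simp add: fps_of_nat)

text \<open>Where the Cartier operator lands: modulo p only multiples of the single series S are
  left.\<close>

definition const_plus_pN :: "nat \<Rightarrow> 'a fps \<Rightarrow> 'a fps set" where
  "const_plus_pN k S = {fps_const c * S + pp * f | c f. f \<in> dwork_mod k S}"

lemma const_plus_pN_add:
  assumes "f \<in> const_plus_pN k S" "g \<in> const_plus_pN k S"
  shows "f + g \<in> const_plus_pN k S"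
proof -
  from assms obtain c c' f' g' where "f = fps_const c * S + pp * f'" "g = fps_const c' * S + pp * g'"
    "f' \<in> dwork_mod k S" "g' \<in> dwork_mod k S" unfolding const_plus_pN_def by blast
  hence "f + g = fps_const (c + c') * S + pp * (f' + g')" "f' + g' \<in> dwork_mod k S"
    by (auto simp: algebra_simps simp flip: fps_const_add intro: dwork_mod.add)
  thus ?thesis unfolding const_plus_pN_def by blast
qed

lemma pN_subset: "f \<in> dwork_mod k S \<Longrightarrow> pp * f \<in> const_plus_pN k S"
  unfolding const_plus_pN_def by (rule CollectI, rule exI[of _ 0], rule exI[of _ f]) simp

text \<open>The power is p^m here, not p^(m-1). For m \<ge> 1 the additional p makes this p times a
  generator; for m = 0 there is no additional p, but then Q is a constant.\<close>

lemma const_plus_pN_gen: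
  assumes "fps_deg_le Q (3 * m)"
  shows "pp ^ m * Q * S ^ (2 * m + 1) \<in> const_plus_pN k S"
proof (cases m)
  case 0
  with assms have "Q = fps_const (fps_nth Q 0)" by (simp add: fps_deg_le_0_iff)
  hence "pp ^ m * Q * S ^ (2 * m + 1) = fps_const (fps_nth Q 0) * S + pp * 0"
    using 0 by simp
  thus ?thesis unfolding const_plus_pN_def using N_0 by blast
next
  case (Suc n)
  from pN_subset[OF dwork_mod.gen[OF assms, of S k]] show ?thesis by (simp add: Suc mult_ac)
qed

lemma const_plus_pN_sum:
  assumes "\<And>r. fps_deg_le (R r) (3 * (m + r))"
  shows "(\<Sum>r<n. pp ^ (m + r) * R r * S ^ (2 * (m + r) + 1)) \<in> const_plus_pN k S"
proof (induction n)
  case 0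
  show ?case using pN_subset[OF N_0] by simp
next
  case (Suc n)
  from const_plus_pN_add[OF Suc const_plus_pN_gen[OF assms]] show ?case by simp
qed

text \<open>With m' = m - 1 in the expansion, term r has index m - 1 + r and the factor p^(m-1+r),
  one power of p more than the module asks for unless the index is 0. The level drops from k + 1 to
  k because one p of the remainder p^(k+1) e is spent on the factor p in front.\<close>

lemma cartier_N:
  assumes "f \<in> dwork_mod (Suc k) (wS a b)"
  shows "cartier p h f \<in> const_plus_pN k (wS (a ^ p) (b ^ p))"
  using assms
proof (induction rule: dwork_mod.induct)
  case (gen Q m)
  \<comment> \<open>Both sides are odd, and p \<ge> 3 keeps j nonnegative. For m = 0 the truncated
    subtraction leaves p = 1 + 2 j, so j = h.\<close>
  have "\<exists>j. p * (2 * (m - 1) + 1) = 2 * m + 1 + 2 * j"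
  proof (cases m)
    case 0
    thus ?thesis using p_h by auto
  next
    case (Suc n)
    obtain h' where h': "h = Suc h'" using h_pos by (cases h) auto
    hence "p = 2 * h' + 3" using p_h by simp
    hence "p * (2 * n + 1) = 2 * m + 1 + 2 * (n * (2 * h' + 2) + h')"
      unfolding Suc by (simp add: algebra_simps)
    thus ?thesis using Suc by (intro exI[of _ "n * (2 * h' + 2) + h'"]) simp
  qed
  then obtain j where j: "p * (2 * (m - 1) + 1) = 2 * m + 1 + 2 * j" ..
  obtain R e where R: "\<And>r. fps_deg_le (R r) (3 * (m - 1 + r))"
    "cartier p h (Q * wS a b ^ (2 * m + 1)) =
      (\<Sum>r<Suc k. pp ^ r * R r * wS (a ^ p) (b ^ p) ^ (2 * (m - 1 + r) + 1)) + pp ^ Suc k * e"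
    using cartier_expand[OF gen j insertI1, of a b "Suc k"] by blast
  have "cartier p h (pp ^ (m - 1) * Q * wS a b ^ (2 * m + 1)) =
      pp ^ (m - 1) * cartier p h (Q * wS a b ^ (2 * m + 1))"
    using cartier_of_nat_mult[of p h "p ^ (m - 1)"] by (simp add: mult.assoc)
  also have "\<dots> = (\<Sum>r<Suc k. pp ^ (m - 1 + r) * R r * wS (a ^ p) (b ^ p) ^ (2 * (m - 1 + r) + 1))
      + pp * (pp ^ k * (pp ^ (m - 1) * e))"
    unfolding R(2) by (simp add: algebra_simps sum_distrib_left power_add)
  also have "\<dots> \<in> const_plus_pN k (wS (a ^ p) (b ^ p))"
    by (intro const_plus_pN_add const_plus_pN_sum R(1) pN_subset dwork_mod.rem)
  finally show ?case .
next
  case (rem e)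
  have "cartier p h (pp ^ Suc k * e) = pp * (pp ^ k * cartier p h e)"
    using cartier_of_nat_mult[of p h "p ^ Suc k" e] by (simp add: mult.assoc)
  thus ?case using pN_subset[OF dwork_mod.rem] by simp
next
  case (add f g)
  thus ?case by (simp add: cartier_add const_plus_pN_add)
qed

text \<open>The case m = m' = 0, j = h: the leading coefficient has degree 0 and is the coefficient
  of w^i in g^h. For i = h this is the Hasse invariant, since g = w^3 f(1/w); for i = h + 1 it is
  the c of the overview.\<close>

lemma cartier_wS:
  assumes "i \<in> {h, h + 1}"
  shows "\<exists>f \<in> dwork_mod k (wS (a ^ p) (b ^ p)). cartier p i (wS a b) =
           fps_const (fps_nth (wcubic a b ^ h) i) * wS (a ^ p) (b ^ p) + pp * f"
proof -
  define T where "T = wS (a ^ p) (b ^ p)"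
  have "p * (2 * 0 + 1) = 2 * 0 + 1 + 2 * h" using p_h by simp
  from cartier_expand[OF _ this assms, of 1 a b "Suc k"] fps_deg_le_const[of 1 0]
  obtain R e where R: "\<And>r. fps_deg_le (R r) (3 * r)" "R 0 = cartier p i (wcubic a b ^ h)"
    "cartier p i (wS a b) = (\<Sum>r<Suc k. pp ^ r * R r * T ^ (2 * r + 1)) + pp ^ Suc k * e"
    unfolding T_def by auto
  have R0: "R 0 = fps_const (fps_nth (wcubic a b ^ h) i)"
    using R(1)[of 0] R(2) by (simp add: fps_deg_le_0_iff)
  have "(\<Sum>r<n. pp ^ r * R (Suc r) * T ^ (2 * Suc r + 1)) \<in> dwork_mod k T" for n
  proof (induction n)
    case (Suc n)
    have "pp ^ n * R (Suc n) * T ^ (2 * Suc n + 1) \<in> dwork_mod k T"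
      using dwork_mod.gen[OF R(1), of "Suc n" T k] by simp
    with Suc show ?case by (simp add: dwork_mod.add)
  qed (simp add: N_0)
  hence "(\<Sum>r<k. pp ^ r * R (Suc r) * T ^ (2 * Suc r + 1)) + pp ^ k * e \<in> dwork_mod k T"
    by (intro dwork_mod.add dwork_mod.rem)
  moreover have "cartier p i (wS a b) = fps_const (fps_nth (wcubic a b ^ h) i) * T +
      pp * ((\<Sum>r<k. pp ^ r * R (Suc r) * T ^ (2 * Suc r + 1)) + pp ^ k * e)"
    unfolding R(3) sum.lessThan_Suc_shift
    by (simp add: R0 algebra_simps sum_distrib_left)
  ultimately show ?thesis unfolding T_def by blast
qed

end

section \<open>The Hasse coefficient under Frobenius\<close>

lemma prime_dvd_sum_power_diff:
  fixes x :: "'b \<Rightarrow> 'a::comm_ring_1"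
  assumes "prime p" "finite A"
  shows "of_nat p dvd (\<Sum>i\<in>A. x i) ^ p - (\<Sum>i\<in>A. x i ^ p)"
  using assms(2)
proof (induction rule: finite_induct)
  case empty
  show ?case using prime_gt_0_nat[OF assms(1)] by (simp add: power_0_left)
next
  case (insert i A)
  have "of_nat p dvd ((x i + sum x A) ^ p - (x i ^ p + sum x A ^ p)) + (sum x A ^ p - (\<Sum>i\<in>A. x i ^ p))"
    by (intro dvd_add prime_dvd_add_power_diff assms insert.IH)
  thus ?case using insert by (simp add: algebra_simps)
qed

text \<open>In the exponents 2 l + 1 of z, each application reads the coefficient at p times the
  exponent: 2 (p^i l + (p^i - 1) / 2) + 1 = p^i (2 l + 1).\<close>

lemma cartier_funpow_nth:
  assumes "p = 2 * h + 1"
  shows "fps_nth ((cartier p h ^^ i) f) l = fps_nth f (p ^ i * l + (p ^ i - 1) div 2)"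
proof (induction i arbitrary: l)
  case (Suc i)
  have "odd (p ^ i)" using assms by simp
  then obtain m where m: "p ^ i = 2 * m + 1" by (elim oddE)
  have "p ^ Suc i = (2 * h + 1) * (2 * m + 1)"
    unfolding power_Suc m by (simp add: assms)
  hence "p ^ Suc i = 2 * (p ^ i * h + m) + 1" unfolding m by simp
  hence "(p ^ Suc i - 1) div 2 = p ^ i * h + m" by simp
  moreover have "(p ^ i - 1) div 2 = m" unfolding m by simp
  ultimately have "p ^ i * (p * l + h) + (p ^ i - 1) div 2 = p ^ Suc i * l + (p ^ Suc i - 1) div 2"
    by (simp add: algebra_simps)
  thus ?case by (simp add: Suc)
qed simp

context dwork
begin

abbreviation hasse_coeff :: "'a \<Rightarrow> 'a \<Rightarrow> 'a" where "hasse_coeff a b \<equiv> fps_nth (wcubic a b ^ h) h"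

text \<open>Compare the coefficient of w^(p h) in (g^h)^p, computed once from g^p = g'(w^p) modulo p
  and once by raising the coefficients of g^h to the p-th power. Iterated, this makes the Hasse
  coefficients of all twists powers of H modulo p, so inverting H is enough.\<close>

lemma hasse_coeff_power: "of_nat p dvd hasse_coeff (a ^ p) (b ^ p) - hasse_coeff a b ^ p"
proof -
  define g where "g = wcubic a b"
  define g' where "g' = wcubic (a ^ p) (b ^ p)"
  have p0: "p > 0" using prime by (simp add: prime_gt_0_nat)
  have X0: "fps_nth ((fps_X :: 'a fps) ^ p) 0 = 0" using p0 by (simp add: fps_X_power_iff)
  have "pp dvd g ^ p - (g' oo fps_X ^ p)"
    unfolding g_def g'_def by (rule wcubic_power_prime[OF prime])
  also have "\<dots> dvd (g ^ p) ^ h - (g' oo fps_X ^ p) ^ h"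
    by (simp add: power_diff_sumr2)
  also have "(g ^ p) ^ h - (g' oo fps_X ^ p) ^ h = (g ^ h) ^ p - (g' ^ h oo fps_X ^ p)"
    by (simp add: fps_compose_power[OF X0] power_mult[symmetric] mult.commute)
  finally have 1: "of_nat p dvd fps_nth ((g ^ h) ^ p) (p * h) - fps_nth (g' ^ h) h"
    using p0 unfolding of_nat_dvd_fps_iff by (auto simp: fps_nth_compose_X_power dest!: spec[of _ "p * h"])
  define f where "f = g ^ h"
  have deg: "fps_deg_le f (h * 3)"
    unfolding f_def g_def by (intro fps_deg_le_power fps_deg_le_wcubic)
  have f: "f = (\<Sum>i\<le>3 * h. fps_const (fps_nth f i) * fps_X ^ i)"
    using deg by (intro fps_ext) (auto simp: fps_sum_nth fps_X_power_iff fps_deg_le_def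
        if_distrib[of "\<lambda>x. _ * x"] not_le mult.commute cong: if_cong)
  have "pp dvd f ^ p - (\<Sum>i\<le>3 * h. (fps_const (fps_nth f i) * fps_X ^ i) ^ p)"
    by (subst (1) f) (intro prime_dvd_sum_power_diff prime, simp)
  also have "(\<Sum>i\<le>3 * h. (fps_const (fps_nth f i) * fps_X ^ i) ^ p) =
      (\<Sum>i\<le>3 * h. fps_const (fps_nth f i ^ p) * fps_X ^ (p * i))"
    by (simp add: power_mult_distrib fps_const_power power_mult[symmetric] mult.commute)
  finally have 2: "of_nat p dvd fps_nth (f ^ p) (p * h) -
      fps_nth (\<Sum>i\<le>3 * h. fps_const (fps_nth f i ^ p) * fps_X ^ (p * i)) (p * h)"
    unfolding of_nat_dvd_fps_iff by (auto dest!: spec[of _ "p * h"])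
  have "fps_nth (\<Sum>i\<le>3 * h. fps_const (fps_nth f i ^ p) * fps_X ^ (p * i)) (p * h) = fps_nth f h ^ p"
    using p0 by (simp add: fps_sum_nth fps_X_power_iff if_distrib[of "\<lambda>x. _ * x"] cong: if_cong)
  with dvd_diff[OF 2 1] show ?thesis
    unfolding f_def g_def g'_def by (simp add: algebra_simps)
qed

lemma hasse_coeff_power_iterate: "of_nat p dvd hasse_coeff (a ^ p ^ i) (b ^ p ^ i) - hasse_coeff a b ^ p ^ i"
proof (induction i)
  case (Suc i)
  let ?x = "hasse_coeff (a ^ p ^ i) (b ^ p ^ i)" and ?y = "hasse_coeff a b ^ p ^ i"
  have "of_nat p dvd (hasse_coeff ((a ^ p ^ i) ^ p) ((b ^ p ^ i) ^ p) - ?x ^ p) + (?x ^ p - ?y ^ p)"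
  proof (rule dvd_add[OF hasse_coeff_power])
    have "?x - ?y dvd ?x ^ p - ?y ^ p" by (simp add: power_diff_sumr2)
    with Suc show "of_nat p dvd ?x ^ p - ?y ^ p" by (rule dvd_trans)
  qed
  thus ?case by (simp add: power_mult[symmetric] mult.commute)
qed simp

section \<open>Iterates of the Cartier operator and the unit root\<close>

lemma const_plus_pN_subset: "f \<in> const_plus_pN k S \<Longrightarrow> f \<in> dwork_mod k S"
  unfolding const_plus_pN_def by (auto intro!: dwork_mod.add N_const_mult S_in_N N_p_mult)

abbreviation Tw :: "'a \<Rightarrow> 'a \<Rightarrow> nat \<Rightarrow> 'a fps" where
  "Tw a b i \<equiv> wS (a ^ p ^ i) (b ^ p ^ i)"

lemma Tw_Suc: "wS ((a ^ p ^ i) ^ p) ((b ^ p ^ i) ^ p) = Tw a b (Suc i)"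
  by (simp add: power_mult[symmetric] mult.commute)

text \<open>Each step multiplies by the Hasse coefficient of the current twist, which is
  \<open>hasse_coeff a b ^ p ^ i\<close> modulo p; the e built here is 1 + p + ... + p^(i-1). As
  every step lowers the level of the module, the induction needs all k.\<close>

lemma cartier_funpow_wS:
  "\<exists>e. \<exists>f \<in> dwork_mod k (Tw a b i). (cartier p h ^^ i) (wS a b) = fps_const (hasse_coeff a b ^ e) * Tw a b i + pp * f"
proof (induction i arbitrary: k)
  case 0
  have "(cartier p h ^^ 0) (wS a b) = fps_const (hasse_coeff a b ^ 0) * Tw a b 0 + pp * 0" by simp
  thus ?case using N_0 by blast
next
  case (Suc i)
  let ?T = "Tw a b (Suc i)"
  obtain e f where f: "f \<in> dwork_mod (Suc k) (Tw a b i)"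
    "(cartier p h ^^ i) (wS a b) = fps_const (hasse_coeff a b ^ e) * Tw a b i + pp * f"
    using Suc[of "Suc k"] by blast
  have cf: "cartier p h f \<in> dwork_mod k ?T"
    using const_plus_pN_subset[OF cartier_N[OF f(1)]] unfolding Tw_Suc .
  obtain f' where f': "f' \<in> dwork_mod k ?T"
    "cartier p h (Tw a b i) = fps_const (hasse_coeff (a ^ p ^ i) (b ^ p ^ i)) * ?T + pp * f'"
    using cartier_wS[of h k "a ^ p ^ i" "b ^ p ^ i"] unfolding Tw_Suc by blast
  obtain c where "hasse_coeff (a ^ p ^ i) (b ^ p ^ i) - hasse_coeff a b ^ p ^ i = of_nat p * c"
    using hasse_coeff_power_iterate[of a i b] by (elim dvdE)
  hence c: "hasse_coeff (a ^ p ^ i) (b ^ p ^ i) = hasse_coeff a b ^ p ^ i + of_nat p * c"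
    by (simp add: algebra_simps)
  define f'' where "f'' = fps_const (hasse_coeff a b ^ e) * (fps_const c * ?T + f') + cartier p h f"
  have "(cartier p h ^^ Suc i) (wS a b) = fps_const (hasse_coeff a b ^ e) * cartier p h (Tw a b i) + pp * cartier p h f"
    by (simp add: f(2) cartier_add cartier_const_mult cartier_of_nat_mult)
  also have "\<dots> = fps_const (hasse_coeff a b ^ (e + p ^ i)) * ?T + pp * f''"
    unfolding f'(2) c f''_def power_add fps_const_mult[symmetric] fps_const_add[symmetric] fps_of_nat
    by (simp add: algebra_simps del: fps_const_mult fps_const_add)
  finally show ?case
    unfolding f''_def using cf f'(1) by (blast intro: dwork_mod.add N_const_mult S_in_N)
qed

lemma cartier_funpow_linear:
  "(cartier p h ^^ i) (fps_const x * f - fps_const y * g) =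
     fps_const x * (cartier p h ^^ i) f - fps_const y * (cartier p h ^^ i) (g :: 'a fps)"
  by (intro fps_ext) (simp add: cartier_funpow_nth[OF p_h])

text \<open>Successive approximation, with C the Cartier operator and H the Hasse coefficient. If
  C^(n+1) F = p^(n+1) f1, write C f1 = c T + p f2 and C^(n+2) S = H^e T + p f3. Then H^e F - p^(n+1)
  c S becomes p^(n+2) (H^e f2 - c f3) after n + 2 steps. Multiplying F by H^e replaces dividing c by
  it, and the earlier divisibilities survive because the correction is a multiple of
  p^(n+1).\<close>

lemma cartier_funpow_unit_root:
  assumes f: "\<And>k. cartier p h f \<in> const_plus_pN k (wS (a ^ p) (b ^ p))"
  shows "\<exists>m v. (\<forall>i\<le>Suc n. pp ^ i dvd (cartier p h ^^ i) (fps_const (hasse_coeff a b ^ m) * f - fps_const v * wS a b)) \<and>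
    (\<exists>f' \<in> dwork_mod k (Tw a b (Suc n)).
      (cartier p h ^^ Suc n) (fps_const (hasse_coeff a b ^ m) * f - fps_const v * wS a b) = pp ^ Suc n * f')"
proof (induction n arbitrary: k)
  case 0
  obtain c f1 where f1: "f1 \<in> dwork_mod k (Tw a b 1)" "cartier p h f = fps_const c * Tw a b 1 + pp * f1"
    using f[of k] unfolding const_plus_pN_def by auto
  obtain f2 where f2: "f2 \<in> dwork_mod k (Tw a b 1)" "cartier p h (wS a b) = fps_const (hasse_coeff a b) * Tw a b 1 + pp * f2"
    using cartier_wS[of h k a b] by auto
  define f3 where "f3 = fps_const (hasse_coeff a b) * f1 + fps_const (- c) * f2"
  have "(cartier p h ^^ Suc 0) (fps_const (hasse_coeff a b ^ 1) * f - fps_const c * wS a b) = pp ^ Suc 0 * f3"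
    unfolding cartier_funpow_linear
    by (simp add: f1(2) f2(2) f3_def algebra_simps flip: fps_const_neg)
  moreover have "f3 \<in> dwork_mod k (Tw a b (Suc 0))"
    unfolding f3_def using f1 f2 by (intro dwork_mod.add N_const_mult) auto
  moreover have "pp ^ i dvd (cartier p h ^^ i) (fps_const (hasse_coeff a b ^ 1) * f - fps_const c * wS a b)"
    if "i \<le> Suc 0" for i
  proof (cases i)
    case (Suc j)
    hence "i = Suc 0" using that by simp
    thus ?thesis using calculation(1) by (metis dvd_triv_left)
  qed simp
  ultimately show ?case by blast
next
  case (Suc n)
  let ?T = "Tw a b (Suc (Suc n))"
  obtain m v f1 where
    dvd: "\<And>i. i \<le> Suc n \<Longrightarrow> pp ^ i dvd (cartier p h ^^ i) (fps_const (hasse_coeff a b ^ m) * f - fps_const v * wS a b)"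
    and f1: "f1 \<in> dwork_mod (Suc k) (Tw a b (Suc n))"
      "(cartier p h ^^ Suc n) (fps_const (hasse_coeff a b ^ m) * f - fps_const v * wS a b) = pp ^ Suc n * f1"
    using Suc[of "Suc k"] by blast
  define F where "F = fps_const (hasse_coeff a b ^ m) * f - fps_const v * wS a b"
  obtain c f2 where f2: "f2 \<in> dwork_mod k ?T" "cartier p h f1 = fps_const c * ?T + pp * f2"
    using cartier_N[OF f1(1)] unfolding Tw_Suc const_plus_pN_def by blast
  obtain e f3 where f3: "f3 \<in> dwork_mod k ?T"
    "(cartier p h ^^ Suc (Suc n)) (wS a b) = fps_const (hasse_coeff a b ^ e) * ?T + pp * f3"
    using cartier_funpow_wS[of k a "Suc (Suc n)" b] by blast
  define v' where "v' = hasse_coeff a b ^ e * v + of_nat p ^ Suc n * c"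
  have F': "fps_const (hasse_coeff a b ^ (e + m)) * f - fps_const v' * wS a b =
      fps_const (hasse_coeff a b ^ e) * F - fps_const (of_nat p ^ Suc n * c) * wS a b"
    unfolding F_def v'_def power_add fps_const_mult[symmetric] fps_const_add[symmetric]
    by (simp add: algebra_simps del: fps_const_mult fps_const_add)
  have pc: "fps_const (of_nat p ^ Suc n * c) = pp ^ Suc n * fps_const c"
    by (simp only: fps_const_mult[symmetric] fps_const_power[symmetric] fps_of_nat)
  have lin: "(cartier p h ^^ i) (fps_const (hasse_coeff a b ^ (e + m)) * f - fps_const v' * wS a b) =
      fps_const (hasse_coeff a b ^ e) * (cartier p h ^^ i) F - pp ^ Suc n * fps_const c * (cartier p h ^^ i) (wS a b)" for i
    unfolding F' unfolding cartier_funpow_linear unfolding pc ..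
  define f4 where "f4 = fps_const (hasse_coeff a b ^ e) * f2 + fps_const (- c) * f3"
  have "(cartier p h ^^ Suc (Suc n)) F = cartier p h (of_nat (p ^ Suc n) * f1)"
    using f1(2) unfolding F_def[symmetric] by simp
  also have "\<dots> = pp ^ Suc n * (fps_const c * ?T + pp * f2)"
    unfolding cartier_of_nat_mult f2(2) by simp
  finally have "(cartier p h ^^ Suc (Suc n)) (fps_const (hasse_coeff a b ^ (e + m)) * f - fps_const v' * wS a b) =
      pp ^ Suc (Suc n) * f4"
    unfolding lin f3(2) f4_def by (simp add: algebra_simps flip: fps_const_neg)
  moreover have "f4 \<in> dwork_mod k ?T"
    unfolding f4_def using f2 f3 by (intro dwork_mod.add N_const_mult) auto
  moreover have "pp ^ i dvd (cartier p h ^^ i) (fps_const (hasse_coeff a b ^ (e + m)) * f - fps_const v' * wS a b)"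
    if "i \<le> Suc (Suc n)" for i
  proof (cases "i = Suc (Suc n)")
    case True
    thus ?thesis using calculation(1) by (metis dvd_triv_left)
  next
    case False
    hence i: "i \<le> Suc n" using that by simp
    show ?thesis unfolding lin
      by (intro dvd_diff dvd_mult dvd_mult2 dvd[OF i, folded F_def] le_imp_power_dvd i)
  qed
  ultimately show ?case by blast
qed

text \<open>The odd numbers 2 j + 1 divisible by p^i are p^i (2 l + 1), exactly the exponents read
  by the i-th Cartier iterate.\<close>

theorem unit_root_congruence:
  "\<exists>m v. \<forall>i\<le>k. \<forall>j. p ^ i dvd 2 * j + 1 \<longrightarrow>
     of_nat p ^ i dvd hasse_coeff a b ^ m * fps_nth (wS a b) (Suc j) - v * fps_nth (wS a b) j"
proof -
  \<comment> \<open>This is w^-1 S without its polar term; the shift turns the residue h into h +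
    1.\<close>
  define f where "f = fps_shift 1 (wS a b)"
  have "cartier p h f = cartier p (h + 1) (wS a b)"
    by (intro fps_ext) (simp add: f_def)
  hence "cartier p h f \<in> const_plus_pN k (wS (a ^ p) (b ^ p))" for k
    using cartier_wS[of "h + 1" k a b] unfolding const_plus_pN_def by auto
  from cartier_funpow_unit_root[OF this, of k] obtain m v where mv:
    "\<And>i. i \<le> Suc k \<Longrightarrow> pp ^ i dvd (cartier p h ^^ i) (fps_const (hasse_coeff a b ^ m) * f - fps_const v * wS a b)"
    by blast
  have "of_nat p ^ i dvd hasse_coeff a b ^ m * fps_nth (wS a b) (Suc j) - v * fps_nth (wS a b) j"
    if i: "i \<le> k" and j: "p ^ i dvd 2 * j + 1" for i j
  proof -
    have "odd (p ^ i)" using p_h by (metis even_power odd)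
    then obtain q where q: "p ^ i = 2 * q + 1" by (elim oddE)
    from j obtain r where r: "2 * j + 1 = p ^ i * r" by (elim dvdE)
    have "odd (2 * j + 1)" by simp
    hence "odd r" unfolding r by simp
    then obtain l where l: "r = 2 * l + 1" by (elim oddE)
    have "2 * j = 2 * (p ^ i * l + q)" using r unfolding l q by (simp add: algebra_simps)
    hence jl: "j = p ^ i * l + (p ^ i - 1) div 2" unfolding q by simp
    have "of_nat (p ^ i) dvd (cartier p h ^^ i) (fps_const (hasse_coeff a b ^ m) * f - fps_const v * wS a b)"
      using mv[of i] i by simp
    hence "of_nat (p ^ i) dvd fps_nth ((cartier p h ^^ i) (fps_const (hasse_coeff a b ^ m) * f - fps_const v * wS a b)) l"
      unfolding of_nat_dvd_fps_iff by blast
    thus ?thesis unfolding cartier_funpow_nth[OF p_h] jl[symmetric] by (simp add: f_def)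
  qed
  thus ?thesis by blast
qed

text \<open>The coefficient is the constant term of the i-th Cartier iterate of S, and every twist
  of S has constant term 1.\<close>

theorem wS_nth_mod_p:
  "\<exists>e. of_nat p dvd fps_nth (wS a b) ((p ^ i - 1) div 2) - hasse_coeff a b ^ e"
proof -
  obtain e f where "(cartier p h ^^ i) (wS a b) = fps_const (hasse_coeff a b ^ e) * Tw a b i + pp * f"
    using cartier_funpow_wS[of 0 a i b] by blast
  hence "fps_nth ((cartier p h ^^ i) (wS a b)) 0 = fps_nth (fps_const (hasse_coeff a b ^ e) * Tw a b i + pp * f) 0"
    by simp
  hence "fps_nth (wS a b) ((p ^ i - 1) div 2) - hasse_coeff a b ^ e = of_nat p * fps_nth f 0"
    unfolding cartier_funpow_nth[OF p_h] by (simp add: inv_sqrt_nth_0)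
  thus ?thesis by (metis dvd_triv_left)
qed

end

section \<open>Expansions at the origin\<close>

lemma prime_power_bezout:
  fixes n p :: nat
  assumes "prime p" "n > 0"
  obtains v n' where "n = p ^ v * n'" "\<And>k. \<exists>x y :: int. x * int n' + y * int p ^ k = 1"
proof -
  obtain v n' where n: "n = p ^ v * n'" "\<not> p dvd n'"
    using multiplicity_decompose'[of n p] assms by (metis not_prime_unit not_gr_zero)
  have "\<exists>x y :: int. x * int n' + y * int p ^ k = 1" for k
  proof -
    have "coprime (int n') (int (p ^ k))"
      using n(2) assms(1) by (metis coprime_commute coprime_int_iff coprime_power_right_iff
          prime_imp_coprime)
    thus ?thesis using bezout_int[of "int n'" "int (p ^ k)"] by auto
  qed
  with n(1) that show thesis by blast
qed

text \<open>If p^k divides n, then c is itself divisible by p^k and q = 0 works. Otherwise n = p^v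
  n' with v \<le> k, the factor p^v is divided out of c, and n' is inverted modulo p^k by
  Bezout.\<close>

lemma ex_of_nat_mult_cong:
  fixes c :: "'a::comm_ring_1"
  assumes "prime p" "n > 0" and c: "\<And>j. j \<le> k \<Longrightarrow> p ^ j dvd n \<Longrightarrow> of_nat p ^ j dvd c"
  shows "\<exists>q. of_nat p ^ k dvd of_nat n * q - c"
proof (cases "p ^ k dvd n")
  case True
  thus ?thesis using c[of k] by (intro exI[of _ 0]) simp
next
  case False
  obtain v n' where n: "n = p ^ v * n'" and bez: "\<And>k. \<exists>x y :: int. x * int n' + y * int p ^ k = 1"
    using prime_power_bezout assms by blast
  have "v \<le> k" using False n by (meson dvd_triv_left le_imp_power_dvd dvd_trans nat_le_linear)
  with c[of v] n obtain b where b: "c = of_nat p ^ v * b" by (auto elim!: dvdE)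
  obtain x y :: int where xy: "x * int n' + y * int p ^ k = 1" using bez by blast
  have "of_int (x * int n' + y * int p ^ k) = (1 :: 'a)" unfolding xy by simp
  hence xy': "of_nat n' * of_int x = 1 - of_int y * (of_nat p ^ k :: 'a)"
    by (simp add: algebra_simps)
  have "of_nat n * (of_int x * b) - c = of_nat p ^ v * (of_nat n' * of_int x) * b - c"
    by (simp add: n mult_ac)
  also have "\<dots> = of_nat p ^ k * (- (of_nat p ^ v * of_int y * b))"
    unfolding xy' b by (simp add: algebra_simps)
  finally show ?thesis by (metis dvd_triv_left)
qed

text \<open>Up to $p^k$, the hypothesis says that $f\,dt$ is the differential of a power series;
  this notion does not depend on the parameter.\<close>

lemma substitution_preserves_divisibility:
  fixes f z :: "'a::idom fps"
  assumes "prime p" and z: "fps_nth z 0 = 0"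
    and f: "\<And>n j. 0 < n \<Longrightarrow> n \<le> M \<Longrightarrow> j \<le> k \<Longrightarrow> p ^ j dvd n \<Longrightarrow> of_nat p ^ j dvd fps_nth f (n - 1)"
    and n: "0 < n" "n \<le> M" and j: "j \<le> k" "p ^ j dvd n"
  shows "of_nat p ^ j dvd fps_nth ((f oo z) * fps_deriv z) (n - 1)"
proof -
  have "\<exists>q. of_nat p ^ k dvd of_nat n * q - fps_nth f (n - 1)" if "0 < n" "n \<le> M" for n
    using ex_of_nat_mult_cong[OF assms(1) that(1)] f[OF that] by blast
  then obtain q where q: "\<And>n. 0 < n \<Longrightarrow> n \<le> M \<Longrightarrow> of_nat p ^ k dvd of_nat n * q n - fps_nth f (n - 1)"
    by metis
  \<comment> \<open>\<open>Z\<close> is an approximate primitive: its derivative agrees with f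
    modulo p^k below degree M, so the error \<open>D\<close> is a multiple of p^k plus a tail of
    order at least M. Neither affects the claim for n \<le> M.\<close>
  define Z where "Z = Abs_fps (\<lambda>n. if n \<le> M then q n else 0)"
  define D where "D = fps_deriv Z - f"
  have D: "of_nat p ^ k dvd fps_nth D i" if "i < M" for i
    using q[of "Suc i"] that by (simp add: D_def Z_def)
  define D1 where "D1 = Abs_fps (\<lambda>i. if i < M then fps_nth D i else 0)"
  have "of_nat (p ^ k) dvd D1"
    unfolding of_nat_dvd_fps_iff using D by (simp add: D1_def)
  then obtain e where e: "D1 = of_nat (p ^ k) * e" by (elim dvdE)
  have "D = D1 + fps_X ^ M * fps_shift M D"
    by (intro fps_ext) (auto simp: D1_def fps_X_power_mult_nth)
  hence "f = fps_deriv Z - (of_nat (p ^ k) * e + fps_X ^ M * fps_shift M D)"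
    unfolding e D_def by (simp add: algebra_simps)
  hence "f oo z = (fps_deriv Z oo z) - ((of_nat (p ^ k) * e + fps_X ^ M * fps_shift M D) oo z)"
    by (metis fps_compose_sub_distrib)
  also have "(of_nat (p ^ k) * e + fps_X ^ M * fps_shift M D) oo z =
      of_nat (p ^ k) * (e oo z) + z ^ M * (fps_shift M D oo z)"
    by (simp add: fps_compose_add_distrib fps_compose_mult_distrib[OF z] fps_compose_power[OF z, symmetric]
        fps_X_fps_compose_startby0[OF z] fps_of_nat[symmetric] del: of_nat_power)
  finally have fz: "f oo z = (fps_deriv Z oo z) -
      (of_nat (p ^ k) * (e oo z) + z ^ M * (fps_shift M D oo z))" .
  have "(f oo z) * fps_deriv z = fps_deriv (Z oo z) -
      of_nat (p ^ k) * ((e oo z) * fps_deriv z) - z ^ M * ((fps_shift M D oo z) * fps_deriv z)"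
    unfolding fps_compose_deriv[OF z] fz by (simp add: algebra_simps)
  moreover have "fps_nth (z ^ M * ((fps_shift M D oo z) * fps_deriv z)) (n - 1) = 0"
  proof -
    have "fps_X dvd z" using fps_X_power_dvd_iff[of 1 z] z by simp
    hence "fps_X ^ M dvd z ^ M * ((fps_shift M D oo z) * fps_deriv z)"
      by (intro dvd_mult2 dvd_power_same)
    thus ?thesis using n by (simp add: fps_X_power_dvd_iff)
  qed
  ultimately have "fps_nth ((f oo z) * fps_deriv z) (n - 1) =
      of_nat n * fps_nth (Z oo z) n - of_nat p ^ k * fps_nth ((e oo z) * fps_deriv z) (n - 1)"
    using n by (simp add: fps_of_nat[symmetric] del: of_nat_power) simp
  moreover have "of_nat p ^ j dvd (of_nat n :: 'a)"
    using j(2) by (auto elim!: dvdE)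
  ultimately show ?thesis
    using j(1) by (simp add: dvd_diff le_imp_power_dvd dvd_mult2)
qed

section \<open>The curve in the parameters t and z\<close>

context inverse_sqrt_series
begin

context
  fixes a b :: 'a and U :: "'a fps"
  assumes U: "U = 1 + fps_const a * fps_X ^ 4 * U ^ 2 + fps_const b * fps_X ^ 6 * U ^ 3"
begin

text \<open>U stands for -1 / (t^3 y), so that x = 1 / (t^2 U): \<open>z\<close> = t U^(1/2) is
  x^(-1/2), \<open>q\<close> = U^(-1/2) is t / z, and \<open>tau\<close> is t as a series in
  z.\<close>

definition "q = inv_sqrt U"
definition "z = fps_X * U * q"
definition "W = q * fps_deriv z"
text \<open>The regular part x W - t^-2 of x omega, by \<open>U_eq_W\<close>.\<close>

definition "E = (fps_const a * z ^ 2 + 2 * fps_const b * z ^ 4) * W"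
definition "tau = fps_X * (inv_sqrt (wcubic a b) oo fps_X ^ 2)"

lemma U_0: "fps_nth U 0 = 1"
  using arg_cong[OF U, of "\<lambda>f. fps_nth f 0"] by (simp add: mult.assoc)

lemma q_square: "q ^ 2 * U = 1"
  unfolding q_def using inv_sqrt_square U_0 by blast

lemma q_0: "fps_nth q 0 = 1"
  by (simp add: q_def inv_sqrt_nth_0)

lemma z_0: "fps_nth z 0 = 0"
  by (simp add: z_def mult.assoc)

lemma z_1: "fps_nth z 1 = 1"
  by (simp add: z_def mult.assoc U_0 q_0)

lemma z_square: "z ^ 2 = fps_X ^ 2 * U"
  using q_square unfolding z_def by Groebner_Basis.algebra

lemma z_q: "z * q = fps_X"
  using q_square unfolding z_def by Groebner_Basis.algebra

lemma z2_0: "fps_nth (z ^ 2) 0 = 0"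
  by (simp add: fps_nth_power_0 z_0)

lemma U_z: "U = 1 + fps_const a * z ^ 4 + fps_const b * z ^ 6"
proof -
  have "z ^ 4 = fps_X ^ 4 * U ^ 2" "z ^ 6 = fps_X ^ 6 * U ^ 3"
    using z_square by Groebner_Basis.algebra+
  thus ?thesis by (intro trans[OF U]) (simp add: mult.assoc)
qed

lemma wcubic_z: "wcubic a b oo z ^ 2 = U"
  unfolding wcubic_def
  by (rule trans[OF _ U_z[symmetric]]) (simp add: fps_compose_add_distrib fps_compose_mult_distrib[OF z2_0]
      fps_compose_power[OF z2_0, symmetric] fps_X_fps_compose_startby0[OF z2_0] power_mult[symmetric])

lemma wS_z: "inv_sqrt (wcubic a b) oo z ^ 2 = q"
  unfolding q_def
proof (rule inv_sqrt_unique)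
  have "(inv_sqrt (wcubic a b) oo z ^ 2) ^ 2 * U = (inv_sqrt (wcubic a b) ^ 2 * wcubic a b) oo z ^ 2"
    unfolding fps_compose_mult_distrib[OF z2_0] wcubic_z fps_compose_power[OF z2_0] ..
  thus "(inv_sqrt (wcubic a b) oo z ^ 2) ^ 2 * U = 1" by (simp add: inv_sqrt_square)
qed (simp add: inv_sqrt_nth_0)

lemma X2_z: "fps_X ^ 2 oo z = z ^ 2"
  by (simp add: fps_compose_power[OF z_0, symmetric] fps_X_fps_compose_startby0[OF z_0])

lemma compose_X2_z: "(f oo fps_X ^ 2) oo z = f oo z ^ 2"
proof -
  have "fps_nth (fps_X ^ 2 :: 'a fps) 0 = 0" by (simp add: fps_X_power_iff)
  from fps_compose_assoc[OF z_0 this] show ?thesis by (simp add: X2_z)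
qed

lemma tau_0: "fps_nth tau 0 = 0"
  by (simp add: tau_def)

lemma tau_z: "tau oo z = fps_X"
  unfolding tau_def fps_compose_mult_distrib[OF z_0] compose_X2_z wS_z
  by (simp add: fps_X_fps_compose_startby0[OF z_0] z_q)

text \<open>Substituting z is injective because its linear coefficient is 1, so the one-sided
  inverse \<open>tau\<close> is two-sided.\<close>

lemma z_tau: "z oo tau = fps_X"
proof -
  have "(z oo tau) oo z = fps_X oo z"
    unfolding fps_compose_assoc[OF z_0 tau_0, symmetric] tau_z
    by (simp add: fps_X_fps_compose_startby0[OF z_0])
  thus ?thesis using fps_compose_inj_right[OF z_0] z_1 by auto
qed

lemma W_z: "W = ((inv_sqrt (wcubic a b) oo fps_X ^ 2) oo z) * fps_deriv z"
  by (simp add: W_def compose_X2_z wS_z)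

text \<open>The invariant differential in the parameter z: W dt = S(z^2) dz.\<close>

lemma W_tau: "(W oo tau) * fps_deriv tau = inv_sqrt (wcubic a b) oo fps_X ^ 2"
proof -
  have "(fps_deriv z oo tau) * fps_deriv tau = 1"
    unfolding fps_compose_deriv[OF tau_0, symmetric] z_tau by simp
  thus ?thesis
    unfolding W_z fps_compose_mult_distrib[OF tau_0] fps_compose_assoc[OF tau_0 z_0, symmetric] z_tau
    by (simp add: mult.assoc)
qed

text \<open>Divided by z^2 = t^2 U this reads x W = t^-2 + E. It comes from differentiating z q = t,
  q^2 U = 1 and U = 1 + a z^4 + b z^6; a factor 2 has to be cancelled on the way.\<close>

lemma U_eq_W: "U = W * (1 - fps_const a * z ^ 4 - 2 * fps_const b * z ^ 6)"
proof -
  define A B z' q' U' where "A = fps_const a" and "B = fps_const b" and "z' = fps_deriv z"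
    and "q' = fps_deriv q" and "U' = fps_deriv U"
  have "fps_deriv (z * q) = 1" by (simp add: z_q)
  hence 1: "z' * q + z * q' = 1" by (simp add: z'_def q'_def algebra_simps)
  have "fps_deriv (q ^ 2 * U) = 0" by (simp add: q_square)
  hence 2: "q * (2 * q' * U + q * U') = 0"
    by (simp add: q'_def U'_def power2_eq_square algebra_simps)
  have "q \<noteq> 0" using q_0 by auto
  with 2 have 2: "2 * (q' * U) = - (q * U')" by (simp add: eq_neg_iff_add_eq_0 mult.assoc)
  have "U' = fps_deriv (1 + A * z ^ 4 + B * z ^ 6)"
    unfolding U'_def A_def B_def by (rule arg_cong[OF U_z])
  hence 3: "U' = 2 * (z * z' * (2 * A * z ^ 2 + 3 * B * z ^ 4))"
    unfolding A_def B_def z'_def by (simp add: fps_deriv_power algebra_simps eval_nat_numeral)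
  have "2 * (z * q' * U) = 2 * (- (z ^ 2 * W * (2 * A * z ^ 2 + 3 * B * z ^ 4)))"
    using 2 3 unfolding W_def z'_def by Groebner_Basis.algebra
  moreover have "(2 :: 'a fps) \<noteq> 0"
    using two_neq_0 by (metis fps_const_eq_0_iff fps_numeral_fps_const)
  ultimately have 4: "z * q' * U = - (z ^ 2 * W * (2 * A * z ^ 2 + 3 * B * z ^ 4))"
    using mult_left_cancel by blast
  have 5: "W + z * q' = 1" using 1 by (simp add: W_def z'_def mult.commute)
  have 6: "U = 1 + A * z ^ 4 + B * z ^ 6" unfolding A_def B_def by (rule U_z)
  show ?thesis unfolding A_def[symmetric] B_def[symmetric]
    using 4 5 6 by Groebner_Basis.algebra
qed

text \<open>U(-t) solves the same equation, since only even powers of t occur in it. The solution is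
  unique: the difference of two is annihilated by a series with constant term 1.\<close>

lemma even_U: "U oo (- fps_X) = U"
proof -
  define V where "V = U oo (- fps_X)"
  have X0: "fps_nth (- fps_X :: 'a fps) 0 = 0" by simp
  have "V = (1 + fps_const a * fps_X ^ 4 * U ^ 2 + fps_const b * fps_X ^ 6 * U ^ 3) oo (- fps_X)"
    unfolding V_def by (rule arg_cong[OF U])
  hence V: "V = 1 + fps_const a * fps_X ^ 4 * V ^ 2 + fps_const b * fps_X ^ 6 * V ^ 3"
    unfolding V_def by (simp add: fps_compose_add_distrib fps_compose_mult_distrib[OF X0]
        fps_compose_power[OF X0, symmetric] fps_X_fps_compose_startby0[OF X0])
  define c where "c = 1 - fps_X * (fps_const a * fps_X ^ 3 * (V + U) +
      fps_const b * fps_X ^ 5 * (V ^ 2 + V * U + U ^ 2))"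
  have "(V - U) * c = 0"
    using U V unfolding c_def by Groebner_Basis.algebra
  moreover have "fps_nth c 0 = 1" by (simp add: c_def)
  hence "c \<noteq> 0" by auto
  ultimately show ?thesis by (simp add: V_def)
qed

text \<open>z is odd in t, so dz/dt is even. The vanishing odd coefficients are what allows zeta to
  be odd.\<close>

lemma even_W: "W oo (- fps_X) = W" and even_E: "E oo (- fps_X) = E"
proof -
  have X0: "fps_nth (- fps_X :: 'a fps) 0 = 0" by simp
  have q: "q oo (- fps_X) = q"
    unfolding q_def inv_sqrt_def using U_0
    by (subst fps_compose_assoc[OF X0, symmetric]) (simp_all add: fps_compose_sub_distrib even_U)
  have z: "z oo (- fps_X) = - z"
    unfolding z_def fps_compose_mult_distrib[OF X0] q even_U
    by (simp add: fps_X_fps_compose_startby0[OF X0])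
  have "fps_deriv (z oo (- fps_X)) = - (fps_deriv z oo (- fps_X))"
    unfolding fps_compose_deriv[OF X0] by simp
  hence z': "fps_deriv z oo (- fps_X) = fps_deriv z" unfolding z by simp
  show W: "W oo (- fps_X) = W"
    unfolding W_def fps_compose_mult_distrib[OF X0] q z' ..
  show "E oo (- fps_X) = E"
    unfolding E_def fps_compose_mult_distrib[OF X0] W fps_compose_add_distrib
      fps_compose_power[OF X0, symmetric] z
    by (simp add: numeral_fps_const)
qed

lemma odd_nth_eq_0:
  fixes f :: "'a fps"
  assumes "f oo (- fps_X) = f" "odd n"
  shows "fps_nth f n = 0"
proof -
  have "fps_nth (f oo (- fps_X)) n = - fps_nth f n"
    unfolding fps_compose_uminus' using assms(2) by simp
  hence "2 * fps_nth f n = 0" unfolding assms(1) eq_neg_iff_add_eq_0 mult_2 .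
  thus ?thesis using two_neq_0 by simp
qed

lemmas odd_nth_W = odd_nth_eq_0[OF even_W] and odd_nth_E = odd_nth_eq_0[OF even_E]

end

text \<open>The coefficient of z^(2j) in E dt = z^-2 S(z^2) dz + d(1/t), where 1/t = z^-1 (g S)(z^2)
  because t = z S(z^2) and S^2 g = 1. The factor 2 j + 1 absorbs every power of p dividing the
  exponent.\<close>

lemma wS_nth_Suc:
  fixes a b :: 'a
  defines "S \<equiv> inv_sqrt (wcubic a b)"
  shows "fps_nth ((fps_const a * fps_X + 2 * fps_const b * fps_X ^ 2) * S) j =
    fps_nth S (Suc j) + of_nat (2 * j + 1) * fps_nth (wcubic a b * S) (Suc j)"
proof -
  define A B g g' S' where "A = fps_const a" and "B = fps_const b" and "g = wcubic a b"
    and "g' = fps_deriv (wcubic a b)" and "S' = fps_deriv S"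
  have g: "g = 1 + A * fps_X ^ 2 + B * fps_X ^ 3" by (simp add: g_def wcubic_def A_def B_def)
  have g': "g' = 2 * A * fps_X + 3 * B * fps_X ^ 2"
    unfolding g'_def wcubic_def A_def B_def by (simp add: fps_deriv_power algebra_simps)
  have Sg: "S ^ 2 * g = 1" unfolding S_def g_def by (simp add: inv_sqrt_square)
  have "fps_deriv (S ^ 2 * g) = 0" by (simp add: Sg)
  hence "S * (2 * S' * g + S * g') = 0"
    by (simp add: S'_def g'_def g_def power2_eq_square algebra_simps)
  moreover have "fps_nth S 0 = 1" by (simp add: S_def inv_sqrt_nth_0)
  hence "S \<noteq> 0" by auto
  ultimately have S': "2 * S' * g + S * g' = 0" by simp
  have d: "fps_deriv (g * S) = g' * S + g * S'"
    by (simp add: g_def g'_def S'_def algebra_simps)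
  have "fps_X * ((A * fps_X + 2 * B * fps_X ^ 2) * S) =
      S + 2 * (fps_X * fps_deriv (g * S)) - g * S"
  proof -
    have "2 * (fps_X * fps_deriv (g * S)) = fps_X * g' * S + fps_X * (2 * S' * g + S * g')"
      unfolding d by (simp add: algebra_simps)
    thus ?thesis unfolding S' unfolding g g'
      by (simp add: algebra_simps power2_eq_square power3_eq_cube)
  qed
  hence "fps_nth (fps_X * ((A * fps_X + 2 * B * fps_X ^ 2) * S)) (Suc j) =
      fps_nth (S + 2 * (fps_X * fps_deriv (g * S)) - g * S) (Suc j)" by simp
  hence "fps_nth ((A * fps_X + 2 * B * fps_X ^ 2) * S) j =
      fps_nth S (Suc j) + 2 * (of_nat (Suc j) * fps_nth (g * S) (Suc j)) - fps_nth (g * S) (Suc j)"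
    by (simp add: numeral_fps_const del: fps_deriv_mult)
  thus ?thesis
    unfolding A_def B_def g_def by (simp add: algebra_simps)
qed

end

section \<open>Exactness carried between z and t\<close>

context dwork
begin

context
  fixes a b :: 'a and U :: "'a fps"
  assumes U: "U = 1 + fps_const a * fps_X ^ 4 * U ^ 2 + fps_const b * fps_X ^ 6 * U ^ 3"
begin

text \<open>The congruence for S is corrected by the exact term of \<open>wS_nth_Suc\<close>, read
  as a statement about the form f(z^2) dz, and pulled back along z(t).\<close>

theorem unit_root_divisibility:
  "\<exists>m v. \<forall>n>0. \<forall>j\<le>k. p ^ j dvd n \<longrightarrow>
     of_nat p ^ j dvd hasse_coeff a b ^ m * fps_nth (E a b U) (n - 1) - v * fps_nth (W U) (n - 1)"
proof -
  define S where "S = wS a b"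
  obtain m v where mv: "\<And>i j. i \<le> k \<Longrightarrow> p ^ i dvd 2 * j + 1 \<Longrightarrow>
     of_nat p ^ i dvd hasse_coeff a b ^ m * fps_nth S (Suc j) - v * fps_nth S j"
    using unit_root_congruence[of k a b] unfolding S_def by blast
  define f where "f = fps_const (hasse_coeff a b ^ m) * ((fps_const a * fps_X + 2 * fps_const b * fps_X ^ 2) * S)
      - fps_const v * S"
  have f: "of_nat p ^ i dvd fps_nth f j" if i: "i \<le> k" "p ^ i dvd 2 * j + 1" for i j
  proof -
    have "fps_nth f j = (hasse_coeff a b ^ m * fps_nth S (Suc j) - v * fps_nth S j) +
        of_nat (2 * j + 1) * (hasse_coeff a b ^ m * fps_nth (wcubic a b * S) (Suc j))"
      unfolding f_def S_def fps_sub_nth fps_mult_left_const_nth wS_nth_Suc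
      by (simp add: algebra_simps del: of_nat_add of_nat_mult of_nat_Suc)
    moreover have "of_nat p ^ i dvd (of_nat (2 * j + 1) :: 'a)"
      using i(2) by (metis of_nat_power of_nat_mult dvd_def)
    ultimately show ?thesis using mv[OF i] by (auto intro!: dvd_add dvd_mult2 simp del: of_nat_add of_nat_mult)
  qed
  have f2: "of_nat p ^ j dvd fps_nth (f oo fps_X ^ 2) (n - 1)"
    if "0 < n" "j \<le> k" "p ^ j dvd n" for n j
  proof (cases "even (n - 1)")
    case True
    then obtain l where l: "n - 1 = 2 * l" by (elim evenE)
    hence "n = 2 * l + 1" using that by simp
    thus ?thesis using f[of j l] that by (simp add: fps_nth_compose_X_power)
  qed (simp add: fps_nth_compose_X_power)
  have "((f oo fps_X ^ 2) oo z U) * fps_deriv (z U) =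
      fps_const (hasse_coeff a b ^ m) * E a b U - fps_const v * W U"
    unfolding f_def S_def compose_X2_z[OF U] fps_compose_sub_distrib fps_compose_add_distrib
      fps_compose_mult_distrib[OF z2_0[OF U]] wS_z[OF U] E_def[OF U] W_def[OF U]
    by (simp add: fps_compose_power[OF z2_0[OF U], symmetric] numeral_fps_const
        fps_X_fps_compose_startby0[OF z2_0[OF U]] power_mult[symmetric] algebra_simps)
  hence "of_nat p ^ j dvd fps_nth (fps_const (hasse_coeff a b ^ m) * E a b U - fps_const v * W U) (n - 1)"
    if "0 < n" "j \<le> k" "p ^ j dvd n" for n j
    using substitution_preserves_divisibility[OF prime z_0[OF U] f2, where M = n and k = k] that
    by auto
  thus ?thesis by (intro exI[of _ m] exI[of _ v]) simp
qed

text \<open>In the parameter z, the exponent p^k - 1 alone gives that p^k divides v w for a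
  coefficient w of S congruent modulo p to a power x of the Hasse coefficient. Replacing a factor x
  by w - p c gains one p each time, whence p^k divides v x^k.\<close>

theorem W_detects_divisibility:
  assumes v: "\<And>n j. 0 < n \<Longrightarrow> n \<le> p ^ k \<Longrightarrow> j \<le> k \<Longrightarrow> p ^ j dvd n \<Longrightarrow>
    of_nat p ^ j dvd v * fps_nth (W U) (n - 1)"
  shows "\<exists>e. of_nat p ^ k dvd v * hasse_coeff a b ^ e"
proof -
  define S where "S = wS a b"
  have "of_nat p ^ k dvd fps_nth (((fps_const v * W U) oo tau a b) * fps_deriv (tau a b)) (p ^ k - 1)"
  proof (rule substitution_preserves_divisibility[OF prime tau_0[OF U], where M = "p ^ k" and k = k])
    show "of_nat p ^ j dvd fps_nth (fps_const v * W U) (n - 1)"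
      if "0 < n" "n \<le> p ^ k" "j \<le> k" "p ^ j dvd n" for n j
      using v[OF that] by simp
    show "0 < p ^ k" using prime by (simp add: prime_gt_0_nat)
  qed simp_all
  also have "((fps_const v * W U) oo tau a b) * fps_deriv (tau a b) = fps_const v * (S oo fps_X ^ 2)"
    unfolding fps_compose_mult_distrib[OF tau_0[OF U]] S_def W_tau[OF U, symmetric] by simp
  also have "fps_nth \<dots> (p ^ k - 1) = v * fps_nth S ((p ^ k - 1) div 2)"
    using odd by (simp add: fps_nth_compose_X_power)
  finally have vS: "of_nat p ^ k dvd v * fps_nth S ((p ^ k - 1) div 2)" .
  obtain e where "of_nat p dvd fps_nth S ((p ^ k - 1) div 2) - hasse_coeff a b ^ e"
    using wS_nth_mod_p unfolding S_def by blast
  then obtain c where "fps_nth S ((p ^ k - 1) div 2) - hasse_coeff a b ^ e = of_nat p * c" by (elim dvdE)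
  moreover define w x where "w = fps_nth S ((p ^ k - 1) div 2)" and "x = hasse_coeff a b ^ e"
  ultimately have c: "x = w - of_nat p * c" by (simp add: algebra_simps)
  have "of_nat p ^ j dvd v * x ^ j" if "j \<le> k" for j
    using that
  proof (induction j)
    case (Suc j)
    have "v * x ^ Suc j = (v * x ^ j) * x"
      by (simp add: mult_ac)
    also have "\<dots> = (v * x ^ j) * (w - of_nat p * c)"
      by (rule arg_cong[OF c])
    also have "\<dots> = x ^ j * (v * w) - of_nat p * (v * x ^ j) * c"
      by (simp add: algebra_simps)
    also have "of_nat p ^ Suc j dvd \<dots>"
    proof (rule dvd_diff)
      show "of_nat p ^ Suc j dvd x ^ j * (v * w)"
        using vS Suc.prems unfolding w_def by (meson dvd_mult dvd_trans le_imp_power_dvd)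
      have "of_nat p ^ j dvd v * x ^ j" using Suc by simp
      thus "of_nat p ^ Suc j dvd of_nat p * (v * x ^ j) * c"
        unfolding power_Suc by (intro dvd_mult2[of _ "of_nat p * (v * x ^ j)"] mult_dvd_mono dvd_refl)
    qed
    finally show ?case .
  qed simp
  hence "of_nat p ^ k dvd v * hasse_coeff a b ^ (e * k)" by (simp add: x_def power_mult)
  thus ?thesis by blast
qed

end

end

section \<open>Specialisation to R and the given curve\<close>

lemma of_nat_R_neq_0:
  assumes "n > 0"
  shows "of_nat n \<noteq> (0 :: R)"
proof -
  have "rat_of_zsixth (of_nat n) = of_nat n"
    by (induction n) (simp_all add: zero_zsixth.rep_eq one_zsixth.rep_eq plus_zsixth.rep_eq)
  hence "of_nat n \<noteq> (0 :: zsixth)"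
    using assms by (metis zero_zsixth.rep_eq of_nat_eq_0_iff not_gr_zero)
  thus ?thesis by (simp add: of_nat_poly)
qed

lemma R_half_exists: "\<exists>h :: R. 2 * h = 1"
proof -
  obtain h :: zsixth where "2 * h = 1" using zsixth_half_exists ..
  hence "2 * [:[:h:]:] = (1 :: R)"
    by (simp only: mult_2 add_pCons add_0) (simp add: one_pCons)
  thus ?thesis ..
qed

text \<open>g is the reversal w^3 f(1/w), so in f^h, of degree 3h, the coefficient of x^(2h) becomes
  that of w^h.\<close>

lemma hasse_eq_wcubic:
  assumes "p = 2 * h + 1"
  shows "hasse p = fps_nth (wcubic A4 A6 ^ h) h"
proof -
  have "reflect_poly cubic = [:1, 0, A4, A6:]"
    by (simp add: cubic_def reflect_poly_def cCons_def A6_def)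
  hence "wcubic A4 A6 = fps_of_poly (reflect_poly cubic)"
    by (intro fps_ext) (auto simp: wcubic_def coeff_pCons fps_X_power_iff
        numeral_eq_Suc split: nat.splits)
  hence "wcubic A4 A6 ^ h = fps_of_poly (reflect_poly (cubic ^ h))"
    by (simp add: fps_of_poly_power reflect_poly_power)
  hence "fps_nth (wcubic A4 A6 ^ h) h = coeff (reflect_poly (cubic ^ h)) h" by simp
  also have "degree cubic = 3" by (simp add: cubic_def)
  hence "degree (cubic ^ h) = 3 * h" by (subst degree_power_eq) (auto simp: cubic_def)
  hence "coeff (reflect_poly (cubic ^ h)) h = coeff (cubic ^ h) (2 * h)"
    by (simp add: coeff_reflect_poly)
  finally show ?thesis using assms by (simp add: hasse_def)
qed

text \<open>The parameter z is gone from the conclusion. Existence and uniqueness of beta rest on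
  the last two claims, which carry powers of H because they are stated in R.\<close>

theorem expansion_congruences:
  assumes "prime p" "p > 3"
  obtains W E :: "R fps" where
    "W_exp = fps_to_fls W" "x_exp * W_exp = fls_X_inv ^ 2 + fps_to_fls E"
    "\<And>n. odd n \<Longrightarrow> fps_nth W n = 0" "\<And>n. odd n \<Longrightarrow> fps_nth E n = 0"
    "\<And>k. \<exists>m v. \<forall>n>0. \<forall>j\<le>k. p ^ j dvd n \<longrightarrow>
       of_nat p ^ j dvd hasse p ^ m * fps_nth E (n - 1) - v * fps_nth W (n - 1)"
    "\<And>k v. (\<And>n j. 0 < n \<Longrightarrow> n \<le> p ^ k \<Longrightarrow> j \<le> k \<Longrightarrow> p ^ j dvd n \<Longrightarrow>
         of_nat p ^ j dvd v * fps_nth W (n - 1)) \<Longrightarrow>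
       \<exists>e. of_nat p ^ k dvd v * hasse p ^ e"
proof -
  obtain s :: "R fps" where s: "fps_nth s 0 = 1" "s ^ 2 * (1 + fps_X) = 1"
    using R_half_exists exists_inverse_sqrt_series by blast
  have two: "(2 :: R) \<noteq> 0" using of_nat_R_neq_0[of 2] by simp
  have odd: "odd p" using assms prime_odd_nat by auto
  interpret dwork s p
    using s two odd assms of_nat_R_neq_0[of p] by unfold_locales auto
  have hasse_coeff: "hasse_coeff A4 A6 = hasse p" using hasse_eq_wcubic[OF p_h] by simp
  define X Y :: "R fls" where "X = fls_X" and "Y = fls_X_inv"
  define a b where "a = fls_const A4" and "b = fls_const A6"
  have XY: "X * Y = 1" unfolding X_def Y_def by (rule fls_X_times_X_inv)
  obtain u where u: "y_exp * fps_to_fls u = - (Y ^ 3)" "fps_nth u 0 = 1"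
    using expansion_exists expansion_at_O_unique unfolding Y_def by blast
  have curve: "y_exp ^ 2 = x_exp ^ 3 + a * x_exp + b" and xy: "x_exp = - (X * y_exp)"
    using expansion_xy_exp unfolding expansion_at_O_def a_def b_def X_def by blast+
  define U where "U = fps_to_fls u"
  have yU: "y_exp * U = - (Y ^ 3)" using u(1) by (simp add: U_def)
  \<comment> \<open>With y U = -t^-3, the curve equation multiplied by t^6 U^3 becomes the fixed
    point equation for U.\<close>
  have "U = X ^ 6 * (y_exp ^ 2 * U ^ 2) * U"
  proof -
    have "X ^ 6 * (y_exp * U) ^ 2 = 1" unfolding yU using XY by Groebner_Basis.algebra
    thus ?thesis by (simp add: power_mult_distrib mult.assoc[symmetric])
  qed
  also have "\<dots> = X ^ 6 * U ^ 3 * (x_exp ^ 3 + a * x_exp + b)"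
    unfolding curve by Groebner_Basis.algebra
  also have "\<dots> = - (X ^ 9 * (y_exp * U) ^ 3) - a * X ^ 7 * (y_exp * U) * U ^ 2 + b * X ^ 6 * U ^ 3"
    unfolding xy by Groebner_Basis.algebra
  also have "\<dots> = 1 + a * X ^ 4 * U ^ 2 + b * X ^ 6 * U ^ 3"
    unfolding yU using XY by Groebner_Basis.algebra
  finally have "fps_to_fls u = fps_to_fls (1 + fps_const A4 * fps_X ^ 4 * u ^ 2 + fps_const A6 * fps_X ^ 6 * u ^ 3)"
    unfolding U_def a_def b_def X_def
    by (simp add: fls_times_fps_to_fls fps_to_fls_power flip: fps_const_to_fls)
  hence ueq: "u = 1 + fps_const A4 * fps_X ^ 4 * u ^ 2 + fps_const A6 * fps_X ^ 6 * u ^ 3"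
    by (simp only: fps_to_fls_eq_iff)
  define zz where "zz = fps_to_fls (z u)"
  define z' where "z' = fps_to_fls (fps_deriv (z u))"
  define qq where "qq = fps_to_fls (q u)"
  define Wf where "Wf = fps_to_fls (W u)"
  have Wf: "Wf = qq * z'"
    by (simp add: Wf_def W_def[OF ueq] qq_def z'_def fls_times_fps_to_fls)
  have z2: "zz ^ 2 = X ^ 2 * U"
    using arg_cong[OF z_square[OF ueq], of fps_to_fls]
    by (simp add: zz_def X_def U_def fls_times_fps_to_fls fps_to_fls_power)
  have zq: "zz * qq = X"
    using arg_cong[OF z_q[OF ueq], of fps_to_fls]
    by (simp add: zz_def X_def qq_def fls_times_fps_to_fls)
  have UW: "U = Wf * (1 - a * zz ^ 4 - 2 * b * zz ^ 6)"
    using arg_cong[OF U_eq_W[OF ueq], of fps_to_fls]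
    by (simp add: zz_def Wf_def U_def a_def b_def fls_times_fps_to_fls fps_to_fls_power
        flip: fps_const_to_fls)
  have dz: "fls_deriv zz = z'" by (simp add: zz_def z'_def fls_deriv_fps_to_fls)
  have xz: "x_exp * zz ^ 2 = 1"
    unfolding z2 xy using yU XY by Groebner_Basis.algebra
  have "fls_deriv (x_exp * zz ^ 2) = 0" unfolding xz by simp
  hence dx: "fls_deriv x_exp * zz ^ 2 + 2 * x_exp * zz * z' = 0"
    by (simp add: dz power2_eq_square algebra_simps)
  have zz0: "zz \<noteq> 0" using xz by auto
  have yz: "y_exp * zz ^ 2 * X = - 1"
    unfolding z2 using yU XY by Groebner_Basis.algebra
  \<comment> \<open>The factor z^3 makes the relations x z^2 = 1, z q = t and y z^2 t = -1
    applicable.\<close>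
  have "zz ^ 3 * (Wf * (2 * y_exp)) = 2 * z' * (y_exp * zz ^ 2 * (zz * qq))"
    unfolding Wf by Groebner_Basis.algebra
  also have "\<dots> = - 2 * z'" unfolding zq yz by simp
  also have "\<dots> = zz ^ 3 * fls_deriv x_exp"
    using dx xz by Groebner_Basis.algebra
  finally have "Wf * (2 * y_exp) = fls_deriv x_exp" using zz0 by simp
  hence "Wf * (2 * y_exp) = W_exp * (2 * y_exp)" using W_exp by simp
  moreover have "2 * y_exp \<noteq> 0"
  proof -
    have "y_exp \<noteq> 0" using yz by auto
    moreover have "(2 :: R fls) \<noteq> 0"
      using two by (metis fls_const_numeral fls_const_nonzero)
    ultimately show ?thesis by simp
  qed
  ultimately have W: "W_exp = fps_to_fls (W u)" by (simp add: Wf_def)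
  have "fps_to_fls (E A4 A6 u) = (a * zz ^ 2 + 2 * b * zz ^ 4) * Wf"
    by (simp add: E_def[OF ueq] zz_def Wf_def a_def b_def fls_times_fps_to_fls fps_to_fls_power
        flip: fps_const_to_fls)
  moreover have "x_exp * U = Y ^ 2"
    unfolding xy using yU XY by Groebner_Basis.algebra
  ultimately have "x_exp * Wf = Y ^ 2 + fps_to_fls (E A4 A6 u)"
    using UW xz by Groebner_Basis.algebra
  hence E: "x_exp * W_exp = fls_X_inv ^ 2 + fps_to_fls (E A4 A6 u)"
    unfolding W Wf_def Y_def .
  show thesis
    by (rule that[OF W E])
       (use odd_nth_W[OF ueq] odd_nth_E[OF ueq] unit_root_divisibility[OF ueq]
          W_detects_divisibility[OF ueq] in \<open>auto simp: hasse_coeff\<close>)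
qed

section \<open>Congruences in $R_H$\<close>

lemma to_fract_power: "to_fract (x ^ n) = to_fract x ^ n"
  by (induction n) simp_all

lemma to_fract_of_nat: "to_fract (of_nat n) = of_nat n"
  by (induction n) simp_all

lemma to_fract_of_int: "to_fract (of_int n) = of_int n"
  by (cases n) (simp_all add: to_fract_of_nat del: of_nat_Suc)

text \<open>Lower bounds instead of exact orders let a family of series be multiplied over one
  common range of summation.\<close>

lemma fls_times_nth_bounds:
  fixes f g :: "'a::comm_ring_1 fls"
  assumes "\<And>i. i < a \<Longrightarrow> fls_nth f i = 0" "\<And>i. i < b \<Longrightarrow> fls_nth g i = 0"
  shows "fls_nth (f * g) k = (\<Sum>i=a..k - b. fls_nth f i * fls_nth g (k - i))"
proof (cases "f = 0 \<or> g = 0")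
  case False
  hence "a \<le> fls_subdegree f" "b \<le> fls_subdegree g"
    using assms by (meson fls_subdegree_geI)+
  hence "(\<Sum>i=fls_subdegree f..k - fls_subdegree g. fls_nth f i * fls_nth g (k - i)) =
      (\<Sum>i=a..k - b. fls_nth f i * fls_nth g (k - i))"
    by (intro sum.mono_neutral_left) auto
  thus ?thesis by (simp add: fls_times_nth(2))
qed auto

definition fls_fract :: "'a::idom fls \<Rightarrow> 'a fract fls" where
  "fls_fract f = Abs_fls (\<lambda>i. to_fract (fls_nth f i))"

lemma fls_nth_fls_fract [simp]: "fls_nth (fls_fract f) i = to_fract (fls_nth f i)"
  unfolding fls_fract_def
  by (intro nth_Abs_fls_lower_bound[of "fls_subdegree f"]) simp

lemma fls_fract_mult: "fls_fract (f * g) = fls_fract f * fls_fract g"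
proof (intro fls_eqI)
  fix k
  have "fls_nth (f * g) k = (\<Sum>i=fls_subdegree f..k - fls_subdegree g. fls_nth f i * fls_nth g (k - i))"
    by (intro fls_times_nth_bounds) auto
  moreover have "fls_nth (fls_fract f * fls_fract g) k =
      (\<Sum>i=fls_subdegree f..k - fls_subdegree g. fls_nth (fls_fract f) i * fls_nth (fls_fract g) (k - i))"
    by (intro fls_times_nth_bounds) auto
  ultimately show "fls_nth (fls_fract (f * g)) k = fls_nth (fls_fract f * fls_fract g) k"
    by simp
qed

lemma fls_fract_1: "fls_fract 1 = 1"
  by (intro fls_eqI) simp

section \<open>The subring R_H and its ideals generated by powers of p\<close>

locale hasse_completion =
  fixes p :: nat
  assumes prime: "prime p" and gt_3: "p > 3"
begin

abbreviation H :: "R fract" where "H \<equiv> to_fract (hasse p)"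

text \<open>The carrier of R_H and its ideals p^n R_H (\<open>pB n\<close>) are handled inside the
  fraction field, where field arithmetic applies.\<close>

definition B :: "R fract set" where
  "B = {to_fract a / H ^ k | a k. True}"

definition pB :: "nat \<Rightarrow> R fract set" where
  "pB n = (\<lambda>b. of_nat p ^ n * b) ` B"

lemma H_neq_0: "H \<noteq> 0"
  using hasse_nonzero[OF prime gt_3] by simp

lemma p_fract_neq_0: "of_nat p \<noteq> (0 :: R fract)"
  using of_nat_R_neq_0[of p] gt_3 by (metis to_fract_of_nat to_fract_eq_0_iff less_nat_zero_code not_gr_zero)

lemma BE:
  assumes "x \<in> B"
  obtains a k where "x = to_fract a / H ^ k"
  using assms unfolding B_def by blast

lemma B_to_fract: "to_fract a \<in> B"
  unfolding B_def by (rule CollectI, rule exI[of _ a], rule exI[of _ 0]) simp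

lemma B_divide: "to_fract a / H ^ k \<in> B"
  unfolding B_def by blast

lemma B_0: "0 \<in> B" and B_1: "1 \<in> B" and B_of_nat: "of_nat n \<in> B" and B_of_int: "of_int i \<in> B"
  using B_to_fract[of 0] B_to_fract[of 1] B_to_fract[of "of_nat n"] B_to_fract[of "of_int i"]
  by (simp_all add: to_fract_of_nat to_fract_of_int)

lemma B_add: "x \<in> B \<Longrightarrow> y \<in> B \<Longrightarrow> x + y \<in> B"
proof (elim BE)
  fix a b k l assume xy: "x = to_fract a / H ^ k" "y = to_fract b / H ^ l"
  have "x + y = to_fract (a * hasse p ^ l + b * hasse p ^ k) / H ^ (k + l)"
    unfolding xy using H_neq_0 by (simp add: to_fract_power power_add add_frac_eq)
  thus ?thesis by (simp only: B_divide)
qed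

lemma B_mult: "x \<in> B \<Longrightarrow> y \<in> B \<Longrightarrow> x * y \<in> B"
proof (elim BE)
  fix a b k l assume "x = to_fract a / H ^ k" "y = to_fract b / H ^ l"
  hence "x * y = to_fract (a * b) / H ^ (k + l)"
    by (simp add: power_add)
  thus ?thesis by (simp only: B_divide)
qed

lemma B_uminus: "x \<in> B \<Longrightarrow> - x \<in> B"
  using B_mult[OF B_of_int[of "-1"]] by simp

lemma B_diff: "x \<in> B \<Longrightarrow> y \<in> B \<Longrightarrow> x - y \<in> B"
  using B_add[OF _ B_uminus] by simp

lemma B_power: "x \<in> B \<Longrightarrow> x ^ n \<in> B"
  by (induction n) (simp_all add: B_1 B_mult)

lemmas B_intros = B_0 B_1 B_of_nat B_of_int B_to_fract B_add B_mult B_uminus B_diff B_power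

lemma pBI: "b \<in> B \<Longrightarrow> of_nat p ^ n * b \<in> pB n"
  unfolding pB_def by blast

lemma pBE:
  assumes "x \<in> pB n"
  obtains b where "b \<in> B" "x = of_nat p ^ n * b"
  using assms unfolding pB_def by blast

lemma pB_iff: "x \<in> pB n \<longleftrightarrow> x / of_nat p ^ n \<in> B"
proof
  assume "x / of_nat p ^ n \<in> B"
  thus "x \<in> pB n" using pBI[of "x / of_nat p ^ n" n] p_fract_neq_0 by simp
qed (use p_fract_neq_0 in \<open>auto elim!: pBE\<close>)

lemma pB_0: "0 \<in> pB n"
  by (simp add: pB_iff B_0)

lemma pB_add: "x \<in> pB n \<Longrightarrow> y \<in> pB n \<Longrightarrow> x + y \<in> pB n"
  by (simp add: pB_iff add_divide_distrib B_add)

lemma pB_diff: "x \<in> pB n \<Longrightarrow> y \<in> pB n \<Longrightarrow> x - y \<in> pB n"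
  by (simp add: pB_iff diff_divide_distrib B_diff)

lemma pB_uminus: "x \<in> pB n \<Longrightarrow> - x \<in> pB n"
  using pB_diff[OF pB_0] by simp

lemma pB_mult: "x \<in> pB n \<Longrightarrow> y \<in> B \<Longrightarrow> x * y \<in> pB n"
  using B_mult by (simp add: pB_iff field_simps) (metis mult.commute times_divide_eq_left)

lemma pB_mult2: "y \<in> B \<Longrightarrow> x \<in> pB n \<Longrightarrow> y * x \<in> pB n"
  using pB_mult by (simp add: mult.commute)

lemma pB_sum: "(\<And>i. i \<in> A \<Longrightarrow> f i \<in> pB n) \<Longrightarrow> sum f A \<in> pB n"
  by (induction A rule: infinite_finite_induct) (simp_all add: pB_0 pB_add)

lemma pB_mono: "m \<le> n \<Longrightarrow> x \<in> pB n \<Longrightarrow> x \<in> pB m"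
proof (elim pBE)
  fix b assume "m \<le> n" "b \<in> B" "x = of_nat p ^ n * b"
  moreover from this have "x = of_nat p ^ m * (of_nat p ^ (n - m) * b)"
    by (simp add: mult.assoc[symmetric] power_add[symmetric])
  ultimately show ?thesis by (simp add: pBI B_intros)
qed

text \<open>Powers of H are units in R_H. Together with \<open>dvd_of_pB\<close> this exchanges
  congruences in R up to powers of H for congruences in R_H.\<close>

lemma pB_of_dvd:
  assumes "of_nat p ^ n dvd hasse p ^ m * r"
  shows "to_fract r \<in> pB n"
proof -
  from assms obtain c where "hasse p ^ m * r = of_nat p ^ n * c" by (elim dvdE)
  hence "H ^ m * to_fract r = of_nat p ^ n * to_fract c"
    by (metis to_fract_mult to_fract_power to_fract_of_nat)
  hence "to_fract r = of_nat p ^ n * (to_fract c / H ^ m)"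
    using H_neq_0 by (simp add: field_simps)
  thus ?thesis by (simp only: pBI B_divide)
qed

lemma dvd_of_pB:
  assumes "to_fract r \<in> pB n"
  shows "\<exists>m. of_nat p ^ n dvd hasse p ^ m * r"
proof -
  from assms obtain c m where "to_fract r = of_nat p ^ n * (to_fract c / H ^ m)"
    by (elim pBE BE) auto
  hence "H ^ m * to_fract r = of_nat p ^ n * to_fract c"
    using H_neq_0 by (simp add: field_simps)
  hence "to_fract (hasse p ^ m * r) = to_fract (of_nat p ^ n * c)"
    by (simp add: to_fract_power to_fract_of_nat)
  thus ?thesis by (metis to_fract_eq_iff dvd_triv_left)
qed

text \<open>v is the p-adic valuation of n, and the cofactor is inverted modulo powers of p by
  Bezout. Cancelling n loses v powers of p; approximate division by n is possible on p^v
  R_H.\<close>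

lemma pB_of_nat_mult_cancel:
  assumes "n > 0"
  obtains v where "\<And>N x. x \<in> B \<Longrightarrow> of_nat n * x \<in> pB (N + v) \<Longrightarrow> x \<in> pB N"
    and "\<And>k c. v \<le> k \<Longrightarrow> c \<in> pB v \<Longrightarrow> \<exists>q\<in>B. of_nat n * q - c \<in> pB k"
    and "p ^ v dvd n"
proof -
  obtain v n' where n: "n = p ^ v * n'" and bez: "\<And>k. \<exists>x y :: int. x * int n' + y * int p ^ k = 1"
    using prime_power_bezout prime assms by blast
  have bez': "\<exists>x y :: int. of_int x * of_nat n' + of_int y * of_nat p ^ k = (1 :: R fract)" for k
  proof -
    obtain x y where "x * int n' + y * int p ^ k = 1" using bez by blast
    hence "of_int (x * int n' + y * int p ^ k) = (1 :: R fract)" by simp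
    thus ?thesis by auto
  qed
  show thesis
  proof (rule that)
    fix N x assume x: "x \<in> B" "of_nat n * x \<in> pB (N + v)"
    from x(2) obtain b where b: "b \<in> B" "of_nat n * x = of_nat p ^ (N + v) * b" by (elim pBE)
    hence "of_nat p ^ v * (of_nat n' * x) = of_nat p ^ v * (of_nat p ^ N * b)"
      by (simp add: n power_add mult_ac)
    hence b': "of_nat n' * x = of_nat p ^ N * b" using p_fract_neq_0 by simp
    obtain s t :: int where st: "of_int s * of_nat n' + of_int t * of_nat p ^ N = (1 :: R fract)"
      using bez' by blast
    have "x = (of_int s * of_nat n' + of_int t * of_nat p ^ N) * x" unfolding st by simp
    also have "\<dots> = of_int s * (of_nat n' * x) + of_nat p ^ N * (of_int t * x)"
      by (simp add: algebra_simps)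
    also have "\<dots> \<in> pB N" unfolding b' by (intro pB_add pBI pB_mult2 B_intros x b)
    finally show "x \<in> pB N" .
  next
    fix k c assume "v \<le> k" "c \<in> pB v"
    from this(2) obtain b where b: "b \<in> B" "c = of_nat p ^ v * b" by (elim pBE)
    obtain s t :: int where st: "of_int s * of_nat n' + of_int t * of_nat p ^ k = (1 :: R fract)"
      using bez' by blast
    have "of_int s * of_nat n' = 1 - of_int t * (of_nat p ^ k :: R fract)"
      using st by (simp add: algebra_simps)
    hence "of_nat n * (of_int s * b) = of_nat p ^ v * (1 - of_int t * of_nat p ^ k) * b"
      by (simp add: n mult_ac)
    hence "of_nat n * (of_int s * b) - c = of_nat p ^ k * (- (of_int t * of_nat p ^ v * b))"
      unfolding b(2) by (simp add: algebra_simps)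
    hence "of_nat n * (of_int s * b) - c \<in> pB k"
      by (simp only:) (intro pBI B_intros b)
    thus "\<exists>q\<in>B. of_nat n * q - c \<in> pB k"
      by (rule bexI) (intro B_intros b)
  next
    show "p ^ v dvd n" unfolding n by simp
  qed
qed

text \<open>p^n = 2 m + 1 makes -m an inverse of 2 modulo p^n.\<close>

lemma pB_double_cancel:
  assumes "x \<in> B" "2 * x \<in> pB n"
  shows "x \<in> pB n"
proof -
  have "odd (p ^ n)" using prime gt_3 prime_odd_nat by auto
  then obtain m where m: "p ^ n = 2 * m + 1" by (elim oddE)
  have "of_nat p ^ n = (2 * of_nat m + 1 :: R fract)"
    using arg_cong[OF m, of "of_nat :: nat \<Rightarrow> R fract"] by simp
  hence "x = of_nat p ^ n * x - of_nat m * (2 * x)" by (simp add: algebra_simps)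
  also have "\<dots> \<in> pB n" by (intro pB_diff pBI pB_mult2 B_intros assms)
  finally show ?thesis .
qed

definition Wn :: "nat \<Rightarrow> R fract" where
  "Wn n = fls_nth (fls_fract W_exp) (int n)"

text \<open>Only exponents n \<ge> 0 are recorded, so the pole t^-2 is dropped.\<close>

definition En :: "nat \<Rightarrow> R fract" where
  "En n = fls_nth (fls_fract (x_exp * W_exp)) (int n)"

lemma Wn_B: "Wn n \<in> B" and En_B: "En n \<in> B"
  by (simp_all add: Wn_def En_def B_to_fract)

text \<open>Divisibility of n + 1 is tested because t^n dt integrates to t^(n+1) / (n + 1).
  \<open>ex_unit_root_approx\<close> holds with beta = v / H^m; \<open>pB_of_Wn\<close> gives
  uniqueness.\<close>

lemma Wn_odd: "odd n \<Longrightarrow> Wn n = 0"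
  and En_odd: "odd n \<Longrightarrow> En n = 0"
  and fls_fract_W: "fls_fract W_exp = fps_to_fls (Abs_fps Wn)"
  and fls_fract_xW: "fls_fract (x_exp * W_exp) = fls_X_inv ^ 2 + fps_to_fls (Abs_fps En)"
  and ex_unit_root_approx: "\<exists>\<beta>\<in>B. \<forall>n j. j \<le> k \<longrightarrow> p ^ j dvd Suc n \<longrightarrow> En n - \<beta> * Wn n \<in> pB j"
  and pB_of_Wn: "\<beta> \<in> B \<Longrightarrow> (\<And>n j. j \<le> k \<Longrightarrow> p ^ j dvd Suc n \<Longrightarrow> \<beta> * Wn n \<in> pB j) \<Longrightarrow> \<beta> \<in> pB k"
proof -
  obtain W E :: "R fps" where WE: "W_exp = fps_to_fls W" "x_exp * W_exp = fls_X_inv ^ 2 + fps_to_fls E"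
    and odd: "\<And>n. odd n \<Longrightarrow> fps_nth W n = 0" "\<And>n. odd n \<Longrightarrow> fps_nth E n = 0"
    and cong: "\<And>k. \<exists>m v. \<forall>n>0. \<forall>j\<le>k. p ^ j dvd n \<longrightarrow>
       of_nat p ^ j dvd hasse p ^ m * fps_nth E (n - 1) - v * fps_nth W (n - 1)"
    and unit: "\<And>k v. (\<And>n j. 0 < n \<Longrightarrow> n \<le> p ^ k \<Longrightarrow> j \<le> k \<Longrightarrow> p ^ j dvd n \<Longrightarrow>
         of_nat p ^ j dvd v * fps_nth W (n - 1)) \<Longrightarrow>
       \<exists>e. of_nat p ^ k dvd v * hasse p ^ e"
    using expansion_congruences[OF prime gt_3] by blast
  have X: "fls_nth ((fls_X_inv :: 'b::comm_ring_1 fls) ^ 2) i = (if i = -2 then 1 else 0)" for i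
    by (simp add: power2_eq_square fls_X_inv_times_conv_shift)
  have Wn: "Wn n = to_fract (fps_nth W n)" and En: "En n = to_fract (fps_nth E n)" for n
    unfolding Wn_def En_def WE(2) by (simp_all add: WE(1) X)
  show "odd n \<Longrightarrow> Wn n = 0" "odd n \<Longrightarrow> En n = 0" by (simp_all add: Wn En odd)
  show "fls_fract W_exp = fps_to_fls (Abs_fps Wn)"
    by (intro fls_eqI) (simp add: WE Wn)
  show "fls_fract (x_exp * W_exp) = fls_X_inv ^ 2 + fps_to_fls (Abs_fps En)"
    unfolding WE(2) by (intro fls_eqI) (simp add: En X)
  obtain m v where mv: "\<And>n j. n > 0 \<Longrightarrow> j \<le> k \<Longrightarrow> p ^ j dvd n \<Longrightarrow>
       of_nat p ^ j dvd hasse p ^ m * fps_nth E (n - 1) - v * fps_nth W (n - 1)"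
    using cong[of k] by blast
  have "En n - to_fract v / H ^ m * Wn n \<in> pB j" if j: "j \<le> k" "p ^ j dvd Suc n" for n j
  proof -
    have "to_fract (hasse p ^ m * fps_nth E n - v * fps_nth W n) \<in> pB j"
      using mv[of "Suc n", OF _ j] by (intro pB_of_dvd[where m = 0]) simp
    from pB_mult[OF this B_divide[of 1 m]] show ?thesis
      using H_neq_0 by (simp add: Wn En to_fract_power field_simps)
  qed
  thus "\<exists>\<beta>\<in>B. \<forall>n j. j \<le> k \<longrightarrow> p ^ j dvd Suc n \<longrightarrow> En n - \<beta> * Wn n \<in> pB j"
    using B_divide by blast
  show "\<beta> \<in> pB k" if \<beta>: "\<beta> \<in> B" and W: "\<And>n j. j \<le> k \<Longrightarrow> p ^ j dvd Suc n \<Longrightarrow> \<beta> * Wn n \<in> pB j"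
  proof -
    obtain v i where v: "\<beta> = to_fract v / H ^ i" using \<beta> by (elim BE)
    have "\<exists>m. of_nat p ^ j dvd hasse p ^ m * (v * fps_nth W (n - 1))"
      if "n > 0" "j \<le> k" "p ^ j dvd n" for n j
    proof (rule dvd_of_pB)
      have "to_fract (v * fps_nth W (n - 1)) = to_fract (hasse p ^ i) * (\<beta> * Wn (n - 1))"
        using H_neq_0 by (simp add: v Wn to_fract_power)
      also have "\<dots> \<in> pB j" using W[of j "n - 1"] that by (intro pB_mult2[OF B_to_fract]) simp
      finally show "to_fract (v * fps_nth W (n - 1)) \<in> pB j" .
    qed
    then obtain m where m: "\<And>n j. n > 0 \<Longrightarrow> j \<le> k \<Longrightarrow> p ^ j dvd n \<Longrightarrow>
        of_nat p ^ j dvd hasse p ^ m n j * (v * fps_nth W (n - 1))"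
      by metis
    \<comment> \<open>The exponent \<open>m n j\<close> varies, but only n \<le> p^k has to be
      tested, so one power H^M serves all cases.\<close>
    define M where "M = Max ((\<lambda>(n, j). m n j) ` ({0..p ^ k} \<times> {0..k}))"
    have "of_nat p ^ j dvd (hasse p ^ M * v) * fps_nth W (n - 1)"
      if n: "0 < n" "n \<le> p ^ k" "j \<le> k" "p ^ j dvd n" for n j
    proof -
      have "m n j \<le> M" unfolding M_def using n by (intro Max_ge) auto
      hence "hasse p ^ m n j dvd hasse p ^ M" by (rule le_imp_power_dvd)
      hence "hasse p ^ m n j * (v * fps_nth W (n - 1)) dvd hasse p ^ M * (v * fps_nth W (n - 1))"
        by (intro mult_dvd_mono dvd_refl)
      from dvd_trans[OF m[OF n(1,3,4)] this] show ?thesis by (simp add: mult.assoc)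
    qed
    from unit[OF this] obtain e where "of_nat p ^ k dvd hasse p ^ M * v * hasse p ^ e" by blast
    hence "of_nat p ^ k dvd hasse p ^ (M + e) * v" by (simp add: power_add mult_ac)
    hence "to_fract v \<in> pB k" by (rule pB_of_dvd)
    from pB_mult[OF this B_divide[of 1 i]] show ?thesis by (simp add: v)
  qed
qed

end

section \<open>The completion\<close>

context hasse_completion
begin

section \<open>Cosets of R_H modulo p^n\<close>

lemma R_H_simps:
  "carrier (R_H p) = B" "x \<otimes>\<^bsub>R_H p\<^esub> y = x * y" "x \<oplus>\<^bsub>R_H p\<^esub> y = x + y"
  "\<one>\<^bsub>R_H p\<^esub> = 1" "\<zero>\<^bsub>R_H p\<^esub> = 0"
  by (simp_all add: R_H_def B_def)

lemma R_H_cring: "cring (R_H p)"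
proof (intro cringI abelian_groupI comm_monoidI, unfold R_H_simps)
  show "\<exists>y\<in>B. y + x = 0" if "x \<in> B" for x
    using that B_uminus by (intro bexI[of _ "- x"]) auto
qed (auto simp: algebra_simps intro!: B_intros)

lemma R_H_pow: "x [^]\<^bsub>R_H p\<^esub> (n::nat) = x ^ n"
  by (induction n) (simp_all add: R_H_simps mult.commute)

abbreviation I :: "nat \<Rightarrow> R fract set" where
  "I n \<equiv> PIdl\<^bsub>R_H p\<^esub> (of_nat p [^]\<^bsub>R_H p\<^esub> n)"

lemma I_eq: "I n = pB n"
  by (auto simp: cgenideal_def R_H_simps R_H_pow pB_def mult.commute)

lemma I_ideal: "ideal (I n) (R_H p)"
  by (rule cring.cgenideal_ideal[OF R_H_cring]) (simp add: R_H_simps R_H_pow B_intros)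

definition level_class :: "nat \<Rightarrow> R fract \<Rightarrow> R fract set" where
  "level_class n x = I n +>\<^bsub>R_H p\<^esub> x"

lemma level_class_eq: "level_class n x = (\<lambda>y. y + x) ` pB n"
  by (auto simp: level_class_def a_r_coset_def' R_H_simps I_eq)

lemma level_class_eq_iff: "level_class n x = level_class n y \<longleftrightarrow> x - y \<in> pB n"
proof
  assume "level_class n x = level_class n y"
  moreover have "x \<in> level_class n x" unfolding level_class_eq using pB_0 by force
  ultimately have "x \<in> level_class n y" by simp
  thus "x - y \<in> pB n" unfolding level_class_eq by auto
next
  assume *: "x - y \<in> pB n"
  show "level_class n x = level_class n y"
  proof (intro equalityI subsetI)
    fix u assume "u \<in> level_class n x"
    then obtain w where "w \<in> pB n" "u = w + x" unfolding level_class_eq by auto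
    hence "u = (w + (x - y)) + y" "w + (x - y) \<in> pB n" using * pB_add by auto
    thus "u \<in> level_class n y" unfolding level_class_eq by blast
  next
    fix u assume "u \<in> level_class n y"
    then obtain w where "w \<in> pB n" "u = w + y" unfolding level_class_eq by auto
    hence "u = (w - (x - y)) + x" "w - (x - y) \<in> pB n" using * pB_diff by auto
    thus "u \<in> level_class n x" unfolding level_class_eq by blast
  qed
qed

lemma set_add_level_class_Suc: "I n <+>\<^bsub>R_H p\<^esub> level_class (Suc n) x = level_class n x"
proof (intro equalityI subsetI)
  fix u assume "u \<in> I n <+>\<^bsub>R_H p\<^esub> level_class (Suc n) x"
  then obtain v w where "v \<in> pB n" "w \<in> pB (Suc n)" "u = (v + w) + x"
    by (auto simp: set_add_def' R_H_simps I_eq level_class_eq add.assoc)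
  moreover from this have "v + w \<in> pB n" by (intro pB_add) (auto intro: pB_mono[of n "Suc n"])
  ultimately show "u \<in> level_class n x" unfolding level_class_eq by blast
next
  fix u assume "u \<in> level_class n x"
  then obtain w where "w \<in> pB n" "u = w + (0 + x)" unfolding level_class_eq by auto
  moreover have "0 \<in> pB (Suc n)" by (rule pB_0)
  ultimately show "u \<in> I n <+>\<^bsub>R_H p\<^esub> level_class (Suc n) x"
    unfolding set_add_def' R_H_simps I_eq level_class_eq by blast
qed

section \<open>Elements of the completion as coherent sequences\<close>

definition coherent :: "(nat \<Rightarrow> R fract) \<Rightarrow> bool" where
  "coherent r \<longleftrightarrow> (\<forall>n. r n \<in> B) \<and> (\<forall>n. r (Suc n) - r n \<in> pB n)"

text \<open>An element of the limit is given by representatives in R_H, the n-th one mattering only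
  modulo p^n.\<close>

definition hat_of :: "(nat \<Rightarrow> R fract) \<Rightarrow> nat \<Rightarrow> R fract set" where
  "hat_of r = (\<lambda>n. level_class n (r n))"

lemma coherentD: "coherent r \<Longrightarrow> r n \<in> B"
  by (simp add: coherent_def)

lemma coherent_diff_pB:
  assumes "coherent r" "m \<le> n"
  shows "r n - r m \<in> pB m"
  using assms(2)
proof (induction rule: dec_induct)
  case (step n)
  have "r (Suc n) - r n \<in> pB m"
    using assms(1) step(1) pB_mono unfolding coherent_def by blast
  from pB_add[OF this step.IH] show ?case by simp
qed (simp add: pB_0)

lemma coherent_const: "x \<in> B \<Longrightarrow> coherent (\<lambda>_. x)"
  by (simp add: coherent_def pB_0)

lemma coherent_add: "coherent r \<Longrightarrow> coherent s \<Longrightarrow> coherent (\<lambda>n. r n + s n)"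
  unfolding coherent_def by (auto intro: B_add simp: add_diff_add intro!: pB_add)

lemma coherent_mult:
  assumes "coherent r" "coherent s"
  shows "coherent (\<lambda>n. r n * s n)"
proof -
  have "r (Suc n) * s (Suc n) - r n * s n = (r (Suc n) - r n) * s (Suc n) + r n * (s (Suc n) - s n)" for n
    by (simp add: algebra_simps)
  moreover have "(r (Suc n) - r n) * s (Suc n) + r n * (s (Suc n) - s n) \<in> pB n" for n
    using assms unfolding coherent_def by (intro pB_add pB_mult[OF _ coherentD[OF assms(2)]]
        pB_mult2[OF coherentD[OF assms(1)]]) blast+
  ultimately show ?thesis using assms by (simp add: coherent_def B_mult)
qed

lemma coherent_uminus: "coherent r \<Longrightarrow> coherent (\<lambda>n. - r n)"
  using coherent_mult[OF coherent_const[OF B_uminus[OF B_1]]] by simp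

lemma coherent_sum:
  "(\<And>i. i \<in> A \<Longrightarrow> coherent (r i)) \<Longrightarrow> coherent (\<lambda>n. \<Sum>i\<in>A. r i n)"
  by (induction A rule: infinite_finite_induct) (simp_all add: coherent_const B_0 coherent_add)

lemma hat_of_eq_iff: "hat_of r = hat_of s \<longleftrightarrow> (\<forall>n. r n - s n \<in> pB n)"
  by (simp add: hat_of_def fun_eq_iff level_class_eq_iff)

text \<open>Representatives are chosen level by level; compatibility with the transition maps is
  then precisely coherence.\<close>

lemma R_hat_carrier: "s \<in> carrier (R_hat p) \<longleftrightarrow> (\<exists>r. coherent r \<and> s = hat_of r)"
proof -
  have car: "s \<in> carrier (R_hat p) \<longleftrightarrow>
      (\<forall>n. s n \<in> level_class n ` B) \<and> (\<forall>n. s n = I n <+>\<^bsub>R_H p\<^esub> s (Suc n))"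
  proof -
    have "carrier (R_H p Quot I n) = level_class n ` B" for n
      by (auto simp: FactRing_def A_RCOSETS_def' R_H_simps level_class_def)
    thus ?thesis by (simp add: R_hat_def adic_completion_def Let_def)
  qed
  show ?thesis
  proof
    assume s: "s \<in> carrier (R_hat p)"
    hence "\<forall>n. \<exists>x. x \<in> B \<and> s n = level_class n x" unfolding car by blast
    then obtain r where r: "\<And>n. r n \<in> B" "\<And>n. s n = level_class n (r n)"
      using choice[of "\<lambda>n x. x \<in> B \<and> s n = level_class n x"] by blast
    have "s n = I n <+>\<^bsub>R_H p\<^esub> s (Suc n)" for n using s unfolding car by blast
    hence "level_class n (r (Suc n)) = level_class n (r n)" for n
      unfolding r(2) set_add_level_class_Suc by (rule sym)
    hence "coherent r" using r(1) by (simp add: coherent_def level_class_eq_iff)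
    thus "\<exists>r. coherent r \<and> s = hat_of r" using r(2) by (auto simp: hat_of_def)
  next
    assume "\<exists>r. coherent r \<and> s = hat_of r"
    then obtain r where r: "coherent r" "s = hat_of r" by blast
    have "level_class n (r (Suc n)) = level_class n (r n)" for n
      using r(1) by (simp add: level_class_eq_iff coherent_def)
    thus "s \<in> carrier (R_hat p)"
      unfolding car using r by (auto simp: hat_of_def set_add_level_class_Suc coherentD)
  qed
qed

lemma hat_of_carrier: "coherent r \<Longrightarrow> hat_of r \<in> carrier (R_hat p)"
  by (auto simp: R_hat_carrier)

lemma R_hat_add: "coherent r \<Longrightarrow> coherent s \<Longrightarrow> hat_of r \<oplus>\<^bsub>R_hat p\<^esub> hat_of s = hat_of (\<lambda>n. r n + s n)"
  using ideal.a_rcos_sum[OF I_ideal]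
  by (auto simp: R_hat_def adic_completion_def Let_def FactRing_def hat_of_def level_class_def R_H_simps coherentD
      fun_eq_iff)

lemma R_hat_mult: "coherent r \<Longrightarrow> coherent s \<Longrightarrow> hat_of r \<otimes>\<^bsub>R_hat p\<^esub> hat_of s = hat_of (\<lambda>n. r n * s n)"
  using ideal.rcoset_mult_add[OF I_ideal]
  by (auto simp: R_hat_def adic_completion_def Let_def FactRing_def hat_of_def level_class_def R_H_simps coherentD
      fun_eq_iff)

lemma R_hat_one: "\<one>\<^bsub>R_hat p\<^esub> = hat_of (\<lambda>_. 1)"
  by (simp add: R_hat_def adic_completion_def Let_def FactRing_def hat_of_def level_class_def R_H_simps)

lemma R_hat_zero: "\<zero>\<^bsub>R_hat p\<^esub> = hat_of (\<lambda>_. 0)"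
proof -
  have "level_class n 0 = I n" for n by (simp add: level_class_eq I_eq)
  thus ?thesis
    by (simp add: R_hat_def adic_completion_def Let_def FactRing_def hat_of_def)
qed

lemma to_R_hat_eq: "to_R_hat p a = hat_of (\<lambda>_. to_fract a)"
  by (simp add: to_R_hat_def hat_of_def level_class_def)

lemma R_hat_abelian_group: "abelian_group (R_hat p)"
proof (rule abelian_groupI)
  show "\<exists>y\<in>carrier (R_hat p). y \<oplus>\<^bsub>R_hat p\<^esub> x = \<zero>\<^bsub>R_hat p\<^esub>" if "x \<in> carrier (R_hat p)" for x
  proof -
    from that obtain r where r: "coherent r" "x = hat_of r" by (auto simp: R_hat_carrier)
    hence "hat_of (\<lambda>n. - r n) \<oplus>\<^bsub>R_hat p\<^esub> x = \<zero>\<^bsub>R_hat p\<^esub>"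
      by (simp add: R_hat_add coherent_uminus R_hat_zero)
    thus ?thesis using hat_of_carrier coherent_uminus r by blast
  qed
next
  fix x y assume "x \<in> carrier (R_hat p)" "y \<in> carrier (R_hat p)"
  then obtain r s where rs: "coherent r" "x = hat_of r" "coherent s" "y = hat_of s"
    by (auto simp: R_hat_carrier)
  thus "x \<oplus>\<^bsub>R_hat p\<^esub> y \<in> carrier (R_hat p)"
    by (simp add: R_hat_add coherent_add hat_of_carrier)
  from rs show "x \<oplus>\<^bsub>R_hat p\<^esub> y = y \<oplus>\<^bsub>R_hat p\<^esub> x"
    by (simp add: R_hat_add add.commute)
  fix z assume "z \<in> carrier (R_hat p)"
  then obtain u where "coherent u" "z = hat_of u"
    by (auto simp: R_hat_carrier)
  with rs show "x \<oplus>\<^bsub>R_hat p\<^esub> y \<oplus>\<^bsub>R_hat p\<^esub> z = x \<oplus>\<^bsub>R_hat p\<^esub> (y \<oplus>\<^bsub>R_hat p\<^esub> z)"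
    by (simp add: R_hat_add coherent_add add.assoc)
next
  show "\<zero>\<^bsub>R_hat p\<^esub> \<oplus>\<^bsub>R_hat p\<^esub> x = x" if "x \<in> carrier (R_hat p)" for x
    using that by (auto simp: R_hat_carrier R_hat_zero R_hat_add coherent_const B_0)
  show "\<zero>\<^bsub>R_hat p\<^esub> \<in> carrier (R_hat p)"
    by (simp add: R_hat_zero hat_of_carrier coherent_const B_0)
qed

interpretation Rh: abelian_group "R_hat p" by (rule R_hat_abelian_group)

lemma R_hat_uminus: "coherent r \<Longrightarrow> \<ominus>\<^bsub>R_hat p\<^esub> hat_of r = hat_of (\<lambda>n. - r n)"
  by (intro Rh.minus_equality) (simp_all add: hat_of_carrier coherent_uminus R_hat_add R_hat_zero)

lemma R_hat_add_pow:
  assumes "coherent r"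
  shows "add_pow (R_hat p) (k :: int) (hat_of r) = hat_of (\<lambda>n. of_int k * r n)"
proof -
  have nat: "add_pow (R_hat p) m (hat_of r) = hat_of (\<lambda>n. of_nat m * r n)" for m :: nat
  proof (induction m)
    case (Suc m)
    have "coherent (\<lambda>n. of_nat m * r n)"
      by (intro coherent_mult coherent_const B_of_nat assms)
    moreover have "add_pow (R_hat p) (Suc m) (hat_of r) = add_pow (R_hat p) m (hat_of r) \<oplus>\<^bsub>R_hat p\<^esub> hat_of r"
      by (simp add: add_pow_def)
    ultimately have "add_pow (R_hat p) (Suc m) (hat_of r) = hat_of (\<lambda>n. of_nat m * r n + r n)"
      using assms by (simp add: Suc R_hat_add)
    thus ?case by (simp add: algebra_simps)
  qed (simp add: add_pow_def R_hat_zero)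
  have coh: "coherent (\<lambda>n. of_nat m * r n)" for m
    by (intro coherent_mult coherent_const B_of_nat assms)
  show ?thesis
  proof (cases "k < 0")
    case True
    hence "add_pow (R_hat p) k (hat_of r) = \<ominus>\<^bsub>R_hat p\<^esub> (add_pow (R_hat p) (nat (- k)) (hat_of r))"
      unfolding add_pow_def int_pow_def2 a_inv_def by simp
    thus ?thesis unfolding nat R_hat_uminus[OF coh] using True by simp
  next
    case False
    hence "add_pow (R_hat p) k (hat_of r) = add_pow (R_hat p) (nat k) (hat_of r)"
      unfolding add_pow_def int_pow_def2 by simp
    thus ?thesis unfolding nat using False by simp
  qed
qed

lemma R_hat_finsum:
  assumes "finite A" "\<And>i. i \<in> A \<Longrightarrow> coherent (r i)"
  shows "(\<Oplus>\<^bsub>R_hat p\<^esub>i\<in>A. hat_of (r i)) = hat_of (\<lambda>n. \<Sum>i\<in>A. r i n)"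
  using assms
proof (induction rule: finite_induct)
  case empty
  show ?case by (simp add: R_hat_zero)
next
  case (insert j A)
  have "(\<Oplus>\<^bsub>R_hat p\<^esub>i\<in>insert j A. hat_of (r i)) = hat_of (r j) \<oplus>\<^bsub>R_hat p\<^esub> (\<Oplus>\<^bsub>R_hat p\<^esub>i\<in>A. hat_of (r i))"
    using insert by (intro Rh.finsum_insert) (auto intro: hat_of_carrier)
  thus ?case using insert by (simp add: R_hat_add coherent_sum)
qed

text \<open>A Laurent series over $\hat R$ is handled through a family of Laurent series over the fraction
  field, one for each level $n$ of the inverse limit.\<close>

definition laurent_of :: "(nat \<Rightarrow> R fract fls) \<Rightarrow> int \<Rightarrow> nat \<Rightarrow> R fract set" where
  "laurent_of F = (\<lambda>i. hat_of (\<lambda>n. fls_nth (F n) i))"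

text \<open>The pole bound a is common to all levels, so that the family gives one Laurent series
  over the completion.\<close>

definition lcoherent :: "int \<Rightarrow> (nat \<Rightarrow> R fract fls) \<Rightarrow> bool" where
  "lcoherent a F \<longleftrightarrow> (\<forall>i. coherent (\<lambda>n. fls_nth (F n) i)) \<and> (\<forall>n. \<forall>i<a. fls_nth (F n) i = 0)"

lemma lcoherentD: "lcoherent a F \<Longrightarrow> coherent (\<lambda>n. fls_nth (F n) i)"
  by (simp add: lcoherent_def)

section \<open>Operations on Laurent series over the completion\<close>

lemma laurent_of_eq_iff: "laurent_of F = laurent_of G \<longleftrightarrow> (\<forall>n i. fls_nth (F n - G n) i \<in> pB n)"
  by (auto simp: laurent_of_def fun_eq_iff[of "\<lambda>i. hat_of (_ i)"] hat_of_eq_iff)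

lemma laurent_of_add:
  assumes "lcoherent a F" "lcoherent b G"
  shows "laurent_of F \<oplus>\<^bsub>laurent_ring (R_hat p)\<^esub> laurent_of G = laurent_of (\<lambda>n. F n + G n)"
  using assms by (simp add: laurent_ring_def laurent_of_def R_hat_add lcoherent_def)

text \<open>The ring sums only over indices where both coefficients are nonzero in the completion.
  The other terms of the product at level n need not vanish in the fraction field, but they lie in
  p^n R_H.\<close>

lemma laurent_of_mult:
  assumes "lcoherent a F" "lcoherent b G"
  shows "laurent_of F \<otimes>\<^bsub>laurent_ring (R_hat p)\<^esub> laurent_of G = laurent_of (\<lambda>n. F n * G n)"
proof
  fix k
  define A where "A = {i. laurent_of F i \<noteq> \<zero>\<^bsub>R_hat p\<^esub> \<and> laurent_of G (k - i) \<noteq> \<zero>\<^bsub>R_hat p\<^esub>}"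
  have F0: "laurent_of F i = \<zero>\<^bsub>R_hat p\<^esub>" if "i < a" for i
    using assms(1) that by (simp add: laurent_of_def R_hat_zero lcoherent_def)
  have G0: "laurent_of G i = \<zero>\<^bsub>R_hat p\<^esub>" if "i < b" for i
    using assms(2) that by (simp add: laurent_of_def R_hat_zero lcoherent_def)
  have A: "A \<subseteq> {a..k - b}"
  proof
    fix i assume i: "i \<in> A"
    hence "\<not> i < a" "\<not> k - i < b" using F0 G0 unfolding A_def by blast+
    thus "i \<in> {a..k - b}" by simp
  qed
  have coh: "coherent (\<lambda>n. fls_nth (F n) i * fls_nth (G n) (k - i))" for i
    using assms by (intro coherent_mult) (auto dest: lcoherentD)
  have "(laurent_of F \<otimes>\<^bsub>laurent_ring (R_hat p)\<^esub> laurent_of G) k =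
      (\<Oplus>\<^bsub>R_hat p\<^esub>i\<in>A. laurent_of F i \<otimes>\<^bsub>R_hat p\<^esub> laurent_of G (k - i))"
    by (simp add: laurent_ring_def A_def)
  also have "\<dots> = (\<Oplus>\<^bsub>R_hat p\<^esub>i\<in>A. hat_of (\<lambda>n. fls_nth (F n) i * fls_nth (G n) (k - i)))"
    using assms by (simp add: laurent_of_def R_hat_mult lcoherentD)
  also have "\<dots> = hat_of (\<lambda>n. \<Sum>i\<in>A. fls_nth (F n) i * fls_nth (G n) (k - i))"
    using A coh by (intro R_hat_finsum) (auto intro: finite_subset)
  also have "\<dots> = hat_of (\<lambda>n. fls_nth (F n * G n) k)"
    unfolding hat_of_eq_iff
  proof
    fix n
    have "fls_nth (F n * G n) k = (\<Sum>i=a..k - b. fls_nth (F n) i * fls_nth (G n) (k - i))"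
      using assms by (intro fls_times_nth_bounds) (auto simp: lcoherent_def)
    also have "\<dots> = (\<Sum>i\<in>{a..k - b} - A. fls_nth (F n) i * fls_nth (G n) (k - i)) +
        (\<Sum>i\<in>A. fls_nth (F n) i * fls_nth (G n) (k - i))"
      using A by (intro sum.subset_diff) auto
    finally have "(\<Sum>i\<in>A. fls_nth (F n) i * fls_nth (G n) (k - i)) - fls_nth (F n * G n) k =
        - (\<Sum>i\<in>{a..k - b} - A. fls_nth (F n) i * fls_nth (G n) (k - i))"
      by simp
    also have "\<dots> \<in> pB n"
    proof (intro pB_uminus pB_sum)
      fix i assume "i \<in> {a..k - b} - A"
      hence "laurent_of F i = \<zero>\<^bsub>R_hat p\<^esub> \<or> laurent_of G (k - i) = \<zero>\<^bsub>R_hat p\<^esub>" by (auto simp: A_def)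
      hence "fls_nth (F n) i \<in> pB n \<or> fls_nth (G n) (k - i) \<in> pB n"
        by (auto simp: laurent_of_def R_hat_zero hat_of_eq_iff)
      moreover have "fls_nth (F n) i \<in> B" "fls_nth (G n) (k - i) \<in> B"
        using lcoherentD[OF assms(1), THEN coherentD] lcoherentD[OF assms(2), THEN coherentD] by blast+
      ultimately show "fls_nth (F n) i * fls_nth (G n) (k - i) \<in> pB n"
        by (auto intro: pB_mult pB_mult2)
    qed
    finally show "(\<Sum>i\<in>A. fls_nth (F n) i * fls_nth (G n) (k - i)) - fls_nth (F n * G n) k \<in> pB n" .
  qed
  finally show "(laurent_of F \<otimes>\<^bsub>laurent_ring (R_hat p)\<^esub> laurent_of G) k = laurent_of (\<lambda>n. F n * G n) k"
    by (simp add: laurent_of_def)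
qed

lemma laurent_of_deriv:
  assumes "lcoherent a F"
  shows "laurent_deriv (R_hat p) (laurent_of F) = laurent_of (\<lambda>n. fls_deriv (F n))"
  using assms by (simp add: laurent_deriv_def laurent_of_def R_hat_add_pow lcoherentD)

lemma lcoherent_deriv:
  assumes "lcoherent a F"
  shows "lcoherent (a - 1) (\<lambda>n. fls_deriv (F n))"
  using assms unfolding lcoherent_def
  by (auto intro!: coherent_mult coherent_const B_of_int simp del: of_int_add)

lemma expand_R_hat_eq: "expand_R_hat p f = laurent_of (\<lambda>_. fls_fract f)"
  by (simp add: expand_R_hat_def laurent_of_def to_R_hat_eq)

lemma lcoherent_fls_fract: "lcoherent (fls_subdegree f) (\<lambda>_. fls_fract f)"
  by (simp add: lcoherent_def coherent_const B_to_fract)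

section \<open>Existence and uniqueness of the zeta series\<close>

lemma laurent_of_carrier: "lcoherent a F \<Longrightarrow> laurent_of F \<in> carrier (laurent_ring (R_hat p))"
  by (auto simp: laurent_ring_def laurent_of_def lcoherent_def hat_of_carrier R_hat_zero intro!: exI[of _ a])

lemma laurent_of_uminus:
  assumes "lcoherent a F"
  shows "\<ominus>\<^bsub>laurent_ring (R_hat p)\<^esub> laurent_of F = laurent_of (\<lambda>n. - F n)"
proof -
  let ?L = "laurent_ring (R_hat p)"
  have m: "lcoherent a (\<lambda>n. - F n)"
    using assms by (simp add: lcoherent_def coherent_uminus)
  have zero: "\<zero>\<^bsub>?L\<^esub> = laurent_of (\<lambda>_. 0)"
    by (simp add: laurent_ring_def laurent_of_def R_hat_zero)
  show ?thesis
    unfolding a_inv_def m_inv_def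
  proof (rule the_equality)
    show "laurent_of (\<lambda>n. - F n) \<in> carrier (add_monoid ?L) \<and>
        laurent_of F \<otimes>\<^bsub>add_monoid ?L\<^esub> laurent_of (\<lambda>n. - F n) = \<one>\<^bsub>add_monoid ?L\<^esub> \<and>
        laurent_of (\<lambda>n. - F n) \<otimes>\<^bsub>add_monoid ?L\<^esub> laurent_of F = \<one>\<^bsub>add_monoid ?L\<^esub>"
      using laurent_of_add[OF assms m] laurent_of_add[OF m assms] laurent_of_carrier[OF m] by (simp add: zero)
  next
    fix y assume y: "y \<in> carrier (add_monoid ?L) \<and> laurent_of F \<otimes>\<^bsub>add_monoid ?L\<^esub> y = \<one>\<^bsub>add_monoid ?L\<^esub> \<and>
        y \<otimes>\<^bsub>add_monoid ?L\<^esub> laurent_of F = \<one>\<^bsub>add_monoid ?L\<^esub>"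
    show "y = laurent_of (\<lambda>n. - F n)"
    proof
      fix i
      have "y \<in> carrier ?L" and sum: "y \<oplus>\<^bsub>?L\<^esub> laurent_of F = \<zero>\<^bsub>?L\<^esub>" using y by simp_all
      hence "y i \<in> carrier (R_hat p)" by (simp add: laurent_ring_def)
      moreover have "y i \<oplus>\<^bsub>R_hat p\<^esub> laurent_of F i = \<zero>\<^bsub>R_hat p\<^esub>"
        using fun_cong[OF sum, of i] by (simp add: laurent_ring_def)
      ultimately have "\<ominus>\<^bsub>R_hat p\<^esub> laurent_of F i = y i"
        using lcoherentD[OF assms] by (intro Rh.minus_equality) (simp_all add: laurent_of_def hat_of_carrier)
      thus "y i = laurent_of (\<lambda>n. - F n) i"
        using lcoherentD[OF assms] by (simp add: laurent_of_def R_hat_uminus)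
    qed
  qed
qed

text \<open>An even coefficient c must satisfy c = -c, so 2 c = 0, and 2 is invertible modulo
  p^n.\<close>

lemma laurent_odd_laurent_of_iff:
  assumes "lcoherent a F"
  shows "laurent_odd (R_hat p) (laurent_of F) \<longleftrightarrow> (\<forall>i n. even i \<longrightarrow> fls_nth (F n) i \<in> pB n)"
proof -
  note coh = lcoherentD[OF assms]
  have "laurent_odd (R_hat p) (laurent_of F) \<longleftrightarrow> (\<forall>i. even i \<longrightarrow> laurent_of F i = laurent_of (\<lambda>n. - F n) i)"
  proof -
    have "laurent_reflect (R_hat p) (laurent_of F) i = (if even i then laurent_of F i else laurent_of (\<lambda>n. - F n) i)" for i
      using coh by (simp add: laurent_reflect_def laurent_of_def R_hat_uminus)
    thus ?thesis
      unfolding laurent_odd_def laurent_of_uminus[OF assms] fun_eq_iff[of _ "laurent_of _"] by simp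
  qed
  also have "\<dots> \<longleftrightarrow> (\<forall>i n. even i \<longrightarrow> 2 * fls_nth (F n) i \<in> pB n)"
    unfolding laurent_of_def hat_of_eq_iff mult_2 by simp
  also have "\<dots> \<longleftrightarrow> (\<forall>i n. even i \<longrightarrow> fls_nth (F n) i \<in> pB n)"
  proof -
    have "2 * fls_nth (F n) i \<in> pB n \<longleftrightarrow> fls_nth (F n) i \<in> pB n" for i n
      using pB_double_cancel[OF coherentD[OF coh[of i]], of n n] pB_mult2[OF B_of_nat[of 2], of "fls_nth (F n) i" n]
      by auto
    thus ?thesis by simp
  qed
  finally show ?thesis .
qed

section \<open>The differential equation for zeta\<close>

definition zeta_series :: "(nat \<Rightarrow> nat \<Rightarrow> R fract) \<Rightarrow> nat \<Rightarrow> R fract fls" where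
  "zeta_series \<gamma> n = fls_X_inv + fps_to_fls (Abs_fps (\<lambda>i. \<gamma> i n))"

lemma lcoherent_fps:
  assumes "\<And>i. coherent (\<gamma> i)"
  shows "lcoherent 0 (\<lambda>n. fps_to_fls (Abs_fps (\<lambda>i. \<gamma> i n)))"
proof -
  have "coherent (\<lambda>n. fls_nth (fps_to_fls (Abs_fps (\<lambda>i. \<gamma> i n))) i)" for i
    using assms by (cases "i < 0") (simp_all add: coherent_const B_0)
  thus ?thesis by (simp add: lcoherent_def)
qed

lemma lcoherent_X_inv: "lcoherent (-1) (\<lambda>_. fls_X_inv)"
  by (auto simp: lcoherent_def coherent_const B_0 B_1)

lemma lcoherent_zeta:
  assumes "\<And>i. coherent (\<gamma> i)"
  shows "lcoherent (-1) (zeta_series \<gamma>)"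
proof -
  have "coherent (\<lambda>n. fls_nth fls_X_inv i + fls_nth (fps_to_fls (Abs_fps (\<lambda>i. \<gamma> i n))) i)" for i
    by (rule coherent_add[OF lcoherentD[OF lcoherent_X_inv] lcoherentD[OF lcoherent_fps[OF assms]]])
  thus ?thesis by (simp add: lcoherent_def zeta_series_def del: fps_to_fls_nth) simp
qed

lemma ex_power_series_iff:
  "(\<exists>g\<in>power_series (R_hat p). \<zeta> = laurent_t_inv (R_hat p) \<oplus>\<^bsub>laurent_ring (R_hat p)\<^esub> g) \<longleftrightarrow>
   (\<exists>\<gamma>. (\<forall>i. coherent (\<gamma> i)) \<and> \<zeta> = laurent_of (zeta_series \<gamma>))"
proof -
  have t: "laurent_t_inv (R_hat p) = laurent_of (\<lambda>_. fls_X_inv)"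
    by (auto simp: laurent_t_inv_def laurent_of_def R_hat_one R_hat_zero)
  have add: "laurent_t_inv (R_hat p) \<oplus>\<^bsub>laurent_ring (R_hat p)\<^esub> laurent_of (\<lambda>n. fps_to_fls (Abs_fps (\<lambda>i. \<gamma> i n))) =
      laurent_of (zeta_series \<gamma>)" if "\<And>i. coherent (\<gamma> i)" for \<gamma>
    unfolding t laurent_of_add[OF lcoherent_X_inv lcoherent_fps[OF that]] zeta_series_def ..
  show ?thesis
  proof
    assume "\<exists>g\<in>power_series (R_hat p). \<zeta> = laurent_t_inv (R_hat p) \<oplus>\<^bsub>laurent_ring (R_hat p)\<^esub> g"
    then obtain g where g: "g \<in> power_series (R_hat p)"
      "\<zeta> = laurent_t_inv (R_hat p) \<oplus>\<^bsub>laurent_ring (R_hat p)\<^esub> g" by blast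
    have "\<forall>i. \<exists>r. coherent r \<and> g (int i) = hat_of r"
      using g(1) by (simp add: power_series_def flip: R_hat_carrier)
    then obtain \<gamma> where \<gamma>: "\<And>i. coherent (\<gamma> i)" "\<And>i. g (int i) = hat_of (\<gamma> i)"
      using choice[of "\<lambda>i r. coherent r \<and> g (int i) = hat_of r"] by blast
    have "g = laurent_of (\<lambda>n. fps_to_fls (Abs_fps (\<lambda>i. \<gamma> i n)))"
    proof
      fix i :: int
      show "g i = laurent_of (\<lambda>n. fps_to_fls (Abs_fps (\<lambda>i. \<gamma> i n))) i"
      proof (cases "i < 0")
        case True
        thus ?thesis using g(1) by (simp add: power_series_def laurent_of_def R_hat_zero)
      next
        case False
        thus ?thesis using \<gamma>(2)[of "nat i"] by (simp add: laurent_of_def)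
      qed
    qed
    hence "\<zeta> = laurent_of (zeta_series \<gamma>)" using g(2) add[OF \<gamma>(1)] by (simp only:)
    thus "\<exists>\<gamma>. (\<forall>i. coherent (\<gamma> i)) \<and> \<zeta> = laurent_of (zeta_series \<gamma>)"
      using \<gamma>(1) by blast
  next
    assume "\<exists>\<gamma>. (\<forall>i. coherent (\<gamma> i)) \<and> \<zeta> = laurent_of (zeta_series \<gamma>)"
    then obtain \<gamma> where \<gamma>: "\<And>i. coherent (\<gamma> i)" "\<zeta> = laurent_of (zeta_series \<gamma>)" by blast
    have "laurent_of (\<lambda>n. fps_to_fls (Abs_fps (\<lambda>i. \<gamma> i n))) \<in> power_series (R_hat p)"
      using hat_of_carrier[OF lcoherentD[OF lcoherent_fps[OF \<gamma>(1)]]]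
      by (simp add: power_series_def laurent_of_def R_hat_zero)
    thus "\<exists>g\<in>power_series (R_hat p). \<zeta> = laurent_t_inv (R_hat p) \<oplus>\<^bsub>laurent_ring (R_hat p)\<^esub> g"
      by (rule bexI[rotated]) (simp only: add[OF \<gamma>(1)] \<gamma>(2))
  qed
qed

lemma fls_mult_fls_fract_pB:
  assumes "\<And>i. fls_nth f i \<in> pB n"
  shows "fls_nth (f * fls_fract g) i \<in> pB n"
proof -
  have "fls_nth (f * fls_fract g) i =
      (\<Sum>j=fls_subdegree f..i - fls_subdegree g. fls_nth f j * fls_nth (fls_fract g) (i - j))"
    by (intro fls_times_nth_bounds) auto
  also have "\<dots> \<in> pB n" by (intro pB_sum pB_mult assms) (simp add: B_to_fract)
  finally show ?thesis .
qed

text \<open>After multiplication by the unit W, the pole -t^-2 of the derivative of 1/t cancels the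
  pole t^-2 of x W, and a power series identity remains.\<close>

lemma D_hat_eq_iff:
  assumes \<gamma>: "\<And>i. coherent (\<gamma> i)" and b: "coherent b"
  shows "D_hat p (laurent_of (zeta_series \<gamma>)) \<oplus>\<^bsub>laurent_ring (R_hat p)\<^esub> expand_R_hat p x_exp
      = laurent_const (R_hat p) (hat_of b) \<longleftrightarrow>
    (\<forall>n i. of_nat (Suc i) * \<gamma> (Suc i) n + En i - b n * Wn i \<in> pB n)"
proof -
  define V where "V = fls_fract W_inv_exp"
  define W where "W = fls_fract W_exp"
  define x where "x = fls_fract x_exp"
  have WV: "W * V = 1"
    unfolding W_def V_def fls_fract_mult[symmetric] W_inv_exp by (rule fls_fract_1)
  note cz = lcoherent_zeta[OF \<gamma>]
  note cd = lcoherent_deriv[OF cz]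
  define F where "F = (\<lambda>n. fls_deriv (zeta_series \<gamma> n) * V + x - fls_const (b n))"
  have const: "laurent_const (R_hat p) (hat_of b) = laurent_of (\<lambda>n. fls_const (b n))"
    by (auto simp: laurent_const_def laurent_of_def R_hat_zero)
  have D: "D_hat p (laurent_of (zeta_series \<gamma>)) = laurent_of (\<lambda>n. fls_deriv (zeta_series \<gamma> n) * V)"
    unfolding D_hat_def laurent_of_deriv[OF cz] expand_R_hat_eq V_def
    by (rule laurent_of_mult[OF cd lcoherent_fls_fract])
  have cDV: "lcoherent (-2 + fls_subdegree W_inv_exp) (\<lambda>n. fls_deriv (zeta_series \<gamma> n) * V)"
    unfolding lcoherent_def
  proof (intro conjI allI impI)
    have nth: "fls_nth (fls_deriv (zeta_series \<gamma> n) * V) i =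
        (\<Sum>j=-2..i - fls_subdegree W_inv_exp. fls_nth (fls_deriv (zeta_series \<gamma> n)) j * fls_nth V (i - j))"
      for n i
      using cd unfolding V_def lcoherent_def by (intro fls_times_nth_bounds) auto
    show "coherent (\<lambda>n. fls_nth (fls_deriv (zeta_series \<gamma> n) * V) i)" for i
      unfolding nth unfolding V_def
      by (intro coherent_sum coherent_mult coherent_const lcoherentD[OF cd]) (simp add: B_to_fract)
    show "fls_nth (fls_deriv (zeta_series \<gamma> n) * V) i = 0" if "i < -2 + fls_subdegree W_inv_exp" for n i
      unfolding nth using that by (intro sum.neutral) auto
  qed
  have FW: "F n * W = fps_to_fls (fps_deriv (Abs_fps (\<lambda>i. \<gamma> i n)) + Abs_fps En - fps_const (b n) * Abs_fps Wn)" for n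
  proof -
    have "F n * W = fls_deriv (zeta_series \<gamma> n) * (W * V) + x * W - fls_const (b n) * W"
      by (simp add: F_def algebra_simps)
    also have "x * W = fls_X_inv ^ 2 + fps_to_fls (Abs_fps En)"
      unfolding x_def W_def fls_fract_mult[symmetric] by (rule fls_fract_xW)
    also have "fls_deriv (zeta_series \<gamma> n) = - (fls_X_inv ^ 2) + fps_to_fls (fps_deriv (Abs_fps (\<lambda>i. \<gamma> i n)))"
      by (simp add: zeta_series_def fls_deriv_fps_to_fls)
    finally show ?thesis
      unfolding WV unfolding W_def fls_fract_W
      by (simp add: fls_times_fps_to_fls flip: fps_const_to_fls)
  qed
  have "D_hat p (laurent_of (zeta_series \<gamma>)) \<oplus>\<^bsub>laurent_ring (R_hat p)\<^esub> expand_R_hat p x_exp =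
      laurent_of (\<lambda>n. fls_deriv (zeta_series \<gamma> n) * V + x)"
    unfolding D expand_R_hat_eq x_def by (rule laurent_of_add[OF cDV lcoherent_fls_fract])
  hence "D_hat p (laurent_of (zeta_series \<gamma>)) \<oplus>\<^bsub>laurent_ring (R_hat p)\<^esub> expand_R_hat p x_exp
      = laurent_const (R_hat p) (hat_of b) \<longleftrightarrow> (\<forall>n i. fls_nth (F n) i \<in> pB n)"
    unfolding const F_def laurent_of_eq_iff[symmetric] by simp
  \<comment> \<open>W and its inverse V both have coefficients from R, so multiplying by either
    preserves membership in p^n R_H.\<close>
  also have "\<dots> \<longleftrightarrow> (\<forall>n i. fls_nth (F n * W) i \<in> pB n)"
  proof
    assume "\<forall>n i. fls_nth (F n) i \<in> pB n"
    thus "\<forall>n i. fls_nth (F n * W) i \<in> pB n"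
      unfolding W_def using fls_mult_fls_fract_pB by blast
  next
    assume "\<forall>n i. fls_nth (F n * W) i \<in> pB n"
    hence "\<forall>n i. fls_nth (F n * W * V) i \<in> pB n"
      unfolding V_def using fls_mult_fls_fract_pB by blast
    thus "\<forall>n i. fls_nth (F n) i \<in> pB n" by (simp add: mult.assoc WV)
  qed
  also have "\<dots> \<longleftrightarrow> (\<forall>n i. of_nat (Suc i) * \<gamma> (Suc i) n + En i - b n * Wn i \<in> pB n)"
  proof -
    have nth: "fls_nth (F n * W) i = (if i < 0 then 0 else
        of_nat (Suc (nat i)) * \<gamma> (Suc (nat i)) n + En (nat i) - b n * Wn (nat i))" for n i
      unfolding FW fps_to_fls_nth by simp
    show ?thesis
    proof (intro iffI allI)
      fix n i assume "\<forall>n i. fls_nth (F n * W) i \<in> pB n"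
      hence "fls_nth (F n * W) (int i) \<in> pB n" by blast
      thus "of_nat (Suc i) * \<gamma> (Suc i) n + En i - b n * Wn i \<in> pB n" unfolding nth by simp
    next
      fix n i assume "\<forall>n i. of_nat (Suc i) * \<gamma> (Suc i) n + En i - b n * Wn i \<in> pB n"
      thus "fls_nth (F n * W) i \<in> pB n" unfolding nth using pB_0 by (simp only: split: if_split) blast
    qed
  qed
  finally show ?thesis .
qed

lemma ex_zeta:
  "\<exists>\<gamma> b. (\<forall>i. coherent (\<gamma> i)) \<and> coherent b \<and> (\<forall>i n. even i \<longrightarrow> \<gamma> i n = 0) \<and>
     (\<forall>n i. of_nat (Suc i) * \<gamma> (Suc i) n + En i - b n * Wn i \<in> pB n)"
proof -
  have "\<forall>k. \<exists>\<beta>. \<beta> \<in> B \<and> (\<forall>n j. j \<le> k \<longrightarrow> p ^ j dvd Suc n \<longrightarrow> En n - \<beta> * Wn n \<in> pB j)"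
    using ex_unit_root_approx by blast
  from choice[OF this] obtain b where b: "\<And>k. b k \<in> B"
    "\<And>k n j. j \<le> k \<Longrightarrow> p ^ j dvd Suc n \<Longrightarrow> En n - b k * Wn n \<in> pB j"
    by blast
  have cb: "coherent b"
    unfolding coherent_def
  proof (intro conjI allI)
    fix k
    show "b (Suc k) - b k \<in> pB k"
    proof (rule pB_of_Wn)
      fix n j assume j: "j \<le> k" "p ^ j dvd Suc n"
      \<comment> \<open>Both b k and b (k + 1) make the form exact to level k, so their difference
        times W is exact to that level and uniqueness applies.\<close>
      have "(En n - b k * Wn n) - (En n - b (Suc k) * Wn n) \<in> pB j"
        by (rule pB_diff[OF b(2)[OF j] b(2)[OF le_SucI[OF j(1)] j(2)]])
      thus "(b (Suc k) - b k) * Wn n \<in> pB j" by (simp add: algebra_simps)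
    qed (intro B_diff b(1))
  qed (rule b(1))
  have "\<forall>i. \<exists>g. coherent g \<and> (odd i \<longrightarrow> g = (\<lambda>_. 0)) \<and>
      (\<forall>n. of_nat (Suc i) * g n + En i - b n * Wn i \<in> pB n)" (is "\<forall>i. ?P i")
  proof
    fix i show "?P i"
    proof (cases "odd i")
      case True
      \<comment> \<open>For odd i both coefficients \<open>En i\<close> and \<open>Wn i\<close>
        vanish, so the coefficient of the even power t^(i+1) can be exactly 0.\<close>
      thus ?thesis
        by (intro exI[of _ "\<lambda>_. 0"]) (simp add: coherent_const B_0 En_odd Wn_odd pB_0)
    next
      case False
      obtain v where cancel: "\<And>N x. x \<in> B \<Longrightarrow> of_nat (Suc i) * x \<in> pB (N + v) \<Longrightarrow> x \<in> pB N"
        and quot: "\<And>k c. v \<le> k \<Longrightarrow> c \<in> pB v \<Longrightarrow> \<exists>q\<in>B. of_nat (Suc i) * q - c \<in> pB k"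
        and v: "p ^ v dvd Suc i"
        by (rule pB_of_nat_mult_cancel[OF zero_less_Suc[of i]]) (rule that)
      \<comment> \<open>Solving (i + 1) g = c loses v powers of p, hence beta is taken at level N +
        v.\<close>
      define c where "c = (\<lambda>N. b (N + v) * Wn i - En i)"
      have "c N \<in> pB v" for N
        using pB_uminus[OF b(2)[of v "N + v", OF _ v]] by (simp add: c_def)
      hence "\<forall>N. \<exists>q. q \<in> B \<and> of_nat (Suc i) * q - c N \<in> pB (N + v)"
        using quot[OF le_add2] by blast
      from choice[OF this] obtain g
        where g: "\<And>N. g N \<in> B" "\<And>N. of_nat (Suc i) * g N - c N \<in> pB (N + v)"
        by blast
      have "coherent g"
        unfolding coherent_def
      proof (intro conjI allI g(1))
        fix N
        have "(of_nat (Suc i) * g (Suc N) - c (Suc N)) - (of_nat (Suc i) * g N - c N)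
            + (b (Suc (N + v)) - b (N + v)) * Wn i \<in> pB (N + v)"
        proof (rule pB_add[OF pB_diff[OF _ g(2)] pB_mult[OF _ Wn_B]])
          show "of_nat (Suc i) * g (Suc N) - c (Suc N) \<in> pB (N + v)"
            by (rule pB_mono[OF _ g(2)]) simp
          show "b (Suc (N + v)) - b (N + v) \<in> pB (N + v)" using cb by (simp add: coherent_def)
        qed
        hence "of_nat (Suc i) * (g (Suc N) - g N) \<in> pB (N + v)"
          by (simp add: c_def algebra_simps)
        thus "g (Suc N) - g N \<in> pB N" by (rule cancel[OF B_diff[OF g(1) g(1)]])
      qed
      moreover have "of_nat (Suc i) * g N + En i - b N * Wn i \<in> pB N" for N
      proof -
        have "(of_nat (Suc i) * g N - c N) + (b (N + v) - b N) * Wn i \<in> pB N"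
          by (rule pB_add[OF pB_mono[OF le_add1 g(2)] pB_mult[OF coherent_diff_pB[OF cb le_add1] Wn_B]])
        thus ?thesis by (simp add: c_def algebra_simps)
      qed
      ultimately show ?thesis using False by blast
    qed
  qed
  from choice[OF this] obtain g where g: "\<And>i. coherent (g i)" "\<And>i. odd i \<Longrightarrow> g i = (\<lambda>_. 0)"
    "\<And>i n. of_nat (Suc i) * g i n + En i - b n * Wn i \<in> pB n"
    by blast
  \<comment> \<open>The derivation does not see the constant term; 0 is the choice that makes zeta
    odd.\<close>
  define \<gamma> where "\<gamma> = (\<lambda>i. case i of 0 \<Rightarrow> (\<lambda>_. 0) | Suc j \<Rightarrow> g j)"
  have "coherent (\<gamma> i)" for i
    using g(1) by (cases i) (simp_all add: \<gamma>_def coherent_const B_0)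
  moreover have "\<gamma> i n = 0" if "even i" for i n
    using that g(2) by (cases i) (simp_all add: \<gamma>_def)
  moreover have "of_nat (Suc i) * \<gamma> (Suc i) n + En i - b n * Wn i \<in> pB n" for i n
    using g(3) by (simp add: \<gamma>_def)
  ultimately show ?thesis using cb by blast
qed

text \<open>The difference satisfies (i + 1) \<delta> = (b - b') W up to p^n. The left side is
  exact, so b - b' vanishes in the limit by \<open>pB_of_Wn\<close>, and then i + 1 is cancelled.
  The constant term is not covered, as the derivation kills it.\<close>

lemma zeta_coeff_unique:
  assumes \<gamma>: "\<And>i. coherent (\<gamma> i)" "\<And>i. coherent (\<gamma>' i)" and b: "coherent b" "coherent b'"
    and eq: "\<And>n i. of_nat (Suc i) * \<gamma> (Suc i) n + En i - b n * Wn i \<in> pB n"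
      "\<And>n i. of_nat (Suc i) * \<gamma>' (Suc i) n + En i - b' n * Wn i \<in> pB n"
  shows "\<gamma> (Suc i) n - \<gamma>' (Suc i) n \<in> pB n"
proof -
  define \<delta> where "\<delta> = (\<lambda>i n. \<gamma> (Suc i) n - \<gamma>' (Suc i) n)"
  have \<delta>: "coherent (\<delta> i)" for i
    unfolding \<delta>_def diff_conv_add_uminus
    by (rule coherent_add[OF \<gamma>(1) coherent_uminus[OF \<gamma>(2)]])
  have eq': "of_nat (Suc i) * \<delta> i n - (b n - b' n) * Wn i \<in> pB n" for i n
    using pB_diff[OF eq(1)[where i = i and n = n] eq(2)[where i = i and n = n]] by (simp add: \<delta>_def algebra_simps)
  have d: "b k - b' k \<in> pB k" for k
  proof (rule pB_of_Wn)
    show "b k - b' k \<in> B" by (rule B_diff[OF coherentD[OF b(1)] coherentD[OF b(2)]])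
    fix n j assume j: "j \<le> k" "p ^ j dvd Suc n"
    from j(2) obtain m where m: "Suc n = p ^ j * m" by (elim dvdE)
    have "of_nat (Suc n) * \<delta> n k = of_nat p ^ j * (of_nat m * \<delta> n k)"
      unfolding m by (simp add: mult.assoc)
    also have "\<dots> \<in> pB j" by (rule pBI[OF B_mult[OF B_of_nat coherentD[OF \<delta>]]])
    finally have "of_nat (Suc n) * \<delta> n k - (of_nat (Suc n) * \<delta> n k - (b k - b' k) * Wn n) \<in> pB j"
      by (rule pB_diff[OF _ pB_mono[OF j(1) eq']])
    thus "(b k - b' k) * Wn n \<in> pB j" by simp
  qed
  have "of_nat (Suc i) * \<delta> i n \<in> pB n" for n
    using pB_add[OF eq'[of i n] pB_mult[OF d Wn_B[of i]]] by simp
  moreover obtain v where "\<And>N x. x \<in> B \<Longrightarrow> of_nat (Suc i) * x \<in> pB (N + v) \<Longrightarrow> x \<in> pB N"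
    by (rule pB_of_nat_mult_cancel[OF zero_less_Suc[of i]]) (rule that)
  \<comment> \<open>Cancelling costs v levels, so it is done at level n + v, and coherence leads
    back to level n.\<close>
  ultimately have "\<delta> i (n + v) \<in> pB n"
    using coherentD[OF \<delta>] by blast
  from pB_diff[OF this coherent_diff_pB[OF \<delta>[of i] le_add1[of n v]]] show ?thesis
    by (simp add: \<delta>_def)
qed

theorem ex1_zeta:
  "\<exists>!\<zeta>. (\<exists>g \<in> power_series (R_hat p).
            \<zeta> = laurent_t_inv (R_hat p) \<oplus>\<^bsub>laurent_ring (R_hat p)\<^esub> g) \<and>
         laurent_odd (R_hat p) \<zeta> \<and>
         (\<exists>\<beta> \<in> carrier (R_hat p).
            D_hat p \<zeta> \<oplus>\<^bsub>laurent_ring (R_hat p)\<^esub> expand_R_hat p x_exp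
              = laurent_const (R_hat p) \<beta>)"
proof -
  have odd_iff: "laurent_odd (R_hat p) (laurent_of (zeta_series \<gamma>)) \<longleftrightarrow> (\<forall>i n. even i \<longrightarrow> \<gamma> i n \<in> pB n)"
    if "\<And>i. coherent (\<gamma> i)" for \<gamma>
  proof -
    have nth: "fls_nth (zeta_series \<gamma> n) i = (if i < 0 then 0 else \<gamma> (nat i) n)" if "even i" for i n
      using that by (auto simp: zeta_series_def)
    show ?thesis
      unfolding laurent_odd_laurent_of_iff[OF lcoherent_zeta[OF that]]
    proof (intro iffI allI impI)
      fix i n assume *: "\<forall>i n. even i \<longrightarrow> fls_nth (zeta_series \<gamma> n) i \<in> pB n" and "even (i :: nat)"
      thus "\<gamma> i n \<in> pB n" using nth[of "int i" n] *[rule_format, of "int i" n] by simp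
    next
      fix i n assume *: "\<forall>i n. even i \<longrightarrow> \<gamma> i n \<in> pB n" and i: "even (i :: int)"
      show "fls_nth (zeta_series \<gamma> n) i \<in> pB n"
        unfolding nth[OF i] using * i by (auto simp: pB_0 even_nat_iff)
    qed
  qed
  obtain \<gamma> b where \<gamma>b: "\<forall>i. coherent (\<gamma> i)" "coherent b" "\<forall>i n. even i \<longrightarrow> \<gamma> i n = 0"
    "\<forall>n i. of_nat (Suc i) * \<gamma> (Suc i) n + En i - b n * Wn i \<in> pB n"
    using ex_zeta by (elim exE conjE)
  note \<gamma> = \<gamma>b(1)[rule_format] and b = \<gamma>b(2) and even = \<gamma>b(3)[rule_format]
    and eq = \<gamma>b(4)[rule_format]
  show ?thesis
  proof (rule ex1I[of _ "laurent_of (zeta_series \<gamma>)"], intro conjI)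
    show "\<exists>g \<in> power_series (R_hat p).
        laurent_of (zeta_series \<gamma>) = laurent_t_inv (R_hat p) \<oplus>\<^bsub>laurent_ring (R_hat p)\<^esub> g"
      unfolding ex_power_series_iff using \<gamma> by blast
    show "laurent_odd (R_hat p) (laurent_of (zeta_series \<gamma>))"
      unfolding odd_iff[OF \<gamma>] by (simp add: even pB_0)
    show "\<exists>\<beta> \<in> carrier (R_hat p). D_hat p (laurent_of (zeta_series \<gamma>)) \<oplus>\<^bsub>laurent_ring (R_hat p)\<^esub>
        expand_R_hat p x_exp = laurent_const (R_hat p) \<beta>"
    proof (rule bexI[OF _ hat_of_carrier[OF b]])
      show "D_hat p (laurent_of (zeta_series \<gamma>)) \<oplus>\<^bsub>laurent_ring (R_hat p)\<^esub>
          expand_R_hat p x_exp = laurent_const (R_hat p) (hat_of b)"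
        unfolding D_hat_eq_iff[OF \<gamma> b] using eq by blast
    qed
  next
    fix \<zeta> assume *: "(\<exists>g \<in> power_series (R_hat p).
            \<zeta> = laurent_t_inv (R_hat p) \<oplus>\<^bsub>laurent_ring (R_hat p)\<^esub> g) \<and>
         laurent_odd (R_hat p) \<zeta> \<and>
         (\<exists>\<beta> \<in> carrier (R_hat p).
            D_hat p \<zeta> \<oplus>\<^bsub>laurent_ring (R_hat p)\<^esub> expand_R_hat p x_exp
              = laurent_const (R_hat p) \<beta>)"
    obtain \<gamma>' where \<gamma>': "\<And>i. coherent (\<gamma>' i)" "\<zeta> = laurent_of (zeta_series \<gamma>')"
      using *[THEN conjunct1] unfolding ex_power_series_iff by blast
    obtain \<beta> where \<beta>: "\<beta> \<in> carrier (R_hat p)"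
      "D_hat p \<zeta> \<oplus>\<^bsub>laurent_ring (R_hat p)\<^esub> expand_R_hat p x_exp = laurent_const (R_hat p) \<beta>"
      using *[THEN conjunct2, THEN conjunct2] by (elim bexE)
    then obtain b' where b': "coherent b'" "\<beta> = hat_of b'" unfolding R_hat_carrier by blast
    have eq': "of_nat (Suc i) * \<gamma>' (Suc i) n + En i - b' n * Wn i \<in> pB n" for i n
      using \<beta>(2) unfolding \<gamma>'(2) b'(2) D_hat_eq_iff[OF \<gamma>'(1) b'(1)] by blast
    have "laurent_odd (R_hat p) (laurent_of (zeta_series \<gamma>'))"
      using *[THEN conjunct2, THEN conjunct1] unfolding \<gamma>'(2) .
    \<comment> \<open>Oddness settles the constant coefficient, which the equation leaves
      free.\<close>
    hence "\<gamma>' 0 n \<in> pB n" for n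
      unfolding odd_iff[OF \<gamma>'(1)] by simp
    hence "\<gamma>' i n - \<gamma> i n \<in> pB n" for i n
      using zeta_coeff_unique[OF \<gamma>'(1) \<gamma> b'(1) b eq' eq] by (cases i) (simp_all add: even)
    thus "\<zeta> = laurent_of (zeta_series \<gamma>)"
      unfolding \<gamma>'(2) laurent_of_eq_iff by (simp add: zeta_series_def pB_0)
  qed
qed

end

theorem theorem2:
  fixes p :: nat
  assumes "prime p" and "p > 3"
  shows "\<exists>!\<zeta>. (\<exists>g \<in> power_series (R_hat p).
                \<zeta> = laurent_t_inv (R_hat p) \<oplus>\<^bsub>laurent_ring (R_hat p)\<^esub> g) \<and>
             laurent_odd (R_hat p) \<zeta> \<and>
             (\<exists>\<beta> \<in> carrier (R_hat p).
                D_hat p \<zeta> \<oplus>\<^bsub>laurent_ring (R_hat p)\<^esub> expand_R_hat p x_exp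
                  = laurent_const (R_hat p) \<beta>)"
  by (intro hasse_completion.ex1_zeta hasse_completion.intro assms)

end
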